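(* For each universal by adjunction machine $U_0$ there exists another universal by adjunction machine $U_1$ such that for all left-c.e. reals $\beta$ and all right-c.e. reals $\beta$ we have $\Omega_{U_0}\neq\Omega_{U_1}+\beta$.
   Context: A real $x$ is left-c.e. if its left Dedekind cut $\{q\in\mathbb{Q}: q<x\}$ is computably enumerable, and right-c.e. if its right Dedekind cut $\{q\in\mathbb{Q}: q>x\}$ is computably enumerable. Machines are Turing machines operating on finite binary strings, i.e. partial computable functions from finite binary strings to finite binary strings. Given an effective list $(M_e)_{e\in\mathbb{N}}$ of all Turing machines, a Turing machine $U$ is universal (by adjunction) if there exists a computable function $e\mapsto\sigma_e$ from numbers to strings such that $U(\sigma_e\ast\tau)=M_e(\tau)$ for all $e$ and all strings $\tau$, where $\ast$ denotes concatenation and equality means that both sides are undefined or both are defined and equal. A similar definition applies to universal prefix-free machines, with everything restricted to Turing machines with prefix-free domain (no string in the domain is a proper prefix of another string in the domain). The statement is for machines in general, covering both the plain and the prefix-free setting. $\Omega_U$ denotes the halting probability of $U$, i.e. the probability that $U$ halts on some prefix of a uniformly random infinite binary sequence; for prefix-free $U$ this is $\sum_{\sigma\in\mathrm{dom}(U)}2^{-|\sigma|}$. It is taken as known that, whether one considers prefix-free machines or plain Turing machines, the halting probabilities of universal machines are exactly the Martin-Löf random left-c.e. reals (as reals in $(0,1)$). Here a real is Martin-Löf random if it belongs to no set $\bigcap_n V_n$ where $(V_n)$ is a uniformly computably enumerable sequence of open sets with $V_n$ of measure at most $2^{-n}$ for each $n$.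
   Formalization: For plain machines, U_0 is assumed to have a Martin-Löf random halting probability (and U_1 is shown to have one too): a plain machine universal by adjunction may halt on the empty string, so that its halting probability is 1, and then the claim fails. *)

theory Defs
  imports "HOL-Probability.Probability" "HOL-Library.Sublist" "HOL-Library.Countable"
begin

section \<open>Partial recursive functions\<close>

text \<open>Turing computability is rendered by the mu-recursive functions.  \<open>rec_eval f xs y\<close> means
  that the program \<open>f\<close> halts on the argument list \<open>xs\<close> with value \<open>y\<close>.\<close>

datatype recf = Zero | Succ | Proj nat | Comp recf "recf list" | PrimRec recf recf | Mu recf

inductive rec_eval :: "recf \<Rightarrow> nat list \<Rightarrow> nat \<Rightarrow> bool" where
  zero: "rec_eval Zero xs 0"
| succ: "rec_eval Succ [x] (Suc x)"
| proj: "i < length xs \<Longrightarrow> rec_eval (Proj i) xs (xs ! i)"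
| comp: "list_all2 (\<lambda>g y. rec_eval g xs y) gs ys \<Longrightarrow> rec_eval f ys z
    \<Longrightarrow> rec_eval (Comp f gs) xs z"
| primrec_0: "rec_eval f xs y \<Longrightarrow> rec_eval (PrimRec f g) (0 # xs) y"
| primrec_Suc: "rec_eval (PrimRec f g) (n # xs) r \<Longrightarrow> rec_eval g (n # r # xs) y
    \<Longrightarrow> rec_eval (PrimRec f g) (Suc n # xs) y"
| mu: "rec_eval f (n # xs) 0 \<Longrightarrow> \<forall>m<n. \<exists>k. rec_eval f (m # xs) (Suc k)
    \<Longrightarrow> rec_eval (Mu f) xs n"

definition ce_set :: "nat set \<Rightarrow> bool" where
  "ce_set A \<longleftrightarrow> (\<exists>f. \<forall>x. x \<in> A \<longleftrightarrow> (\<exists>y. rec_eval f [x] y))"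


section \<open>Left-c.e., right-c.e. and random reals\<close>

text \<open>The rationals are coded by the library surjection \<^term>\<open>nat_to_rat_surj\<close>; a set of rationals is
  c.e. iff its set of codes is.\<close>

definition ce_rat_set :: "rat set \<Rightarrow> bool" where
  "ce_rat_set Q \<longleftrightarrow> ce_set {n. nat_to_rat_surj n \<in> Q}"

definition left_ce :: "real \<Rightarrow> bool" where
  "left_ce x \<longleftrightarrow> ce_rat_set {q. of_rat q < x}"

definition right_ce :: "real \<Rightarrow> bool" where
  "right_ce x \<longleftrightarrow> ce_rat_set {q. of_rat q > x}"

definition uniformly_ce_open :: "(nat \<Rightarrow> real set) \<Rightarrow> bool" where
  "uniformly_ce_open V \<longleftrightarrow> (\<exists>W. ce_set W \<and>
     (\<forall>n. V n = \<Union>{ {of_rat (nat_to_rat_surj a) <..< of_rat (nat_to_rat_surj b)} | a b.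
                   prod_encode (n, prod_encode (a, b)) \<in> W }))"

definition ml_random :: "real \<Rightarrow> bool" where
  "ml_random x \<longleftrightarrow> \<not> (\<exists>V. uniformly_ce_open V \<and>
     (\<forall>n. emeasure lborel (V n) \<le> ennreal ((1/2) ^ n)) \<and> x \<in> (\<Inter>n. V n))"


section \<open>Machines\<close>

type_synonym machine = "bool list \<Rightarrow> bool list option"

text \<open>Bijective binary numeration, a bijection between strings and natural numbers.\<close>

fun str_code :: "bool list \<Rightarrow> nat" where
  "str_code [] = 0"
| "str_code (b # s) = 2 * str_code s + (if b then 2 else 1)"

definition turing_machine :: "machine \<Rightarrow> bool" where
  "turing_machine U \<longleftrightarrow> (\<exists>f. \<forall>\<tau> y.
     rec_eval f [str_code \<tau>] y \<longleftrightarrow> (\<exists>\<rho>. U \<tau> = Some \<rho> \<and> y = str_code \<rho>))"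

definition prefix_free_machine :: "machine \<Rightarrow> bool" where
  "prefix_free_machine U \<longleftrightarrow> turing_machine U \<and>
     (\<forall>\<sigma>\<in>dom U. \<forall>\<tau>\<in>dom U. \<not> strict_prefix \<sigma> \<tau>)"

text \<open>Below, \<open>K\<close> is a class of machines, to be instantiated with \<^const>\<open>turing_machine\<close> or
  \<^const>\<open>prefix_free_machine\<close>.\<close>

definition effective_list :: "(machine \<Rightarrow> bool) \<Rightarrow> (nat \<Rightarrow> machine) \<Rightarrow> bool" where
  "effective_list K M \<longleftrightarrow> range M = Collect K \<and>
     (\<exists>f. \<forall>e \<tau> y. rec_eval f [e, str_code \<tau>] y \<longleftrightarrow> (\<exists>\<rho>. M e \<tau> = Some \<rho> \<and> y = str_code \<rho>))"

definition computable_strings :: "(nat \<Rightarrow> bool list) \<Rightarrow> bool" where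
  "computable_strings \<sigma> \<longleftrightarrow> (\<exists>f. \<forall>e y. rec_eval f [e] y \<longleftrightarrow> y = str_code (\<sigma> e))"

definition universal_by_adjunction ::
    "(machine \<Rightarrow> bool) \<Rightarrow> (nat \<Rightarrow> machine) \<Rightarrow> machine \<Rightarrow> bool" where
  "universal_by_adjunction K M U \<longleftrightarrow> K U \<and>
     (\<exists>\<sigma>. computable_strings \<sigma> \<and> (\<forall>e \<tau>. U (\<sigma> e @ \<tau>) = M e \<tau>))"

text \<open>The measure is that of fair coin tosses; for a prefix-free machine it is the sum of the weights
  \<open>2 powr - length \<sigma>\<close> over the domain.  Pitfall: a plain machine that is universal by
  adjunction may also halt on a prefix of every adjoined string (for example on the empty string),
  and then its halting probability need not be random.\<close>

definition halting_probability :: "machine \<Rightarrow> real" where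
  "halting_probability U =
     measure (stream_space (measure_pmf (bernoulli_pmf (1/2)))) {\<omega>. \<exists>n. stake n \<omega> \<in> dom U}"

end

theory Submission
  imports Defs
begin

text \<open>The difference \<open>\<Omega> U\<^sub>0 - \<Omega> U\<^sub>1\<close> is arranged to be \<open>2^-k (y - x)\<close>, where \<open>x, y\<close> are
  left-c.e. reals, obtained by diagonalization, such that no \<open>2^-k (y - x)\<close> is left-c.e. or
  right-c.e.

  Prefix-free machines: some string \<open>\<sigma>\<close> makes \<open>U\<^sub>0\<close> act on \<open>\<sigma>1\<tau>\<close> as \<open>U\<^sub>0\<close> acts on \<open>\<tau>\<close>, while
  below \<open>\<sigma>0\<close> it halts with probability \<open>y\<close>; replacing the latter part by a machine of halting
  probability \<open>x\<close> leaves the machine universal.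

  Plain machines: \<open>U\<^sub>0\<close> may already halt on a prefix of every adjoined string, so nothing can be
  replaced. But \<open>\<alpha> = \<Omega> U\<^sub>0\<close> is random, hence by the argument of Kucera and Slaman
  \<open>\<alpha> - 2^-n y\<close> is left-c.e. for large \<open>n\<close>, and so is the rest \<open>w\<close> in
  \<open>\<beta> = \<alpha> - 2^-(n+1) (y - x) = \<alpha>/2 + w\<close>. By an argument of Demuth \<open>\<beta>\<close> is random, and it is the
  halting probability of a machine that simulates \<open>U\<^sub>0\<close> inside a cylinder on which it halts anyway.
  Both arguments build a Martin-Loef test whose measure is bounded by Vitali's covering lemma.\<close>


section \<open>Total recursive functions\<close>

definition total_rec :: "nat \<Rightarrow> (nat list \<Rightarrow> nat) \<Rightarrow> bool" where
  "total_rec k F \<longleftrightarrow> (\<exists>f. \<forall>xs. length xs = k \<longrightarrow> rec_eval f xs (F xs))"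

lemma total_rec_cong:
  assumes "\<And>xs. length xs = k \<Longrightarrow> F xs = G xs" "total_rec k F"
  shows "total_rec k G"
  using assms unfolding total_rec_def by metis

lemma total_rec_nth: "i < k \<Longrightarrow> total_rec k (\<lambda>xs. xs ! i)"
  unfolding total_rec_def by (metis rec_eval.proj)

lemma total_rec_list_comp:
  assumes F: "total_rec (length Gs) F" and Gs: "\<And>G. G \<in> set Gs \<Longrightarrow> total_rec k G"
  shows "total_rec k (\<lambda>xs. F (map (\<lambda>G. G xs) Gs))"
proof -
  obtain f where f: "\<And>xs. length xs = length Gs \<Longrightarrow> rec_eval f xs (F xs)"
    using F unfolding total_rec_def by blast
  obtain c where c: "\<And>G xs. G \<in> set Gs \<Longrightarrow> length xs = k \<Longrightarrow> rec_eval (c G) xs (G xs)"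
    using Gs unfolding total_rec_def by metis
  have "rec_eval (Comp f (map c Gs)) xs (F (map (\<lambda>G. G xs) Gs))" if "length xs = k" for xs
    by (rule rec_eval.comp[where ys = "map (\<lambda>G. G xs) Gs"])
      (auto simp: list_all2_conv_all_nth intro!: c f that)
  then show ?thesis unfolding total_rec_def by blast
qed

lemma total_rec_comp1:
  assumes "total_rec 1 (\<lambda>xs. f (hd xs))" "total_rec k G"
  shows "total_rec k (\<lambda>xs. f (G xs))"
  using total_rec_list_comp[of "[G]" "\<lambda>xs. f (hd xs)" k] assms by simp

lemma total_rec_comp2:
  assumes "total_rec 2 (\<lambda>xs. f (hd xs) (hd (tl xs)))" "total_rec k G" "total_rec k H"
  shows "total_rec k (\<lambda>xs. f (G xs) (H xs))"
  using total_rec_list_comp[of "[G, H]" "\<lambda>xs. f (hd xs) (hd (tl xs))" k] assms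
  by (auto simp: numeral_2_eq_2)

lemma total_rec_reindex:
  assumes "total_rec (length js) F" "\<And>j. j \<in> set js \<Longrightarrow> j < k"
  shows "total_rec k (\<lambda>xs. F (map (\<lambda>j. xs ! j) js))"
proof -
  have "total_rec k (\<lambda>xs. F (map (\<lambda>G. G xs) (map (\<lambda>j xs. xs ! j) js)))"
    using assms by (intro total_rec_list_comp) (auto intro: total_rec_nth)
  then show ?thesis by (simp add: comp_def)
qed

lemma total_rec_Cons_comp:
  assumes "total_rec (Suc k) (\<lambda>ys. F (hd ys) (tl ys))" "total_rec k G"
  shows "total_rec k (\<lambda>xs. F (G xs) xs)"
proof (rule total_rec_cong)
  let ?Gs = "G # map (\<lambda>i xs. xs ! i) [0..<k]"
  have "total_rec k H" if "H \<in> set ?Gs" for H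
    using that assms(2) by (auto intro: total_rec_nth)
  then show "total_rec k (\<lambda>xs. F (hd (map (\<lambda>G. G xs) ?Gs)) (tl (map (\<lambda>G. G xs) ?Gs)))"
    using total_rec_list_comp[of ?Gs "\<lambda>ys. F (hd ys) (tl ys)" k] assms(1) by simp
  show "F (hd (map (\<lambda>G. G xs) ?Gs)) (tl (map (\<lambda>G. G xs) ?Gs)) = F (G xs) xs"
    if "length xs = k" for xs
    using map_nth[of xs] that by (simp add: comp_def)
qed

lemma total_rec_tl:
  assumes "total_rec k F"
  shows "total_rec (Suc k) (\<lambda>xs. F (tl xs))"
proof (rule total_rec_cong)
  show "total_rec (Suc k) (\<lambda>xs. F (map (\<lambda>j. xs ! j) (map Suc [0..<k])))"
    using assms by (intro total_rec_reindex) auto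
  show "F (map (\<lambda>j. xs ! j) (map Suc [0..<k])) = F (tl xs)" if "length xs = Suc k" for xs
    using map_nth[of "tl xs"] that by (cases xs) (simp_all add: comp_def)
qed

text \<open>Arguments are written \<open>hd (tl \<dots>)\<close> because rules for binders, such as
  \<open>total_rec_sum\<close> below, turn an argument list \<open>xs\<close> into \<open>tl ys\<close>.\<close>

lemma total_rec_var:
  "0 < k \<Longrightarrow> total_rec k (\<lambda>xs. hd xs)"
  "1 < k \<Longrightarrow> total_rec k (\<lambda>xs. hd (tl xs))"
  "2 < k \<Longrightarrow> total_rec k (\<lambda>xs. hd (tl (tl xs)))"
  "3 < k \<Longrightarrow> total_rec k (\<lambda>xs. hd (tl (tl (tl xs))))"
  "4 < k \<Longrightarrow> total_rec k (\<lambda>xs. hd (tl (tl (tl (tl xs)))))"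
  "5 < k \<Longrightarrow> total_rec k (\<lambda>xs. hd (tl (tl (tl (tl (tl xs))))))"
  "6 < k \<Longrightarrow> total_rec k (\<lambda>xs. hd (tl (tl (tl (tl (tl (tl xs)))))))"
  "7 < k \<Longrightarrow> total_rec k (\<lambda>xs. hd (tl (tl (tl (tl (tl (tl (tl xs))))))))"
  "8 < k \<Longrightarrow> total_rec k (\<lambda>xs. hd (tl (tl (tl (tl (tl (tl (tl (tl xs)))))))))"
  "9 < k \<Longrightarrow> total_rec k (\<lambda>xs. hd (tl (tl (tl (tl (tl (tl (tl (tl (tl xs))))))))))"
proof -
  have v0: "0 < k \<Longrightarrow> total_rec k (\<lambda>xs. hd xs)" for k
    by (rule total_rec_cong[OF _ total_rec_nth[of 0]]) (auto simp: hd_conv_nth)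
  have v1: "1 < k \<Longrightarrow> total_rec k (\<lambda>xs. hd (tl xs))" for k
    using total_rec_tl[OF v0[of "k - 1"]] by simp
  have v2: "2 < k \<Longrightarrow> total_rec k (\<lambda>xs. hd (tl (tl xs)))" for k
    using total_rec_tl[OF v1[of "k - 1"]] by simp
  have v3: "3 < k \<Longrightarrow> total_rec k (\<lambda>xs. hd (tl (tl (tl xs))))" for k
    using total_rec_tl[OF v2[of "k - 1"]] by simp
  have v4: "4 < k \<Longrightarrow> total_rec k (\<lambda>xs. hd (tl (tl (tl (tl xs)))))" for k
    using total_rec_tl[OF v3[of "k - 1"]] by simp
  have v5: "5 < k \<Longrightarrow> total_rec k (\<lambda>xs. hd (tl (tl (tl (tl (tl xs))))))" for k
    using total_rec_tl[OF v4[of "k - 1"]] by simp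
  have v6: "6 < k \<Longrightarrow> total_rec k (\<lambda>xs. hd (tl (tl (tl (tl (tl (tl xs)))))))" for k
    using total_rec_tl[OF v5[of "k - 1"]] by simp
  have v7: "7 < k \<Longrightarrow> total_rec k (\<lambda>xs. hd (tl (tl (tl (tl (tl (tl (tl xs))))))))" for k
    using total_rec_tl[OF v6[of "k - 1"]] by simp
  have v8: "8 < k \<Longrightarrow> total_rec k (\<lambda>xs. hd (tl (tl (tl (tl (tl (tl (tl (tl xs)))))))))" for k
    using total_rec_tl[OF v7[of "k - 1"]] by simp
  have v9: "9 < k \<Longrightarrow> total_rec k (\<lambda>xs. hd (tl (tl (tl (tl (tl (tl (tl (tl (tl xs))))))))))" for k
    using total_rec_tl[OF v8[of "k - 1"]] by simp
  show "0 < k \<Longrightarrow> total_rec k (\<lambda>xs. hd xs)"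
    "1 < k \<Longrightarrow> total_rec k (\<lambda>xs. hd (tl xs))"
    "2 < k \<Longrightarrow> total_rec k (\<lambda>xs. hd (tl (tl xs)))"
    "3 < k \<Longrightarrow> total_rec k (\<lambda>xs. hd (tl (tl (tl xs))))"
    "4 < k \<Longrightarrow> total_rec k (\<lambda>xs. hd (tl (tl (tl (tl xs)))))"
    "5 < k \<Longrightarrow> total_rec k (\<lambda>xs. hd (tl (tl (tl (tl (tl xs))))))"
    "6 < k \<Longrightarrow> total_rec k (\<lambda>xs. hd (tl (tl (tl (tl (tl (tl xs)))))))"
    "7 < k \<Longrightarrow> total_rec k (\<lambda>xs. hd (tl (tl (tl (tl (tl (tl (tl xs))))))))"
    "8 < k \<Longrightarrow> total_rec k (\<lambda>xs. hd (tl (tl (tl (tl (tl (tl (tl (tl xs)))))))))"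
    "9 < k \<Longrightarrow> total_rec k (\<lambda>xs. hd (tl (tl (tl (tl (tl (tl (tl (tl (tl xs))))))))))"
    by (fact v0 v1 v2 v3 v4 v5 v6 v7 v8 v9)+
qed

lemma total_rec_Suc: "total_rec k F \<Longrightarrow> total_rec k (\<lambda>xs. Suc (F xs))"
proof (rule total_rec_comp1[where f = Suc])
  show "total_rec 1 (\<lambda>xs. Suc (hd xs))"
    unfolding total_rec_def by (auto simp: length_Suc_conv intro!: exI[of _ Succ] rec_eval.succ)
qed

lemma total_rec_const: "total_rec k (\<lambda>xs. c)"
proof (induction c)
  case 0
  show ?case unfolding total_rec_def by (auto intro: rec_eval.zero)
qed (rule total_rec_Suc)

lemma total_rec_primrec:
  assumes "total_rec k F" "total_rec (Suc (Suc k)) (\<lambda>ys. H (hd ys) (hd (tl ys)) (tl (tl ys)))"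
    "total_rec k N"
  shows "total_rec k (\<lambda>xs. rec_nat (F xs) (\<lambda>n r. H n r xs) (N xs))"
proof (rule total_rec_Cons_comp[OF _ assms(3), where F = "\<lambda>n xs. rec_nat (F xs) (\<lambda>n r. H n r xs) n"])
  obtain f where f: "\<And>xs. length xs = k \<Longrightarrow> rec_eval f xs (F xs)"
    using assms(1) unfolding total_rec_def by blast
  obtain h where "\<And>ys. length ys = Suc (Suc k) \<Longrightarrow> rec_eval h ys (H (hd ys) (hd (tl ys)) (tl (tl ys)))"
    using assms(2) unfolding total_rec_def by blast
  from this[of "_ # _ # _"] have h: "\<And>n r xs. length xs = k \<Longrightarrow> rec_eval h (n # r # xs) (H n r xs)"
    by simp
  have "rec_eval (PrimRec f h) (n # xs) (rec_nat (F xs) (\<lambda>n r. H n r xs) n)" if "length xs = k" for n xs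
    using that by (induction n) (auto intro: rec_eval.intros f h)
  then show "total_rec (Suc k) (\<lambda>ys. rec_nat (F (tl ys)) (\<lambda>n r. H n r (tl ys)) (hd ys))"
    unfolding total_rec_def by (auto simp: length_Suc_conv intro!: exI[of _ "PrimRec f h"])
qed

lemma total_rec_add:
  assumes "total_rec k F" "total_rec k G"
  shows "total_rec k (\<lambda>xs. F xs + G xs)"
proof -
  have "total_rec k (\<lambda>xs. rec_nat (F xs) (\<lambda>n r. Suc r) (G xs))"
    by (intro total_rec_primrec assms total_rec_Suc total_rec_var) simp
  moreover have "rec_nat a (\<lambda>n r. Suc r) b = a + b" for a b by (induction b) auto
  ultimately show ?thesis by simp
qed

lemma total_rec_mult:
  assumes "total_rec k F" "total_rec k G"
  shows "total_rec k (\<lambda>xs. F xs * G xs)"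
proof (rule total_rec_comp2[OF _ assms])
  have "total_rec 2 (\<lambda>xs. rec_nat 0 (\<lambda>n r. r + hd xs) (hd (tl xs)))"
    by (intro total_rec_primrec total_rec_const total_rec_add total_rec_var) auto
  moreover have "rec_nat 0 (\<lambda>n r. r + a) b = a * b" for a b :: nat by (induction b) auto
  ultimately show "total_rec 2 (\<lambda>xs. hd xs * hd (tl xs))" by simp
qed

lemma total_rec_power:
  assumes "total_rec k F" "total_rec k G"
  shows "total_rec k (\<lambda>xs. F xs ^ G xs)"
proof (rule total_rec_comp2[OF _ assms])
  have "total_rec 2 (\<lambda>xs. rec_nat 1 (\<lambda>n r. r * hd xs) (hd (tl xs)))"
    by (intro total_rec_primrec total_rec_const total_rec_mult total_rec_var) auto
  moreover have "rec_nat 1 (\<lambda>n r. r * a) b = a ^ b" for a b :: nat by (induction b) auto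
  ultimately show "total_rec 2 (\<lambda>xs. hd xs ^ hd (tl xs))" by simp
qed

lemma total_rec_diff:
  assumes "total_rec k F" "total_rec k G"
  shows "total_rec k (\<lambda>xs. F xs - G xs)"
proof (rule total_rec_comp2[OF _ assms])
  have "total_rec 1 (\<lambda>xs. rec_nat 0 (\<lambda>n r. n) (hd xs))"
    by (intro total_rec_primrec total_rec_const total_rec_var) auto
  moreover have "rec_nat 0 (\<lambda>n r. n) b = b - 1" for b :: nat by (induction b) auto
  ultimately have pred: "total_rec 1 (\<lambda>xs. hd xs - 1)" by simp
  have "total_rec 2 (\<lambda>xs. rec_nat (hd xs) (\<lambda>n r. r - 1) (hd (tl xs)))"
    by (intro total_rec_primrec total_rec_comp1[OF pred] total_rec_var) auto
  moreover have "rec_nat a (\<lambda>n r. r - 1) b = a - b" for a b :: nat by (induction b) auto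
  ultimately show "total_rec 2 (\<lambda>xs. hd xs - hd (tl xs))" by simp
qed

lemma total_rec_skip:
  assumes "total_rec (Suc k) (\<lambda>ys. E (hd ys) (tl ys))"
  shows "total_rec (Suc (Suc k)) (\<lambda>ys. E (hd ys) (tl (tl ys)))"
proof (rule total_rec_cong)
  let ?js = "0 # map (\<lambda>i. Suc (Suc i)) [0..<k]"
  let ?E = "\<lambda>ys. E (hd ys) (tl ys)"
  show "total_rec (Suc (Suc k)) (\<lambda>xs. ?E (map (\<lambda>j. xs ! j) ?js))"
    using assms by (intro total_rec_reindex) auto
  show "?E (map (\<lambda>j. ys ! j) ?js) = E (hd ys) (tl (tl ys))" if "length ys = Suc (Suc k)" for ys
    using map_nth[of "tl (tl ys)"] that by (cases ys; cases "tl ys") (simp_all add: comp_def)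
qed

lemma total_rec_sum:
  assumes "total_rec (Suc k) (\<lambda>ys. E (hd ys) (tl ys))" "total_rec k N"
  shows "total_rec k (\<lambda>xs. \<Sum>i<N xs. E i xs)"
proof -
  have "total_rec k (\<lambda>xs. rec_nat 0 (\<lambda>n r. r + E n xs) (N xs))"
    by (rule total_rec_primrec[OF total_rec_const total_rec_add[OF _ total_rec_skip[OF assms(1)]] assms(2)])
      (simp add: total_rec_var)
  moreover have "rec_nat 0 (\<lambda>n r. r + e n) b = (\<Sum>i<b. e i)" for e :: "nat \<Rightarrow> nat" and b
    by (induction b) auto
  ultimately show ?thesis by simp
qed

definition dec :: "nat \<Rightarrow> (nat list \<Rightarrow> bool) \<Rightarrow> bool" where
  "dec k P \<longleftrightarrow> total_rec k (\<lambda>xs. of_bool (P xs))"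

lemma total_rec_of_bool: "dec k P \<Longrightarrow> total_rec k (\<lambda>xs. of_bool (P xs))"
  by (simp add: dec_def)

lemma dec_cong: "(\<And>xs. length xs = k \<Longrightarrow> P xs = Q xs) \<Longrightarrow> dec k P \<Longrightarrow> dec k Q"
  unfolding dec_def by (rule total_rec_cong) auto

lemma dec_const: "dec k (\<lambda>xs. c)"
  unfolding dec_def by (rule total_rec_const)

lemma dec_not:
  assumes "dec k P"
  shows "dec k (\<lambda>xs. \<not> P xs)"
proof -
  have "total_rec k (\<lambda>xs. 1 - of_bool (P xs))"
    using assms unfolding dec_def by (intro total_rec_diff total_rec_const)
  moreover have "1 - of_bool p = (of_bool (\<not> p) :: nat)" for p by simp
  ultimately show ?thesis by (simp only: dec_def)
qed

lemma dec_conj: "dec k P \<Longrightarrow> dec k Q \<Longrightarrow> dec k (\<lambda>xs. P xs \<and> Q xs)"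
  unfolding dec_def of_bool_conj by (rule total_rec_mult)

lemma dec_disj:
  assumes "dec k P" "dec k Q"
  shows "dec k (\<lambda>xs. P xs \<or> Q xs)"
proof (rule dec_cong)
  show "dec k (\<lambda>xs. \<not> (\<not> P xs \<and> \<not> Q xs))"
    by (intro dec_not dec_conj assms)
qed simp

lemma dec_le:
  assumes "total_rec k F" "total_rec k G"
  shows "dec k (\<lambda>xs. F xs \<le> G xs)"
proof -
  have "total_rec k (\<lambda>xs. 1 - (F xs - G xs))"
    by (intro total_rec_diff total_rec_const assms)
  moreover have "1 - (a - b) = of_bool (a \<le> b)" for a b :: nat by auto
  ultimately show ?thesis by (simp add: dec_def)
qed

lemma dec_less:
  assumes "total_rec k F" "total_rec k G"
  shows "dec k (\<lambda>xs. F xs < G xs)"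
  unfolding not_le[symmetric] by (intro dec_not dec_le assms)

lemma dec_eq:
  assumes "total_rec k F" "total_rec k G"
  shows "dec k (\<lambda>xs. F xs = G xs)"
proof (rule dec_cong)
  show "dec k (\<lambda>xs. F xs \<le> G xs \<and> G xs \<le> F xs)"
    by (intro dec_conj dec_le assms)
qed auto

lemma total_rec_if:
  assumes "dec k P" "total_rec k F" "total_rec k G"
  shows "total_rec k (\<lambda>xs. if P xs then F xs else G xs)"
proof -
  have "total_rec k (\<lambda>xs. of_bool (P xs) * F xs + of_bool (\<not> P xs) * G xs)"
    by (intro total_rec_add total_rec_mult total_rec_of_bool assms dec_not)
  moreover have "of_bool p * a + of_bool (\<not> p) * b = (if p then a else b)" for p and a b :: nat by simp
  ultimately show ?thesis by simp
qed

lemma dec_bex: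
  assumes "dec (Suc k) (\<lambda>ys. P (hd ys) (tl ys))" "total_rec k N"
  shows "dec k (\<lambda>xs. \<exists>i<N xs. P i xs)"
proof -
  have "dec k (\<lambda>xs. 0 < (\<Sum>i<N xs. of_bool (P i xs) :: nat))"
    by (intro dec_less total_rec_const total_rec_sum total_rec_of_bool assms)
  moreover have "0 < (\<Sum>i<n. of_bool (p i) :: nat) \<longleftrightarrow> (\<exists>i<n. p i)" for n :: nat and p
  proof (induction n)
    case (Suc n)
    then show ?case by (auto simp: less_Suc_eq)
  qed auto
  ultimately show ?thesis by simp
qed

lemma dec_ball:
  assumes "dec (Suc k) (\<lambda>ys. P (hd ys) (tl ys))" "total_rec k N"
  shows "dec k (\<lambda>xs. \<forall>i<N xs. P i xs)"
  using dec_not[OF dec_bex[OF dec_not[OF assms(1)] assms(2)]] by simp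

lemma dec_bex_le:
  assumes "dec (Suc k) (\<lambda>ys. P (hd ys) (tl ys))" "total_rec k N"
  shows "dec k (\<lambda>xs. \<exists>i\<le>N xs. P i xs)"
  using dec_bex[OF assms(1) total_rec_Suc[OF assms(2)]] by (simp add: less_Suc_eq_le)

lemma dec_subst1:
  assumes "dec 1 (\<lambda>xs. P (hd xs))" "total_rec k G"
  shows "dec k (\<lambda>xs. P (G xs))"
  using total_rec_comp1[of "\<lambda>x. of_bool (P x)"] assms unfolding dec_def .

lemma total_rec_div:
  assumes "total_rec k F" "total_rec k G"
  shows "total_rec k (\<lambda>xs. F xs div G xs)"
proof (rule total_rec_comp2[OF _ assms])
  have "total_rec 2 (\<lambda>xs. if 0 < hd (tl xs) then \<Sum>i<hd xs. of_bool (Suc i * hd (tl xs) \<le> hd xs) else 0)"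
    by (intro total_rec_if dec_less total_rec_sum total_rec_of_bool dec_le total_rec_mult
        total_rec_Suc total_rec_const total_rec_var) auto
  moreover have "(if 0 < b then \<Sum>i<a. of_bool (Suc i * b \<le> a) else 0) = a div b" for a b :: nat
  proof (cases "0 < b")
    case True
    have *: "Suc i * b \<le> a \<longleftrightarrow> i < a div b" for i
      using less_eq_div_iff_mult_less_eq[OF True, of "Suc i" a] by (simp only: Suc_le_eq)
    have "{..<a} \<inter> {i. i < a div b} = {..<a div b}"
      by (auto intro: less_le_trans[OF _ div_le_dividend])
    with True show ?thesis by (simp only: * sum_of_bool_eq finite_lessThan if_True card_lessThan of_nat_id)
  qed auto
  ultimately show "total_rec 2 (\<lambda>xs. hd xs div hd (tl xs))" by simp
qed

lemma total_rec_mod: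
  assumes "total_rec k F" "total_rec k G"
  shows "total_rec k (\<lambda>xs. F xs mod G xs)"
  using total_rec_diff[OF assms(1) total_rec_mult[OF total_rec_div[OF assms] assms(2)]]
  by (simp add: minus_div_mult_eq_mod)

lemma total_rec_prod_encode:
  assumes "total_rec k F" "total_rec k G"
  shows "total_rec k (\<lambda>xs. prod_encode (F xs, G xs))"
  unfolding prod_encode_def triangle_def split
  by (intro total_rec_add total_rec_div total_rec_mult total_rec_Suc total_rec_const assms)

lemma total_rec_prod_decode:
  assumes "total_rec k F"
  shows "total_rec k (\<lambda>xs. fst (prod_decode (F xs)))" "total_rec k (\<lambda>xs. snd (prod_decode (F xs)))"
proof -
  have fst: "(\<Sum>a<Suc n. a * of_bool (\<exists>b\<le>n. prod_encode (a, b) = n)) = fst (prod_decode n)"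
    and snd: "(\<Sum>b<Suc n. b * of_bool (\<exists>a\<le>n. prod_encode (a, b) = n)) = snd (prod_decode n)" for n
  proof -
    obtain a b where n: "n = prod_encode (a, b)" by (metis prod_decode_inverse surj_pair)
    have le: "a \<le> n" "b \<le> n" unfolding n by (rule le_prod_encode_1 le_prod_encode_2)+
    have "(\<Sum>a'<Suc n. a' * of_bool (\<exists>b\<le>n. prod_encode (a', b) = n)) = (\<Sum>a'<Suc n. if a' = a then a else 0)"
      using le by (intro sum.cong) (auto simp: n)
    then show "(\<Sum>a<Suc n. a * of_bool (\<exists>b\<le>n. prod_encode (a, b) = n)) = fst (prod_decode n)"
      using le by (simp add: n)
    have "(\<Sum>b'<Suc n. b' * of_bool (\<exists>a\<le>n. prod_encode (a, b') = n)) = (\<Sum>b'<Suc n. if b' = b then b else 0)"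
      using le by (intro sum.cong) (auto simp: n)
    then show "(\<Sum>b<Suc n. b * of_bool (\<exists>a\<le>n. prod_encode (a, b) = n)) = snd (prod_decode n)"
      using le by (simp add: n)
  qed
  have "total_rec 1 (\<lambda>xs. \<Sum>a<Suc (hd xs). a * of_bool (\<exists>b\<le>hd xs. prod_encode (a, b) = hd xs))"
    "total_rec 1 (\<lambda>xs. \<Sum>b<Suc (hd xs). b * of_bool (\<exists>a\<le>hd xs. prod_encode (a, b) = hd xs))"
    by (intro total_rec_sum total_rec_mult total_rec_of_bool dec_bex_le dec_eq total_rec_prod_encode
        total_rec_Suc total_rec_var; simp)+
  then have *: "total_rec 1 (\<lambda>xs. fst (prod_decode (hd xs)))" "total_rec 1 (\<lambda>xs. snd (prod_decode (hd xs)))"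
    by (simp_all only: fst snd)
  show "total_rec k (\<lambda>xs. fst (prod_decode (F xs)))" "total_rec k (\<lambda>xs. snd (prod_decode (F xs)))"
    by (rule total_rec_comp1[OF *(1) assms], rule total_rec_comp1[OF *(2) assms])
qed

lemmas rec_intros =
  total_rec_const total_rec_Suc total_rec_add total_rec_mult total_rec_power total_rec_diff
  total_rec_sum total_rec_of_bool total_rec_if total_rec_div total_rec_mod total_rec_prod_encode
  total_rec_prod_decode
  dec_const dec_not dec_conj dec_disj dec_le dec_less dec_eq dec_bex dec_ball dec_bex_le
  total_rec_var

section \<open>Step-bounded evaluation\<close>

text \<open>\<open>S s xs\<close> is \<open>Suc y\<close> if the value \<open>y\<close> has been found by stage \<open>s\<close>, and \<open>0\<close> otherwise.\<close>

definition stage_eval :: "nat \<Rightarrow> recf \<Rightarrow> (nat \<Rightarrow> nat list \<Rightarrow> nat) \<Rightarrow> bool" where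
  "stage_eval k f S \<longleftrightarrow> total_rec (Suc k) (\<lambda>ys. S (hd ys) (tl ys)) \<and>
     (\<forall>xs. length xs = k \<longrightarrow> (\<forall>s y. S s xs = Suc y \<longrightarrow> rec_eval f xs y) \<and>
       (\<forall>y. rec_eval f xs y \<longrightarrow> (\<forall>\<^sub>F s in sequentially. S s xs = Suc y)))"

lemma stage_evalI:
  assumes "total_rec (Suc k) (\<lambda>ys. S (hd ys) (tl ys))"
    and "\<And>xs s y. length xs = k \<Longrightarrow> S s xs = Suc y \<Longrightarrow> rec_eval f xs y"
    and "\<And>xs y. length xs = k \<Longrightarrow> rec_eval f xs y \<Longrightarrow> \<forall>\<^sub>F s in sequentially. S s xs = Suc y"
  shows "stage_eval k f S"
  using assms by (simp add: stage_eval_def)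

lemma stage_evalD:
  assumes "stage_eval k f S"
  shows "total_rec (Suc k) (\<lambda>ys. S (hd ys) (tl ys))"
    and "length xs = k \<Longrightarrow> S s xs = Suc y \<Longrightarrow> rec_eval f xs y"
    and "length xs = k \<Longrightarrow> rec_eval f xs y \<Longrightarrow> \<forall>\<^sub>F s in sequentially. S s xs = Suc y"
  using assms by (simp_all add: stage_eval_def)

lemma dec_Ball_set:
  assumes "\<And>g. g \<in> set gs \<Longrightarrow> dec k (P g)"
  shows "dec k (\<lambda>xs. \<forall>g\<in>set gs. P g xs)"
  using assms
proof (induction gs)
  case Nil
  show ?case by (simp add: dec_const)
next
  case (Cons g gs)
  have "dec k (\<lambda>xs. P g xs \<and> (\<forall>g\<in>set gs. P g xs))"
    by (intro dec_conj Cons.IH Cons.prems) simp_all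
  then show ?case by simp
qed

inductive_cases rec_eval_cases [elim!]:
  "rec_eval Zero xs y" "rec_eval Succ xs y" "rec_eval (Proj i) xs y" "rec_eval (Comp f gs) xs y"
  "rec_eval (PrimRec f g) [] y" "rec_eval (PrimRec f g) (0 # xs) y"
  "rec_eval (PrimRec f g) (Suc n # xs) y" "rec_eval (Mu f) xs y"

lemma stage_eval_Comp:
  assumes f: "stage_eval (length gs) f S" and c: "\<And>g. g \<in> set gs \<Longrightarrow> stage_eval k g (c g)"
  shows "\<exists>T. stage_eval k (Comp f gs) T"
proof
  let ?T = "\<lambda>s xs. if \<forall>g\<in>set gs. 0 < c g s xs then S s (map (\<lambda>g. c g s xs - 1) gs) else 0"
  show "stage_eval k (Comp f gs) ?T"
  proof (rule stage_evalI)
    let ?Gs = "hd # map (\<lambda>g ys. c g (hd ys) (tl ys) - 1) gs"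
    have "total_rec (Suc k) G" if "G \<in> set ?Gs" for G
      using that by (auto intro!: total_rec_var(1) total_rec_diff total_rec_const stage_evalD(1)[OF c]
          simp del: One_nat_def)
    then have "total_rec (Suc k) (\<lambda>ys. (\<lambda>zs. S (hd zs) (tl zs)) (map (\<lambda>G. G ys) ?Gs))"
      using stage_evalD(1)[OF f] by (intro total_rec_list_comp) simp_all
    then have "total_rec (Suc k) (\<lambda>ys. S (hd ys) (map (\<lambda>g. c g (hd ys) (tl ys) - 1) gs))"
      by (simp add: comp_def)
    moreover have "dec (Suc k) (\<lambda>ys. \<forall>g\<in>set gs. 0 < c g (hd ys) (tl ys))"
      by (intro dec_Ball_set dec_less total_rec_const stage_evalD(1)[OF c])
    ultimately show "total_rec (Suc k) (\<lambda>ys. ?T (hd ys) (tl ys))"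
      by (intro total_rec_if total_rec_const)
  next
    fix xs s y assume xs: "length xs = k" and "?T s xs = Suc y"
    then have pos: "\<And>g. g \<in> set gs \<Longrightarrow> 0 < c g s xs" and y: "S s (map (\<lambda>g. c g s xs - 1) gs) = Suc y"
      by (auto split: if_splits)
    show "rec_eval (Comp f gs) xs y"
    proof (rule rec_eval.comp)
      show "list_all2 (\<lambda>g y. rec_eval g xs y) gs (map (\<lambda>g. c g s xs - 1) gs)"
        using pos by (auto simp: list_all2_conv_all_nth intro!: stage_evalD(2)[OF c xs, where s = s])
      show "rec_eval f (map (\<lambda>g. c g s xs - 1) gs) y"
        by (rule stage_evalD(2)[OF f _ y]) simp
    qed
  next
    fix xs y assume xs: "length xs = k" and "rec_eval (Comp f gs) xs y"
    then obtain ys where ys: "list_all2 (\<lambda>g y. rec_eval g xs y) gs ys" and y: "rec_eval f ys y"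
      by auto
    note len = list_all2_lengthD[OF ys]
    have "\<forall>\<^sub>F s in sequentially. \<forall>i\<in>{..<length gs}. c (gs ! i) s xs = Suc (ys ! i)"
      using ys by (intro eventually_ball_finite ballI stage_evalD(3)[OF c xs])
        (auto simp: list_all2_conv_all_nth)
    moreover have "\<forall>\<^sub>F s in sequentially. S s ys = Suc y"
      using stage_evalD(3)[OF f _ y] len by simp
    ultimately show "\<forall>\<^sub>F s in sequentially. ?T s xs = Suc y"
    proof eventually_elim
      case (elim s)
      then have "map (\<lambda>g. c g s xs - 1) gs = ys"
        using len by (intro nth_equalityI) auto
      moreover have "\<forall>g\<in>set gs. 0 < c g s xs" using elim(1) by (auto simp: in_set_conv_nth)
      ultimately show ?case using elim(2) by simp
    qed
  qed
qed

lemma stage_eval_PrimRec: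
  assumes f: "stage_eval k f S" and g: "stage_eval (Suc (Suc k)) g T"
  shows "\<exists>U. stage_eval (Suc k) (PrimRec f g) U"
proof
  let ?H = "\<lambda>n r s zs. if r = 0 then 0 else T s (n # (r - 1) # zs)"
  let ?U = "\<lambda>s xs. rec_nat (S s (tl xs)) (\<lambda>n r. ?H n r s (tl xs)) (hd xs)"
  show "stage_eval (Suc k) (PrimRec f g) ?U"
  proof (rule stage_evalI)
    let ?Gs = "[\<lambda>ws. hd (tl (tl ws)), \<lambda>ws. hd ws, \<lambda>ws. hd (tl ws) - 1] @ map (\<lambda>i ws. ws ! Suc (Suc (Suc (Suc i)))) [0..<k]"
    have "total_rec (Suc (Suc (Suc (Suc k)))) G" if "G \<in> set ?Gs" for G
      using that by (auto intro!: total_rec_var total_rec_diff total_rec_const total_rec_nth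
          simp del: One_nat_def)
    then have "total_rec (Suc (Suc (Suc (Suc k)))) (\<lambda>ys. (\<lambda>zs. T (hd zs) (tl zs)) (map (\<lambda>G. G ys) ?Gs))"
      using stage_evalD(1)[OF g] total_rec_list_comp[of ?Gs "\<lambda>zs. T (hd zs) (tl zs)"] by simp
    then have T: "total_rec (Suc (Suc (Suc (Suc k))))
      (\<lambda>ws. T (hd (tl (tl ws))) (hd ws # (hd (tl ws) - 1) # tl (tl (tl (tl ws)))))"
    proof (rule total_rec_cong[rotated])
      fix xs :: "nat list" assume "length xs = Suc (Suc (Suc (Suc k)))"
      then have "map (\<lambda>i. xs ! Suc (Suc (Suc (Suc i)))) [0..<k] = tl (tl (tl (tl xs)))"
        by (intro nth_equalityI) (auto simp: nth_tl)
      then show "(\<lambda>zs. T (hd zs) (tl zs)) (map (\<lambda>G. G xs) ?Gs) =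
        T (hd (tl (tl xs))) (hd xs # (hd (tl xs) - 1) # tl (tl (tl (tl xs))))"
        by (simp add: comp_def)
    qed
    have "total_rec (Suc (Suc k)) (\<lambda>ys. rec_nat (S (hd ys) (tl (tl ys))) (\<lambda>n r. ?H n r (hd ys) (tl (tl ys))) (hd (tl ys)))"
      by (intro total_rec_primrec total_rec_skip stage_evalD(1)[OF f] total_rec_if dec_eq total_rec_const
          T total_rec_var) simp_all
    then show "total_rec (Suc (Suc k)) (\<lambda>ys. ?U (hd ys) (tl ys))" .
  next
    fix xs s y assume len: "length xs = Suc k" and U: "?U s xs = Suc y"
    obtain n zs where xs: "xs = n # zs" and zs: "length zs = k"
      using len by (auto simp: length_Suc_conv)
    show "rec_eval (PrimRec f g) xs y"
      using U unfolding xs list.sel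
    proof (induction n arbitrary: y)
      case 0
      then show ?case by (auto intro!: rec_eval.primrec_0 stage_evalD(2)[OF f zs])
    next
      case (Suc n)
      let ?r = "rec_nat (S s zs) (\<lambda>n r. ?H n r s zs) n"
      from Suc.prems have r: "?r = Suc (?r - 1)" and "T s (n # (?r - 1) # zs) = Suc y"
        by (auto split: if_splits)
      then have "rec_eval g (n # (?r - 1) # zs) y"
        by (intro stage_evalD(2)[OF g]) (simp_all add: zs)
      with Suc.IH[OF r] show ?case by (rule rec_eval.primrec_Suc)
    qed
  next
    fix xs y assume len: "length xs = Suc k" and ev: "rec_eval (PrimRec f g) xs y"
    obtain n zs where xs: "xs = n # zs" and zs: "length zs = k"
      using len by (auto simp: length_Suc_conv)
    show "\<forall>\<^sub>F s in sequentially. ?U s xs = Suc y"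
      using ev unfolding xs list.sel
    proof (induction n arbitrary: y)
      case 0
      then have "rec_eval f zs y" by auto
      then show ?case using stage_evalD(3)[OF f zs] by simp
    next
      case (Suc n)
      then obtain r where r: "rec_eval (PrimRec f g) (n # zs) r" and y: "rec_eval g (n # r # zs) y"
        by auto
      have "\<forall>\<^sub>F s in sequentially. T s (n # r # zs) = Suc y"
        using stage_evalD(3)[OF g _ y] zs by simp
      with Suc.IH[OF r] show ?case
        by eventually_elim simp
    qed
  qed
qed

lemma sum_of_bool_unique:
  fixes Q :: "nat \<Rightarrow> bool"
  assumes "\<And>m. Q m \<Longrightarrow> m = n" "Q n" "n < s"
  shows "(\<Sum>m<s. Suc m * of_bool (Q m)) = Suc n"
proof -
  have "Suc m * of_bool (Q m) = (if m = n then Suc n else 0)" for m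
    using assms(1)[of m] assms(2) by (cases "m = n") auto
  then show ?thesis using assms(3) by simp
qed

lemma stage_eval_Mu:
  assumes f: "stage_eval (Suc k) f S"
  shows "\<exists>T. stage_eval k (Mu f) T"
proof
  let ?Q = "\<lambda>s xs n. S s (n # xs) = Suc 0 \<and> (\<forall>m<n. Suc 0 < S s (m # xs))"
  let ?T = "\<lambda>s xs. \<Sum>n<s. Suc n * of_bool (?Q s xs n)"
  have T: "?T s xs = Suc n" if "?Q s xs n" "n < s" for s xs n
  proof -
    have "m = n" if "?Q s xs m" for m
      using that \<open>?Q s xs n\<close> by (metis less_irrefl linorder_neqE_nat)
    then show ?thesis using that by (intro sum_of_bool_unique)
  qed
  show "stage_eval k (Mu f) ?T"
  proof (rule stage_evalI)
    have S1: "total_rec (Suc (Suc k)) (\<lambda>ws. S (hd (tl ws)) (hd ws # tl (tl ws)))"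
    proof (rule total_rec_cong)
      let ?js = "[1, 0] @ map (\<lambda>i. Suc (Suc i)) [0..<k]"
      show "total_rec (Suc (Suc k)) (\<lambda>xs. (\<lambda>zs. S (hd zs) (tl zs)) (map (\<lambda>j. xs ! j) ?js))"
        by (rule total_rec_reindex[of ?js "\<lambda>zs. S (hd zs) (tl zs)"])
          (use stage_evalD(1)[OF f] in auto)
      fix xs :: "nat list" assume "length xs = Suc (Suc k)"
      moreover from this have "map (\<lambda>i. xs ! Suc (Suc i)) [0..<k] = tl (tl xs)"
        by (intro nth_equalityI) (auto simp: nth_tl)
      ultimately show "(\<lambda>zs. S (hd zs) (tl zs)) (map (\<lambda>j. xs ! j) ?js) = S (hd (tl xs)) (hd xs # tl (tl xs))"
        by (cases xs; cases "tl xs") (simp_all add: comp_def)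
    qed
    have S2: "total_rec (Suc (Suc (Suc k))) (\<lambda>ws. S (hd (tl (tl ws))) (hd ws # tl (tl (tl ws))))"
      using total_rec_skip[of "Suc k" "\<lambda>n ys. S (hd ys) (n # tl ys)"] S1 by simp
    show "total_rec (Suc k) (\<lambda>ys. ?T (hd ys) (tl ys))"
      by (intro total_rec_sum total_rec_mult total_rec_Suc total_rec_of_bool dec_conj dec_eq S1
          dec_ball dec_less S2 total_rec_const total_rec_var) simp_all
  next
    fix xs s y assume xs: "length xs = k" and y: "?T s xs = Suc y"
    have "\<exists>n<s. ?Q s xs n"
    proof (rule ccontr)
      assume "\<not> (\<exists>n<s. ?Q s xs n)"
      then have "?T s xs = (\<Sum>n<s. 0)" by (intro sum.cong) auto
      with y show False by simp
    qed
    then obtain n where n: "?Q s xs n" "n < s" by blast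
    with T y have "y = n" by simp
    moreover have "rec_eval (Mu f) xs n"
    proof (rule rec_eval.mu)
      show "rec_eval f (n # xs) 0"
        using n by (intro stage_evalD(2)[OF f]) (auto simp: xs)
      show "\<forall>m<n. \<exists>k. rec_eval f (m # xs) (Suc k)"
      proof (intro allI impI exI)
        fix m assume "m < n"
        then show "rec_eval f (m # xs) (Suc (S s (m # xs) - 2))"
          using n by (intro stage_evalD(2)[OF f, where s = s]) (auto simp: xs Suc_diff_Suc numeral_2_eq_2)
      qed
    qed
    ultimately show "rec_eval (Mu f) xs y" by simp
  next
    fix xs n assume xs: "length xs = k" and "rec_eval (Mu f) xs n"
    then have n: "rec_eval f (n # xs) 0" and "\<forall>m<n. \<exists>k. rec_eval f (m # xs) (Suc k)" by auto
    then obtain h where h: "\<And>m. m < n \<Longrightarrow> rec_eval f (m # xs) (Suc (h m))" by metis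
    have "\<forall>\<^sub>F s in sequentially. \<forall>m\<in>{..<n}. S s (m # xs) = Suc (Suc (h m))"
      by (intro eventually_ball_finite ballI stage_evalD(3)[OF f] h) (auto simp: xs)
    moreover have "\<forall>\<^sub>F s in sequentially. S s (n # xs) = Suc 0"
      using n by (intro stage_evalD(3)[OF f]) (auto simp: xs)
    moreover have "\<forall>\<^sub>F s in sequentially. n < s" by (rule eventually_gt_at_top)
    ultimately show "\<forall>\<^sub>F s in sequentially. ?T s xs = Suc n"
      by eventually_elim (intro T, auto)
  qed
qed

lemma stage_eval_exists: "\<exists>S. stage_eval k f S"
proof (induction f arbitrary: k)
  case Zero
  have "stage_eval k Zero (\<lambda>s xs. Suc 0)"
    by (intro stage_evalI total_rec_const) (auto intro: rec_eval.zero)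
  then show ?case by blast
next
  case Succ
  show ?case
  proof (cases "k = 1")
    case True
    have "stage_eval k Succ (\<lambda>s xs. Suc (Suc (hd xs)))"
      unfolding True by (intro stage_evalI total_rec_Suc total_rec_var)
        (auto simp: length_Suc_conv intro: rec_eval.succ)
    then show ?thesis by blast
  next
    case False
    then have "stage_eval k Succ (\<lambda>s xs. 0)"
      by (intro stage_evalI total_rec_const) auto
    then show ?thesis by blast
  qed
next
  case (Proj i)
  show ?case
  proof (cases "i < k")
    case True
    then have "stage_eval k (Proj i) (\<lambda>s xs. Suc (xs ! i))"
      by (intro stage_evalI total_rec_Suc total_rec_tl[of k "\<lambda>xs. xs ! i"] total_rec_nth)
        (auto intro: rec_eval.proj)
    then show ?thesis by blast
  next
    case False
    then have "stage_eval k (Proj i) (\<lambda>s xs. 0)"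
      by (intro stage_evalI total_rec_const) auto
    then show ?thesis by blast
  qed
next
  case (Comp f gs)
  obtain S where "stage_eval (length gs) f S" using Comp.IH(1) by blast
  moreover have "\<forall>g\<in>set gs. \<exists>S. stage_eval k g S" using Comp.IH(2) by blast
  from bchoice[OF this] obtain c where "\<forall>g\<in>set gs. stage_eval k g (c g)" by blast
  ultimately show ?case by (intro stage_eval_Comp) auto
next
  case (PrimRec f g)
  show ?case
  proof (cases k)
    case 0
    then have "stage_eval k (PrimRec f g) (\<lambda>s xs. 0)"
      by (intro stage_evalI total_rec_const) auto
    then show ?thesis by blast
  next
    case (Suc k')
    obtain S T where "stage_eval k' f S" "stage_eval (Suc (Suc k')) g T" using PrimRec.IH by blast
    then show ?thesis unfolding Suc by (rule stage_eval_PrimRec)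
  qed
next
  case (Mu f)
  then obtain S where "stage_eval (Suc k) f S" by blast
  then show ?case by (rule stage_eval_Mu)
qed

lemma rec_eval_unique:
  assumes "rec_eval f xs y" "rec_eval f xs z"
  shows "y = z"
proof -
  obtain S where S: "stage_eval (length xs) f S" using stage_eval_exists by blast
  have "\<forall>\<^sub>F s in sequentially. S s xs = Suc y \<and> S s xs = Suc z"
    using assms stage_evalD(3)[OF S refl] by (simp add: eventually_conj_iff)
  then show ?thesis by (auto dest: eventually_happens)
qed

section \<open>Computably enumerable predicates\<close>

definition ce :: "nat \<Rightarrow> (nat list \<Rightarrow> bool) \<Rightarrow> bool" where
  "ce k P \<longleftrightarrow> (\<exists>R. dec (Suc k) (\<lambda>ys. R (hd ys) (tl ys)) \<and>
     (\<forall>xs. length xs = k \<longrightarrow> P xs = (\<exists>s. R s xs)))"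

lemma ceE:
  assumes "ce k P"
  obtains R where "dec (Suc k) (\<lambda>ys. R (hd ys) (tl ys))"
    "\<And>xs. length xs = k \<Longrightarrow> P xs \<longleftrightarrow> (\<exists>s. R s xs)"
  using assms unfolding ce_def by blast

lemma ceI:
  assumes "dec (Suc k) (\<lambda>ys. R (hd ys) (tl ys))"
    "\<And>xs. length xs = k \<Longrightarrow> P xs \<longleftrightarrow> (\<exists>s. R s xs)"
  shows "ce k P"
  using assms unfolding ce_def by blast

lemma ce_cong: "(\<And>xs. length xs = k \<Longrightarrow> P xs = Q xs) \<Longrightarrow> ce k P \<Longrightarrow> ce k Q"
  unfolding ce_def by simp

lemma dec_tl: "dec k P \<Longrightarrow> dec (Suc k) (\<lambda>xs. P (tl xs))"
  unfolding dec_def by (rule total_rec_tl)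

lemma dec_skip:
  "dec (Suc k) (\<lambda>ys. R (hd ys) (tl ys)) \<Longrightarrow> dec (Suc (Suc k)) (\<lambda>ys. R (hd ys) (tl (tl ys)))"
  unfolding dec_def by (rule total_rec_skip)

lemma dec_list_comp:
  assumes "dec (length Gs) P" "\<And>G. G \<in> set Gs \<Longrightarrow> total_rec k G"
  shows "dec k (\<lambda>xs. P (map (\<lambda>G. G xs) Gs))"
  using total_rec_list_comp[OF assms(1)[unfolded dec_def] assms(2)] by (simp add: dec_def)

lemma dec_bounded_stage:
  assumes "dec (Suc k) (\<lambda>ys. R (hd ys) (tl ys))"
  shows "dec (Suc k) (\<lambda>ys. \<exists>i<hd ys. R i (tl ys))"
  by (rule dec_bex[OF dec_skip[OF assms]]) (rule total_rec_var, simp)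

lemma ce_dec: "dec k P \<Longrightarrow> ce k P"
  by (rule ceI[where R = "\<lambda>s. P"]) (auto intro: dec_tl)

lemma ce_conj:
  assumes "ce k P" "ce k Q"
  shows "ce k (\<lambda>xs. P xs \<and> Q xs)"
proof -
  obtain R where R: "dec (Suc k) (\<lambda>ys. R (hd ys) (tl ys))"
    and P: "\<And>xs. length xs = k \<Longrightarrow> P xs \<longleftrightarrow> (\<exists>s. R s xs)" using assms(1) by (rule ceE) blast
  obtain S where S: "dec (Suc k) (\<lambda>ys. S (hd ys) (tl ys))"
    and Q: "\<And>xs. length xs = k \<Longrightarrow> Q xs \<longleftrightarrow> (\<exists>s. S s xs)" using assms(2) by (rule ceE) blast
  show ?thesis
  proof (rule ceI)
    show "dec (Suc k) (\<lambda>ys. (\<exists>i<hd ys. R i (tl ys)) \<and> (\<exists>i<hd ys. S i (tl ys)))"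
      by (intro dec_conj dec_bounded_stage R S)
    fix xs :: "nat list" assume xs: "length xs = k"
    show "P xs \<and> Q xs \<longleftrightarrow> (\<exists>s. (\<exists>i<s. R i xs) \<and> (\<exists>i<s. S i xs))"
    proof
      assume "P xs \<and> Q xs"
      then obtain i j where "R i xs" "S j xs" using P[OF xs] Q[OF xs] by blast
      then show "\<exists>s. (\<exists>i<s. R i xs) \<and> (\<exists>i<s. S i xs)"
        by (intro exI[of _ "Suc (max i j)"]) (auto simp: less_Suc_eq_le intro: exI[of _ i] exI[of _ j])
    qed (use P[OF xs] Q[OF xs] in blast)
  qed
qed

lemma ce_disj:
  assumes "ce k P" "ce k Q"
  shows "ce k (\<lambda>xs. P xs \<or> Q xs)"
proof -
  obtain R where R: "dec (Suc k) (\<lambda>ys. R (hd ys) (tl ys))"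
    and P: "\<And>xs. length xs = k \<Longrightarrow> P xs \<longleftrightarrow> (\<exists>s. R s xs)" using assms(1) by (rule ceE) blast
  obtain S where S: "dec (Suc k) (\<lambda>ys. S (hd ys) (tl ys))"
    and Q: "\<And>xs. length xs = k \<Longrightarrow> Q xs \<longleftrightarrow> (\<exists>s. S s xs)" using assms(2) by (rule ceE) blast
  show ?thesis
    by (rule ceI[OF dec_disj[OF R S]]) (auto simp: P Q)
qed

lemma ce_list_comp:
  assumes P: "ce (length Gs) P" and Gs: "\<And>G. G \<in> set Gs \<Longrightarrow> total_rec k G"
  shows "ce k (\<lambda>xs. P (map (\<lambda>G. G xs) Gs))"
proof -
  obtain R where R: "dec (Suc (length Gs)) (\<lambda>ys. R (hd ys) (tl ys))"
    and P: "\<And>xs. length xs = length Gs \<Longrightarrow> P xs \<longleftrightarrow> (\<exists>s. R s xs)" using P by (rule ceE) blast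
  let ?Gs = "(\<lambda>xs. hd xs) # map (\<lambda>G xs. G (tl xs)) Gs"
  have "total_rec (Suc k) G" if "G \<in> set ?Gs" for G
    using that Gs by (auto intro: total_rec_var(1) total_rec_tl)
  then have "dec (Suc k) (\<lambda>xs. (\<lambda>ys. R (hd ys) (tl ys)) (map (\<lambda>G. G xs) ?Gs))"
    using R dec_list_comp[of ?Gs "\<lambda>ys. R (hd ys) (tl ys)" "Suc k"] by simp
  then have "dec (Suc k) (\<lambda>xs. R (hd xs) (map (\<lambda>G. G (tl xs)) Gs))"
    by (simp add: comp_def)
  then show ?thesis by (rule ceI[where R = "\<lambda>s xs. R s (map (\<lambda>G. G xs) Gs)"]) (simp add: P)
qed

lemma ce_subst1:
  assumes "ce 1 (\<lambda>xs. P (hd xs))" "total_rec k F"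
  shows "ce k (\<lambda>xs. P (F xs))"
  using ce_list_comp[of "[F]" "\<lambda>xs. P (hd xs)" k] assms by simp

lemma ce_subst2:
  assumes "ce 2 (\<lambda>xs. P (hd xs) (hd (tl xs)))" "total_rec k F" "total_rec k G"
  shows "ce k (\<lambda>xs. P (F xs) (G xs))"
  using ce_list_comp[of "[F, G]" "\<lambda>xs. P (hd xs) (hd (tl xs))" k] assms
  by (auto simp: numeral_2_eq_2)

lemma ce_subst3:
  assumes "ce 3 (\<lambda>xs. P (hd xs) (hd (tl xs)) (hd (tl (tl xs))))"
    "total_rec k F" "total_rec k G" "total_rec k H"
  shows "ce k (\<lambda>xs. P (F xs) (G xs) (H xs))"
  using ce_list_comp[of "[F, G, H]" "\<lambda>xs. P (hd xs) (hd (tl xs)) (hd (tl (tl xs)))" k] assms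
  by (auto simp: numeral_3_eq_3)

lemma ce_ex:
  assumes "ce (Suc k) (\<lambda>ys. P (hd ys) (tl ys))"
  shows "ce k (\<lambda>xs. \<exists>n. P n xs)"
proof -
  obtain R where R: "dec (Suc (Suc k)) (\<lambda>ys. R (hd ys) (tl ys))"
    and P: "\<And>xs. length xs = Suc k \<Longrightarrow> P (hd xs) (tl xs) \<longleftrightarrow> (\<exists>s. R s xs)"
    using assms by (rule ceE) blast
  show ?thesis
  proof (rule ceI)
    let ?Gs = "[\<lambda>ys. fst (prod_decode (hd ys)), \<lambda>ys. snd (prod_decode (hd ys))] @
      map (\<lambda>i ys. ys ! Suc i) [0..<k]"
    have "total_rec (Suc k) G" if "G \<in> set ?Gs" for G
      using that by (auto intro!: total_rec_prod_decode total_rec_var(1) total_rec_nth)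
    then have "dec (Suc k) (\<lambda>xs. (\<lambda>ys. R (hd ys) (tl ys)) (map (\<lambda>G. G xs) ?Gs))"
      using R dec_list_comp[of ?Gs "\<lambda>ys. R (hd ys) (tl ys)" "Suc k"] by simp
    then show "dec (Suc k) (\<lambda>ys. R (fst (prod_decode (hd ys))) (snd (prod_decode (hd ys)) # tl ys))"
    proof (rule dec_cong[rotated])
      fix xs :: "nat list" assume "length xs = Suc k"
      then have "map (\<lambda>i. xs ! Suc i) [0..<k] = tl xs"
        by (intro nth_equalityI) (auto simp: nth_tl)
      then show "(\<lambda>ys. R (hd ys) (tl ys)) (map (\<lambda>G. G xs) ?Gs) =
        R (fst (prod_decode (hd xs))) (snd (prod_decode (hd xs)) # tl xs)"
        by (simp add: comp_def)
    qed
    fix xs :: "nat list" assume xs: "length xs = k"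
    show "(\<exists>n. P n xs) \<longleftrightarrow> (\<exists>s. R (fst (prod_decode s)) (snd (prod_decode s) # xs))"
    proof
      assume "\<exists>n. P n xs"
      then obtain n where "P n xs" ..
      then obtain s where "R s (n # xs)" using P[of "n # xs"] xs by auto
      then show "\<exists>s. R (fst (prod_decode s)) (snd (prod_decode s) # xs)"
        by (intro exI[of _ "prod_encode (s, n)"]) simp
    next
      assume "\<exists>s. R (fst (prod_decode s)) (snd (prod_decode s) # xs)"
      then obtain s n where "R s (n # xs)" by blast
      then show "\<exists>n. P n xs" using P[of "n # xs"] xs by auto
    qed
  qed
qed

lemma ce_rec_eval: "ce (Suc k) (\<lambda>ys. rec_eval f (tl ys) (hd ys))"
proof -
  obtain S where S: "stage_eval k f S" using stage_eval_exists by blast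
  show ?thesis
  proof (rule ceI)
    show "dec (Suc (Suc k)) (\<lambda>ys. S (hd ys) (tl (tl ys)) = Suc (hd (tl ys)))"
      by (intro dec_eq total_rec_skip stage_evalD(1)[OF S] total_rec_Suc total_rec_var) simp
    fix xs :: "nat list" assume "length xs = Suc k"
    then have len: "length (tl xs) = k" by simp
    show "rec_eval f (tl xs) (hd xs) \<longleftrightarrow> (\<exists>s. S s (tl xs) = Suc (hd xs))"
      using stage_evalD(2)[OF S len] eventually_happens[OF stage_evalD(3)[OF S len]] by auto
  qed
qed

lemma total_rec_exact:
  assumes "total_rec k F"
  obtains f where "\<And>xs y. length xs = k \<Longrightarrow> rec_eval f xs y \<longleftrightarrow> y = F xs"
  using assms unfolding total_rec_def by (metis rec_eval_unique)

lemma rec_eval_Mu_dec: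
  assumes "dec (Suc k) (\<lambda>ys. R (hd ys) (tl ys))"
  obtains f where "\<And>xs n. length xs = k \<Longrightarrow> rec_eval (Mu f) xs n \<longleftrightarrow> R n xs \<and> (\<forall>m<n. \<not> R m xs)"
proof -
  have "total_rec (Suc k) (\<lambda>ys. of_bool (\<not> R (hd ys) (tl ys)))"
    using dec_not[OF assms] by (simp only: dec_def)
  then obtain f where "\<And>ys y. length ys = Suc k \<Longrightarrow> rec_eval f ys y \<longleftrightarrow> y = of_bool (\<not> R (hd ys) (tl ys))"
    by (rule total_rec_exact) blast
  from this[of "_ # _"] have f: "\<And>n xs y. length xs = k \<Longrightarrow> rec_eval f (n # xs) y \<longleftrightarrow> y = of_bool (\<not> R n xs)"
    by simp
  have "rec_eval (Mu f) xs n \<longleftrightarrow> R n xs \<and> (\<forall>m<n. \<not> R m xs)" if "length xs = k" for xs n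
  proof
    assume "rec_eval (Mu f) xs n"
    then show "R n xs \<and> (\<forall>m<n. \<not> R m xs)"
      by cases (auto simp: f that split: if_splits)
  next
    assume "R n xs \<and> (\<forall>m<n. \<not> R m xs)"
    then show "rec_eval (Mu f) xs n"
      by (intro rec_eval.mu) (auto simp: f that)
  qed
  then show ?thesis by (rule that)
qed

lemma ce_set_iff_ce: "ce_set A \<longleftrightarrow> ce 1 (\<lambda>xs. hd xs \<in> A)"
proof
  assume "ce_set A"
  then obtain f where f: "\<And>x. x \<in> A \<longleftrightarrow> (\<exists>y. rec_eval f [x] y)" unfolding ce_set_def by blast
  have "ce 1 (\<lambda>xs. \<exists>y. rec_eval f xs y)"
    by (rule ce_ex) (use ce_rec_eval[of 1 f] in simp)
  then show "ce 1 (\<lambda>xs. hd xs \<in> A)"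
    by (rule ce_cong[rotated]) (auto simp: f length_Suc_conv)
next
  assume "ce 1 (\<lambda>xs. hd xs \<in> A)"
  then obtain R where R: "dec (Suc 1) (\<lambda>ys. R (hd ys) (tl ys))"
    and A: "\<And>xs. length xs = 1 \<Longrightarrow> hd xs \<in> A \<longleftrightarrow> (\<exists>s. R s xs)" by (rule ceE) blast
  obtain f where f: "\<And>xs n. length xs = 1 \<Longrightarrow> rec_eval (Mu f) xs n \<longleftrightarrow> R n xs \<and> (\<forall>m<n. \<not> R m xs)"
    using R by (rule rec_eval_Mu_dec) blast
  have "x \<in> A \<longleftrightarrow> (\<exists>y. rec_eval (Mu f) [x] y)" for x
    using A[of "[x]"] f[of "[x]"] exists_least_iff[of "\<lambda>n. R n [x]"] by simp
  then show "ce_set A" unfolding ce_set_def by blast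
qed

lemma partial_rec_of_ce_graph:
  assumes "ce (Suc k) (\<lambda>ys. P (hd ys) (tl ys))"
    and unique: "\<And>xs y z. length xs = k \<Longrightarrow> P y xs \<Longrightarrow> P z xs \<Longrightarrow> y = z"
  obtains f where "\<And>xs y. length xs = k \<Longrightarrow> rec_eval f xs y \<longleftrightarrow> P y xs"
proof -
  obtain R where R: "dec (Suc (Suc k)) (\<lambda>ys. R (hd ys) (tl ys))"
    and P: "\<And>xs. length xs = Suc k \<Longrightarrow> P (hd xs) (tl xs) \<longleftrightarrow> (\<exists>s. R s xs)"
    using assms(1) by (rule ceE) blast
  let ?Gs = "[\<lambda>ys. fst (prod_decode (hd ys)), \<lambda>ys. snd (prod_decode (hd ys))] @
      map (\<lambda>i ys. ys ! Suc i) [0..<k]"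
  have "total_rec (Suc k) G" if "G \<in> set ?Gs" for G
    using that by (auto intro!: total_rec_prod_decode total_rec_var(1) total_rec_nth)
  then have "dec (Suc k) (\<lambda>xs. (\<lambda>ys. R (hd ys) (tl ys)) (map (\<lambda>G. G xs) ?Gs))"
    using R dec_list_comp[of ?Gs "\<lambda>ys. R (hd ys) (tl ys)" "Suc k"] by simp
  then have "dec (Suc k) (\<lambda>ys. R (fst (prod_decode (hd ys))) (snd (prod_decode (hd ys)) # tl ys))"
  proof (rule dec_cong[rotated])
    fix xs :: "nat list" assume "length xs = Suc k"
    then have "map (\<lambda>i. xs ! Suc i) [0..<k] = tl xs"
      by (intro nth_equalityI) (auto simp: nth_tl)
    then show "(\<lambda>ys. R (hd ys) (tl ys)) (map (\<lambda>G. G xs) ?Gs) =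
      R (fst (prod_decode (hd xs))) (snd (prod_decode (hd xs)) # tl xs)"
      by (simp add: comp_def)
  qed
  then obtain f where f: "\<And>xs n. length xs = k \<Longrightarrow> rec_eval (Mu f) xs n \<longleftrightarrow>
      R (fst (prod_decode n)) (snd (prod_decode n) # xs) \<and>
      (\<forall>m<n. \<not> R (fst (prod_decode m)) (snd (prod_decode m) # xs))"
    by (rule rec_eval_Mu_dec[where R = "\<lambda>n xs. R (fst (prod_decode n)) (snd (prod_decode n) # xs)"]) blast
  have "total_rec 1 (\<lambda>xs. snd (prod_decode (hd xs)))"
    by (intro total_rec_prod_decode total_rec_var) simp
  then obtain g where g: "\<And>xs y. length xs = 1 \<Longrightarrow> rec_eval g xs y \<longleftrightarrow> y = snd (prod_decode (hd xs))"
    by (rule total_rec_exact) blast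
  have "rec_eval (Comp g [Mu f]) xs y \<longleftrightarrow> P y xs" if xs: "length xs = k" for xs y
  proof
    assume "rec_eval (Comp g [Mu f]) xs y"
    then obtain ns where "list_all2 (\<lambda>h n. rec_eval h xs n) [Mu f] ns" "rec_eval g ns y" by auto
    then obtain n where "rec_eval (Mu f) xs n" and y: "rec_eval g [n] y"
      by (auto simp: list_all2_Cons1 intro: rec_eval.mu)
    then have "R (fst (prod_decode n)) (y # xs)" using f[OF xs] g[of "[n]"] by simp
    then show "P y xs" using P[of "y # xs"] xs by auto
  next
    assume y: "P y xs"
    then obtain s where s: "R s (y # xs)" using P[of "y # xs"] xs by auto
    let ?Q = "\<lambda>n. R (fst (prod_decode n)) (snd (prod_decode n) # xs)"
    have "?Q (prod_encode (s, y))" using s by simp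
    then obtain n where n: "?Q n" "\<forall>m<n. \<not> ?Q m" using exists_least_iff[of ?Q] by blast
    then have "P (snd (prod_decode n)) xs" using P[of "snd (prod_decode n) # xs"] xs by auto
    then have "snd (prod_decode n) = y" using unique[OF xs] y by blast
    moreover have "rec_eval (Mu f) xs n" using n f[OF xs] by blast
    ultimately show "rec_eval (Comp g [Mu f]) xs y"
      by (intro rec_eval.comp[where ys = "[n]"]) (simp_all add: g)
  qed
  then show ?thesis by (rule that)
qed

section \<open>Codings of strings, machines and rationals\<close>

lemma inj_str_code: "str_code s = str_code t \<Longrightarrow> s = t"
proof (induction s arbitrary: t)
  case Nil
  then show ?case by (cases t) (auto split: if_splits)
next
  case (Cons b s)
  then obtain c u where t: "t = c # u" by (cases t) (auto split: if_splits)
  have "2 * x + (if b then 2 else 1) = 2 * y + (if c then 2 else 1) \<Longrightarrow> b = c \<and> x = y" for x y :: nat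
    by (cases b; cases c) presburger+
  from this[of "str_code s" "str_code u"] have "b = c" "str_code s = str_code u"
    using Cons.prems unfolding t str_code.simps by blast+
  then show ?case using Cons.IH[of u] t by simp
qed

lemma surj_str_code: "\<exists>s. str_code s = n"
proof (induction n rule: less_induct)
  case (less n)
  show ?case
  proof (cases "n = 0")
    case True
    then show ?thesis by (intro exI[of _ "[]"]) simp
  next
    case False
    then have "(n - 1) div 2 < n" by linarith
    then obtain s where s: "str_code s = (n - 1) div 2" using less by blast
    show ?thesis
    proof (cases "even n")
      case True
      with False s show ?thesis by (intro exI[of _ "True # s"]) (auto elim!: evenE)
    next
      case False
      with s show ?thesis by (intro exI[of _ "False # s"]) (auto elim!: oddE)
    qed
  qed
qed

definition str_decode :: "nat \<Rightarrow> bool list" where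
  "str_decode = inv str_code"

lemma str_code_decode [simp]: "str_code (str_decode n) = n"
  unfolding str_decode_def by (rule f_inv_into_f) (use surj_str_code[of n] in auto)

lemma str_decode_code [simp]: "str_decode (str_code s) = s"
  by (rule inj_str_code) simp

lemma str_code_eq_iff: "str_code s = n \<longleftrightarrow> s = str_decode n"
  by auto

lemma str_code_append: "str_code (s @ t) = str_code s + 2 ^ length s * str_code t"
  by (induction s) (auto simp: algebra_simps)

lemma str_code_bounds: "2 ^ length s \<le> Suc (str_code s)" "Suc (str_code s) < 2 ^ Suc (length s)"
  by (induction s) auto

definition strlen :: "nat \<Rightarrow> nat" where
  "strlen n = length (str_decode n)"

lemma total_rec_strlen:
  assumes "total_rec k F"
  shows "total_rec k (\<lambda>xs. strlen (F xs))"
proof (rule total_rec_comp1[OF _ assms])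
  have "total_rec 1 (\<lambda>xs. \<Sum>i<hd xs. of_bool (2 ^ Suc i \<le> Suc (hd xs)))"
    by (intro rec_intros) auto
  moreover have "(\<Sum>i<n. of_bool (2 ^ Suc i \<le> Suc n)) = strlen n" for n
  proof -
    let ?l = "length (str_decode n)"
    have b: "2 ^ ?l \<le> Suc n" "Suc n < 2 ^ Suc ?l" using str_code_bounds[of "str_decode n"] by simp_all
    have "2 ^ Suc i \<le> Suc n \<longleftrightarrow> i < ?l" for i
    proof
      assume "2 ^ Suc i \<le> Suc n"
      with b have "(2::nat) ^ Suc i < 2 ^ Suc ?l" by linarith
      then show "i < ?l" by simp
    next
      assume "i < ?l"
      then have "(2::nat) ^ Suc i \<le> 2 ^ ?l" by (intro power_increasing) auto
      with b show "2 ^ Suc i \<le> Suc n" by linarith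
    qed
    moreover have "?l \<le> n" using b(1) less_exp[of ?l] by linarith
    then have "{..<n} \<inter> {i. i < ?l} = {..<?l}" by auto
    ultimately show ?thesis by (simp only: sum_of_bool_eq finite_lessThan card_lessThan of_nat_id strlen_def)
  qed
  ultimately show "total_rec 1 (\<lambda>xs. strlen (hd xs))" by simp
qed

lemma turing_machine_iff_ce:
  "turing_machine U \<longleftrightarrow> ce 2 (\<lambda>xs. U (str_decode (hd (tl xs))) = Some (str_decode (hd xs)))"
proof
  assume "turing_machine U"
  then obtain f where f: "\<And>\<tau> y. rec_eval f [str_code \<tau>] y \<longleftrightarrow> (\<exists>\<rho>. U \<tau> = Some \<rho> \<and> y = str_code \<rho>)"
    unfolding turing_machine_def by blast
  have "ce 2 (\<lambda>xs. rec_eval f (tl xs) (hd xs))"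
    using ce_rec_eval[of 1 f] by (simp add: numeral_2_eq_2)
  then show "ce 2 (\<lambda>xs. U (str_decode (hd (tl xs))) = Some (str_decode (hd xs)))"
    by (rule ce_cong[rotated])
      (use f[of "str_decode _"] in \<open>auto simp: length_Suc_conv numeral_2_eq_2\<close>)
next
  assume *: "ce 2 (\<lambda>xs. U (str_decode (hd (tl xs))) = Some (str_decode (hd xs)))"
  obtain f where "\<And>xs y. length xs = 1 \<Longrightarrow> rec_eval f xs y \<longleftrightarrow> U (str_decode (hd xs)) = Some (str_decode y)"
    by (rule partial_rec_of_ce_graph[where k = 1 and P = "\<lambda>y xs. U (str_decode (hd xs)) = Some (str_decode y)"])
      (use * in \<open>auto simp: numeral_2_eq_2 str_code_eq_iff dest: arg_cong[where f = str_code]\<close>)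
  from this[of "[_]"] have "\<forall>\<tau> y. rec_eval f [str_code \<tau>] y \<longleftrightarrow> (\<exists>\<rho>. U \<tau> = Some \<rho> \<and> y = str_code \<rho>)"
    by (auto intro: exI[of _ "str_decode _"])
  then show "turing_machine U" unfolding turing_machine_def by blast
qed

lemma ce_machine:
  assumes "turing_machine U" "total_rec k F" "total_rec k G"
  shows "ce k (\<lambda>xs. U (str_decode (F xs)) = Some (str_decode (G xs)))"
  by (rule ce_subst2[where P = "\<lambda>a b. U (str_decode b) = Some (str_decode a)"])
    (use assms turing_machine_iff_ce in auto)

lemma ce_dom:
  assumes "turing_machine U" "total_rec k F"
  shows "ce k (\<lambda>xs. str_decode (F xs) \<in> dom U)"
proof -
  have "ce 1 (\<lambda>xs. \<exists>y. U (str_decode (hd xs)) = Some (str_decode y))"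
    by (intro ce_ex ce_machine assms(1) total_rec_var) auto
  then have "ce 1 (\<lambda>xs. str_decode (hd xs) \<in> dom U)"
    by (rule ce_cong[rotated]) (auto intro: exI[of _ "str_code _"])
  then show ?thesis by (rule ce_subst1[where P = "\<lambda>x. str_decode x \<in> dom U"]) (rule assms)
qed

lemma universal_ce:
  assumes "effective_list turing_machine M"
  obtains R where "dec 3 (\<lambda>xs. R (hd xs) (hd (tl xs)) (hd (tl (tl xs))))"
    "\<And>Z. ce_set Z \<Longrightarrow> \<exists>e. \<forall>n. n \<in> Z \<longleftrightarrow> (\<exists>s. R s e n)"
proof -
  obtain f where f: "\<And>e \<tau> y. rec_eval f [e, str_code \<tau>] y \<longleftrightarrow> (\<exists>\<rho>. M e \<tau> = Some \<rho> \<and> y = str_code \<rho>)"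
    using assms unfolding effective_list_def by blast
  have "ce 2 (\<lambda>xs. \<exists>y. rec_eval f xs y)"
    by (rule ce_ex) (use ce_rec_eval[of 2 f] in simp)
  then obtain R where R: "dec (Suc 2) (\<lambda>ys. R (hd ys) (tl ys))"
    and fR: "\<And>xs. length xs = 2 \<Longrightarrow> (\<exists>y. rec_eval f xs y) \<longleftrightarrow> (\<exists>s. R s xs)"
    by (rule ceE) blast
  show ?thesis
  proof
    show "dec 3 (\<lambda>xs. (\<lambda>s e n. R s [e, n]) (hd xs) (hd (tl xs)) (hd (tl (tl xs))))"
      by (rule dec_cong[OF _ R[folded eval_nat_numeral]])
        (auto simp: numeral_3_eq_3 length_Suc_conv)
    fix Z assume Z: "ce_set Z"
    let ?U = "\<lambda>\<tau>. if str_code \<tau> \<in> Z then Some [] else None"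
    have "ce 2 (\<lambda>xs. hd (tl xs) \<in> Z \<and> hd xs = 0)"
      by (intro ce_conj ce_subst1[OF Z[unfolded ce_set_iff_ce]] ce_dec dec_eq total_rec_const
          total_rec_var) simp_all
    then have "turing_machine ?U"
      unfolding turing_machine_iff_ce
      by (rule ce_cong[rotated]) (auto simp: str_code_eq_iff[symmetric] eq_commute[of "[]"] split: if_splits)
    then obtain e where e: "M e = ?U"
      using assms unfolding effective_list_def by (metis (no_types, lifting) mem_Collect_eq imageE)
    have "n \<in> Z \<longleftrightarrow> (\<exists>s. R s [e, n])" for n
    proof -
      have "n \<in> Z \<longleftrightarrow> (\<exists>y. rec_eval f [e, n] y)"
        using f[of e "str_decode n"] e by auto
      then show ?thesis using fR[of "[e, n]"] by simp
    qed
    then show "\<exists>e. \<forall>n. n \<in> Z \<longleftrightarrow> (\<exists>s. R s [e, n])" by blast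
  qed
qed

definition rat_code :: "nat \<Rightarrow> nat \<Rightarrow> nat \<Rightarrow> nat" where
  "rat_code p q r = prod_encode (if q \<le> p then 2 * (p - q) else 2 * (q - p) - 1, 2 * r)"

abbreviation code_real :: "nat \<Rightarrow> real" where
  "code_real n \<equiv> of_rat (nat_to_rat_surj n)"

lemma int_decode_even: "int_decode (2 * n) = int n"
  and int_decode_odd: "int_decode (Suc (2 * n)) = - int n - 1"
  by (simp_all add: int_decode_def sum_decode_def)

lemma code_real_rat_code: "code_real (rat_code p q r) = (real p - real q) / real r"
proof -
  have "int_decode (if q \<le> p then 2 * (p - q) else 2 * (q - p) - 1) = int p - int q"
  proof (cases "q \<le> p")
    case False
    then obtain m where q: "q = Suc (p + m)" by (auto simp: not_le less_iff_Suc_add)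
    have "2 * (q - p) - 1 = Suc (2 * m)" by (simp add: q)
    with False show ?thesis by (simp add: int_decode_odd q)
  qed (simp add: int_decode_even)
  then show ?thesis
    unfolding nat_to_rat_surj_def rat_code_def
    by (simp add: Let_def int_decode_even Fract_of_int_quotient of_rat_divide of_rat_diff del: of_rat_of_int_eq)
qed

lemma total_rec_rat_code:
  "total_rec k F \<Longrightarrow> total_rec k G \<Longrightarrow> total_rec k H \<Longrightarrow> total_rec k (\<lambda>xs. rat_code (F xs) (G xs) (H xs))"
  unfolding rat_code_def by (intro rec_intros)

lemma dec_rat_less:
  assumes "total_rec k F" "total_rec k G"
  shows "dec k (\<lambda>xs. nat_to_rat_surj (F xs) < nat_to_rat_surj (G xs))"
proof -
  define pos where "pos n = (if n mod 2 = 0 then n div 2 else 0)" for n :: nat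
  define neg where "neg n = (if n mod 2 = 0 then 0 else Suc (n div 2))" for n :: nat
  have int_decode: "int_decode n = int (pos n) - int (neg n)" for n
  proof (cases "even n")
    case True
    then obtain m where "n = 2 * m" by (rule evenE)
    then show ?thesis by (simp add: pos_def neg_def int_decode_even)
  next
    case False
    then obtain m where "n = Suc (2 * m)" by (auto elim: oddE)
    then show ?thesis by (simp only: int_decode_odd) (simp add: pos_def neg_def)
  qed
  define y where "y n = pos (snd (prod_decode n)) + neg (snd (prod_decode n))" for n
  define A where "A n = pos (fst (prod_decode n)) * pos (snd (prod_decode n)) +
    neg (fst (prod_decode n)) * neg (snd (prod_decode n))" for n
  define B where "B n = pos (fst (prod_decode n)) * neg (snd (prod_decode n)) +
    neg (fst (prod_decode n)) * pos (snd (prod_decode n))" for n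
  define D where "D n = y n * y n + of_bool (y n = 0)" for n
  have D: "0 < D n" for n by (cases "y n = 0") (simp_all add: D_def)
  have val: "nat_to_rat_surj n = (rat_of_nat (A n) - rat_of_nat (B n)) / rat_of_nat (D n)" for n
  proof -
    let ?i = "fst (prod_decode n)" and ?j = "snd (prod_decode n)"
    let ?x = "rat_of_nat (pos ?i) - rat_of_nat (neg ?i)" and ?d = "rat_of_nat (pos ?j) - rat_of_nat (neg ?j)"
    have "nat_to_rat_surj n = ?x / ?d"
      by (simp add: nat_to_rat_surj_def case_prod_beta Let_def Fract_of_int_quotient int_decode)
    also have "\<dots> = (?x * ?d) / (?d * ?d + of_bool (?d = 0))" by simp
    also have "?x * ?d = rat_of_nat (A n) - rat_of_nat (B n)"
      by (simp add: A_def B_def algebra_simps)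
    also have "pos ?j = 0 \<or> neg ?j = 0" by (simp add: pos_def neg_def)
    then have "?d * ?d + of_bool (?d = 0) = rat_of_nat (D n)"
      by (auto simp: D_def y_def)
    finally show ?thesis .
  qed
  have "nat_to_rat_surj m < nat_to_rat_surj n \<longleftrightarrow> A m * D n + B n * D m < A n * D m + B m * D n" for m n
  proof -
    have "nat_to_rat_surj m < nat_to_rat_surj n \<longleftrightarrow>
      (rat_of_nat (A m) - rat_of_nat (B m)) * rat_of_nat (D n) < (rat_of_nat (A n) - rat_of_nat (B n)) * rat_of_nat (D m)"
      unfolding val using D[of m] D[of n] by (simp add: divide_simps)
    also have "\<dots> \<longleftrightarrow> rat_of_nat (A m * D n + B n * D m) < rat_of_nat (A n * D m + B m * D n)"
      by (simp add: algebra_simps)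
    finally show ?thesis by (simp only: of_nat_less_iff)
  qed
  moreover have "dec k (\<lambda>xs. A (F xs) * D (G xs) + B (G xs) * D (F xs) < A (G xs) * D (F xs) + B (F xs) * D (G xs))"
  proof -
    have pn: "total_rec j (\<lambda>xs. pos (H xs))" "total_rec j (\<lambda>xs. neg (H xs))" if "total_rec j H" for j H
      unfolding pos_def neg_def by (intro rec_intros that)+
    have "total_rec 1 (\<lambda>xs. y (hd xs))"
      unfolding y_def by (intro rec_intros pn) simp_all
    note y = total_rec_comp1[where f = y, OF this]
    have "total_rec 1 (\<lambda>xs. A (hd xs))"
      unfolding A_def by (intro rec_intros pn) simp_all
    note A = total_rec_comp1[where f = A, OF this]
    have "total_rec 1 (\<lambda>xs. B (hd xs))"
      unfolding B_def by (intro rec_intros pn) simp_all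
    note B = total_rec_comp1[where f = B, OF this]
    have "total_rec 1 (\<lambda>xs. D (hd xs))"
      unfolding D_def by (intro rec_intros y) simp_all
    note D = total_rec_comp1[where f = D, OF this]
    show ?thesis by (intro rec_intros A B D assms)
  qed
  ultimately show ?thesis by simp
qed

lemma uniformly_ce_openI:
  assumes "ce 3 (\<lambda>xs. E (hd xs) (hd (tl xs)) (hd (tl (tl xs))))"
  shows "uniformly_ce_open (\<lambda>n. \<Union>{{code_real a <..< code_real b} | a b. E n a b})"
proof -
  let ?E = "\<lambda>w. E (fst (prod_decode w)) (fst (prod_decode (snd (prod_decode w))))
    (snd (prod_decode (snd (prod_decode w))))"
  have "ce 1 (\<lambda>xs. ?E (hd xs))"
    by (intro ce_subst3[where P = E, OF assms] rec_intros) auto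
  then have "ce_set {w. ?E w}" by (simp add: ce_set_iff_ce)
  then show ?thesis
    unfolding uniformly_ce_open_def by (intro exI[of _ "{w. ?E w}"]) simp
qed

lemma uniformly_ce_openE:
  assumes "uniformly_ce_open V"
  obtains E where "ce 3 (\<lambda>xs. E (hd xs) (hd (tl xs)) (hd (tl (tl xs))))"
    "\<And>n. V n = \<Union>{{code_real a <..< code_real b} | a b. E n a b}"
proof -
  obtain W where W: "ce_set W" and V: "\<And>n. V n = \<Union>{{code_real a <..< code_real b} | a b.
      prod_encode (n, prod_encode (a, b)) \<in> W}"
    using assms unfolding uniformly_ce_open_def by blast
  show ?thesis
  proof
    show "ce 3 (\<lambda>xs. (\<lambda>n a b. prod_encode (n, prod_encode (a, b)) \<in> W) (hd xs) (hd (tl xs)) (hd (tl (tl xs))))"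
      by (intro ce_subst1[OF W[unfolded ce_set_iff_ce]] rec_intros) simp_all
  qed (rule V)
qed

section \<open>A difference of left-c.e. reals that is neither left-c.e. nor right-c.e.\<close>

definition nbit :: "nat \<Rightarrow> nat \<Rightarrow> bool" where
  "nbit a j \<longleftrightarrow> a div 2 ^ j mod 2 = 1"

lemma dec_nbit: "total_rec k F \<Longrightarrow> total_rec k G \<Longrightarrow> dec k (\<lambda>xs. nbit (F xs) (G xs))"
  unfolding nbit_def by (intro rec_intros)

lemma sum_of_bool_less_power: "(\<Sum>i<n. of_bool (P i) * 2 ^ i) < (2 ^ n :: nat)"
proof (induction n)
  case (Suc n)
  have "of_bool (P n) * 2 ^ n \<le> (2 ^ n :: nat)" by simp
  with Suc show ?case by (simp only: sum.lessThan_Suc power_Suc)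
qed simp

lemma nbit_sum: "nbit (\<Sum>i<n. of_bool (P i) * 2 ^ i) j \<longleftrightarrow> j < n \<and> P j"
proof (induction n)
  case 0
  show ?case by (simp add: nbit_def)
next
  case (Suc n)
  let ?x = "\<Sum>i<n. of_bool (P i) * 2 ^ i :: nat"
  have x: "?x < 2 ^ n" by (rule sum_of_bool_less_power)
  consider "j < n" | "j = n" | "n < j" by linarith
  then show ?case
  proof cases
    case 1
    then have "(2::nat) ^ n = 2 ^ j * (2 * 2 ^ (n - Suc j))"
      by (simp flip: power_add power_Suc)
    then have "(?x + of_bool (P n) * 2 ^ n) div 2 ^ j = ?x div 2 ^ j + 2 * (of_bool (P n) * 2 ^ (n - Suc j))"
      by simp
    then have "(?x + of_bool (P n) * 2 ^ n) div 2 ^ j mod 2 = ?x div 2 ^ j mod 2" by simp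
    with Suc 1 show ?thesis by (simp add: nbit_def)
  next
    case 2
    with x show ?thesis by (simp add: nbit_def)
  next
    case 3
    have "?x + of_bool (P n) * 2 ^ n < 2 ^ Suc n"
      using sum_of_bool_less_power[of P "Suc n"] by (simp only: sum.lessThan_Suc)
    also have "\<dots> \<le> 2 ^ j" using 3 by (intro power_increasing) auto
    finally show ?thesis using 3 by (simp add: nbit_def)
  qed
qed

text \<open>Finite sets of numbers are coded in binary; \<open>Q s a i\<close> asks for the number \<open>i\<close> to be put
  into the current set \<open>a\<close> at stage \<open>s\<close>.\<close>

primrec stages :: "(nat \<Rightarrow> nat \<Rightarrow> nat \<Rightarrow> bool) \<Rightarrow> nat \<Rightarrow> nat" where
  "stages Q 0 = 0"
| "stages Q (Suc s) = (\<Sum>i<s. of_bool (nbit (stages Q s) i \<or> Q s (stages Q s) i) * 2 ^ i)"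

definition stage_limit :: "(nat \<Rightarrow> nat \<Rightarrow> nat \<Rightarrow> bool) \<Rightarrow> nat set" where
  "stage_limit Q = {i. \<exists>s. nbit (stages Q s) i}"

lemma nbit_stages_Suc: "nbit (stages Q (Suc s)) i \<longleftrightarrow> i < s \<and> (nbit (stages Q s) i \<or> Q s (stages Q s) i)"
  by (simp only: stages.simps nbit_sum)

lemma nbit_stages_less: "nbit (stages Q s) i \<Longrightarrow> i < s"
proof (cases s)
  case 0
  then show "nbit (stages Q s) i \<Longrightarrow> i < s" by (simp add: nbit_def)
next
  case (Suc t)
  then show "nbit (stages Q s) i \<Longrightarrow> i < s" by (simp add: nbit_stages_Suc del: stages.simps(2))
qed

lemma nbit_stages_mono: "s \<le> t \<Longrightarrow> nbit (stages Q s) i \<Longrightarrow> nbit (stages Q t) i"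
proof (induction t rule: dec_induct)
  case (step t)
  then show ?case using nbit_stages_less by (simp add: nbit_stages_Suc del: stages.simps(2))
qed

lemma stage_limit_imp: "i \<in> stage_limit Q \<Longrightarrow> \<exists>s. Q s (stages Q s) i"
proof -
  assume "i \<in> stage_limit Q"
  then obtain s where "nbit (stages Q s) i" by (auto simp: stage_limit_def)
  then show ?thesis
    by (induction s) (auto simp: nbit_stages_Suc nbit_def[of 0] simp del: stages.simps(2))
qed

lemma stage_limitI: "i < s \<Longrightarrow> Q s (stages Q s) i \<Longrightarrow> i \<in> stage_limit Q"
  unfolding stage_limit_def
  by (auto intro!: exI[of _ "Suc s"] simp: nbit_stages_Suc simp del: stages.simps(2))

lemma stages_agree_below:
  "\<exists>s\<^sub>0. \<forall>s\<ge>s\<^sub>0. \<forall>j<i. nbit (stages Q s) j \<longleftrightarrow> j \<in> stage_limit Q"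
proof (induction i)
  case (Suc i)
  then obtain s\<^sub>0 where s0: "\<And>s j. s \<ge> s\<^sub>0 \<Longrightarrow> j < i \<Longrightarrow> nbit (stages Q s) j \<longleftrightarrow> j \<in> stage_limit Q" by blast
  show ?case
  proof (cases "i \<in> stage_limit Q")
    case True
    then obtain s\<^sub>1 where "nbit (stages Q s\<^sub>1) i" by (auto simp: stage_limit_def)
    then have "nbit (stages Q s) i" if "s \<ge> s\<^sub>1" for s using that nbit_stages_mono by blast
    then show ?thesis using s0 True
      by (intro exI[of _ "max s\<^sub>0 s\<^sub>1"]) (simp add: less_Suc_eq all_conj_distrib imp_disjL)
  next
    case False
    then have "\<not> nbit (stages Q s) i" for s by (auto simp: stage_limit_def)
    then show ?thesis using s0 False
      by (intro exI[of _ s\<^sub>0]) (simp add: less_Suc_eq all_conj_distrib imp_disjL)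
  qed
qed simp

lemma total_rec_stages:
  assumes Q: "dec 3 (\<lambda>xs. Q (hd xs) (hd (tl xs)) (hd (tl (tl xs))))"
  shows "total_rec 1 (\<lambda>xs. stages Q (hd xs))"
proof -
  have Q': "dec k (\<lambda>xs. Q (F xs) (G xs) (H xs))" if "total_rec k F" "total_rec k G" "total_rec k H" for k F G H
    using dec_list_comp[of "[F, G, H]" "\<lambda>xs. Q (hd xs) (hd (tl xs)) (hd (tl (tl xs)))" k] Q that
    by (auto simp: numeral_3_eq_3)
  have "total_rec 1 (\<lambda>xs. rec_nat 0 (\<lambda>s a. \<Sum>i<s. of_bool (nbit a i \<or> Q s a i) * 2 ^ i) (hd xs))"
    by (rule total_rec_primrec; (intro rec_intros dec_nbit Q')?; simp?)
  moreover have "rec_nat 0 (\<lambda>s a. \<Sum>i<s. of_bool (nbit a i \<or> Q s a i) * 2 ^ i) s = stages Q s" for s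
    by (induction s) simp_all
  ultimately show ?thesis by simp
qed

lemma ce_stage_limit:
  assumes "dec 3 (\<lambda>xs. Q (hd xs) (hd (tl xs)) (hd (tl (tl xs))))"
  shows "ce_set (stage_limit Q)"
proof -
  have "ce 1 (\<lambda>xs. \<exists>s. nbit (stages Q s) (hd xs))"
    by (intro ce_ex ce_dec dec_nbit total_rec_comp1[OF total_rec_stages[OF assms]] total_rec_var) simp_all
  then show ?thesis by (simp add: ce_set_iff_ce stage_limit_def)
qed

definition base4 :: "nat set \<Rightarrow> real" where
  "base4 X = (\<Sum>j. of_bool (j \<in> X) * (1/4) ^ Suc j)"

lemma summable_base4: "summable (\<lambda>j. of_bool (j \<in> X) * (1/4::real) ^ Suc j)"
  by (rule summable_comparison_test'[where g = "\<lambda>j. (1/4) ^ j" and N = 0])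
    (auto intro: summable_geometric)

lemma base4_split:
  defines "S \<equiv> \<lambda>X i. \<Sum>j<i. of_bool (j \<in> X) * (1/4::real) ^ Suc j"
  shows "S X i + of_bool (i \<in> X) * (1/4) ^ Suc i \<le> base4 X"
    and "base4 X \<le> S X i + (of_bool (i \<in> X) + 1/3) * (1/4) ^ Suc i"
proof -
  let ?f = "\<lambda>j. of_bool (j \<in> X) * (1/4::real) ^ Suc j"
  let ?t = "\<Sum>j. ?f (j + Suc i)"
  have eq: "base4 X = S X i + of_bool (i \<in> X) * (1/4) ^ Suc i + ?t"
    unfolding base4_def S_def using suminf_split_initial_segment[OF summable_base4, of X "Suc i"] by simp
  have sm: "summable (\<lambda>j. ?f (j + Suc i))" by (rule summable_ignore_initial_segment[OF summable_base4])
  have "0 \<le> ?t" by (intro suminf_nonneg sm) auto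
  with eq show "S X i + of_bool (i \<in> X) * (1/4) ^ Suc i \<le> base4 X" by simp
  have g: "(\<lambda>j. (1/4) ^ Suc (Suc i) * (1/4::real) ^ j) sums ((1/4) ^ Suc (Suc i) * (1 / (1 - 1/4)))"
    by (intro sums_mult geometric_sums) simp
  have "?t \<le> (1/4) ^ Suc (Suc i) * (1 / (1 - 1/4))"
    unfolding sums_unique[OF g] by (intro suminf_le sm sums_summable[OF g]) (auto simp: power_add)
  then show "base4 X \<le> S X i + (of_bool (i \<in> X) + 1/3) * (1/4) ^ Suc i"
    unfolding eq by (simp add: algebra_simps)
qed

definition weight :: "nat \<Rightarrow> nat \<Rightarrow> nat" where
  "weight a i = (\<Sum>j<i. of_bool (nbit a j) * 4 ^ (i - j))"

lemma total_rec_weight: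
  assumes "total_rec k F" "total_rec k G"
  shows "total_rec k (\<lambda>xs. weight (F xs) (G xs))"
proof (rule total_rec_comp2[OF _ assms])
  show "total_rec 2 (\<lambda>xs. weight (hd xs) (hd (tl xs)))"
    unfolding weight_def by (intro rec_intros dec_nbit) auto
qed

lemma real_weight: "real (weight a i) / 4 ^ Suc i = (\<Sum>j<i. of_bool (nbit a j) * (1/4) ^ Suc j)"
proof -
  have "real (of_bool b * 4 ^ (i - j)) / 4 ^ Suc i = of_bool b * (1/4) ^ Suc j" if "j < i" for j b
  proof -
    have "(4::real) ^ Suc i = 4 ^ Suc j * 4 ^ (i - j)" using that by (simp flip: power_add)
    then show ?thesis by (simp add: power_one_over divide_simps)
  qed
  then show ?thesis
    unfolding weight_def of_nat_sum sum_divide_distrib by (intro sum.cong) auto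
qed

text \<open>An index \<open>i\<close> codes an enumeration index \<open>e\<close>, a scale \<open>k\<close>, padding, and a guess \<open>g\<close> of the
  opposite set below \<open>i\<close>.\<close>

definition guess :: "nat \<Rightarrow> nat" where
  "guess i = snd (prod_decode i)"

definition enum_index :: "nat \<Rightarrow> nat" where
  "enum_index i = fst (prod_decode (fst (prod_decode (fst (prod_decode i)))))"

definition scale_index :: "nat \<Rightarrow> nat" where
  "scale_index i = snd (prod_decode (fst (prod_decode (fst (prod_decode i)))))"

text \<open>The rational asked for is the value that the difference would have if \<open>i\<close> contributed half of its
  weight \<open>4^-(i+1)\<close>. Later indices weigh too little to reach it from either side, so it lies below the
  difference if and only if \<open>i\<close> stays out.\<close>

definition attack :: "(nat \<Rightarrow> nat \<Rightarrow> nat \<Rightarrow> bool) \<Rightarrow> (nat \<Rightarrow> nat \<Rightarrow> nat \<Rightarrow> nat) \<Rightarrow> (nat \<Rightarrow> bool) \<Rightarrow>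
    nat \<Rightarrow> nat \<Rightarrow> nat \<Rightarrow> bool" where
  "attack R c S s a i \<longleftrightarrow> S i \<and> (\<exists>t<s. R t (enum_index i)
     (c (2 * weight (guess i) i) (2 * weight a i + 1) (2 * 4 ^ Suc i * 2 ^ scale_index i)))"

lemma attack_succeeds:
  fixes \<sigma> :: real
  assumes c: "\<And>p q r. \<sigma> * code_real (c p q r) = (real p - real q) / real r"
    and e: "\<And>n. (\<exists>t. R t (enum_index i) n) \<longleftrightarrow>
      \<sigma> * code_real n < (1/2) ^ scale_index i * (base4 B - base4 (stage_limit (attack R c S)))"
    and S: "S i" and g: "\<And>j. j < i \<Longrightarrow> nbit (guess i) j \<longleftrightarrow> j \<in> B" and B: "i \<notin> B"
  shows False
proof -
  define Q where "Q = attack R c S"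
  define A where "A = stage_limit Q"
  define h where "h = (1/4::real) ^ Suc i"
  define G where "G = (\<Sum>j<i. of_bool (j \<in> B) * (1/4::real) ^ Suc j)"
  define D where "D = (\<Sum>j<i. of_bool (j \<in> A) * (1/4::real) ^ Suc j)"
  define W where "W a = (\<Sum>j<i. of_bool (nbit a j) * (1/4::real) ^ Suc j)" for a
  define n where "n a = c (2 * weight (guess i) i) (2 * weight a i + 1) (2 * 4 ^ Suc i * 2 ^ scale_index i)" for a
  have h: "0 < h" by (simp add: h_def)
  have \<sigma>n: "\<sigma> * code_real (n a) = (1/2) ^ scale_index i * (G - W a - h / 2)" for a
  proof -
    have G: "G = real (weight (guess i) i) / 4 ^ Suc i"
      unfolding real_weight G_def using g by (intro sum.cong) auto
    have "\<sigma> * code_real (n a) = (1/2) ^ scale_index i * (real (weight (guess i) i) / 4 ^ Suc i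
        - real (weight a i) / 4 ^ Suc i - h / 2)"
      unfolding n_def c h_def by (simp add: field_simps)
    then show ?thesis by (simp only: G W_def real_weight)
  qed
  have R: "(\<exists>t. R t (enum_index i) (n a)) \<longleftrightarrow> G - W a - h / 2 < base4 B - base4 A" for a
    unfolding e \<sigma>n A_def Q_def by (rule mult_less_cancel_left_pos) simp
  have Q: "Q s a i \<longleftrightarrow> (\<exists>t<s. R t (enum_index i) (n a))" for s a
    using S by (simp add: Q_def attack_def n_def)
  have up: "base4 B \<le> G + h / 3"
    using base4_split(2)[where X = B and i = i] B by (simp add: G_def h_def)
  have lo: "G \<le> base4 B"
    using base4_split(1)[where X = B and i = i] B by (simp add: G_def)
  show False
  proof (cases "i \<in> A")
    case True
    then obtain s where "Q s (stages Q s) i" using stage_limit_imp unfolding A_def by blast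
    then have "G - W (stages Q s) - h / 2 < base4 B - base4 A" unfolding Q using R by blast
    moreover have "W (stages Q s) \<le> D"
      unfolding W_def D_def by (intro sum_mono mult_right_mono) (auto simp: A_def stage_limit_def)
    moreover have "D + h \<le> base4 A"
      using base4_split(1)[where X = A and i = i] True by (simp add: D_def h_def)
    ultimately show False using up h by simp
  next
    case False
    obtain s\<^sub>0 where s0: "\<And>s j. s \<ge> s\<^sub>0 \<Longrightarrow> j < i \<Longrightarrow> nbit (stages Q s) j \<longleftrightarrow> j \<in> A"
      using stages_agree_below[of i Q] unfolding A_def by blast
    have "base4 A \<le> D + h / 3"
      using base4_split(2)[where X = A and i = i] False by (simp add: D_def h_def)
    moreover have "W (stages Q s\<^sub>0) = D"
      unfolding W_def D_def using s0 by (intro sum.cong) auto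
    ultimately have "G - W (stages Q s\<^sub>0) - h / 2 < base4 B - base4 A" using lo h by simp
    then obtain t where t: "R t (enum_index i) (n (stages Q s\<^sub>0))" using R by blast
    define s where "s = max s\<^sub>0 (Suc (max t i))"
    have "weight (stages Q s) i = weight (stages Q s\<^sub>0) i"
      unfolding weight_def using s0[of s] s0[of s\<^sub>0] by (intro sum.cong) (auto simp: s_def)
    then have "n (stages Q s) = n (stages Q s\<^sub>0)" by (simp add: n_def)
    then have "Q s (stages Q s) i" unfolding Q using t by (intro exI[of _ t]) (auto simp: s_def)
    then have "i \<in> A" unfolding A_def by (intro stage_limitI[of i s]) (auto simp: s_def)
    with False show False by simp
  qed
qed

text \<open>The two opponents act on alternating intervals \<open>[f n, f (n+1))\<close>, each long enough to contain
  an index for every guess of the elements below \<open>f n\<close>.\<close>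

primrec interval_start :: "nat \<Rightarrow> nat" where
  "interval_start 0 = 0"
| "interval_start (Suc n) =
    Suc (prod_encode (prod_encode (n, interval_start n), 2 ^ interval_start n))"

definition turn :: "nat \<Rightarrow> nat \<Rightarrow> bool" where
  "turn p i \<longleftrightarrow> (\<exists>n\<le>i. n mod 2 = p \<and> interval_start n \<le> i \<and> i < interval_start (Suc n))"

lemma strict_mono_interval_start: "strict_mono interval_start"
proof (rule strict_mono_Suc_iff[THEN iffD2, rule_format])
  fix n
  have "interval_start n \<le> prod_encode (n, interval_start n)" by (rule le_prod_encode_2)
  also have "\<dots> \<le> prod_encode (prod_encode (n, interval_start n), 2 ^ interval_start n)"
    by (rule le_prod_encode_1)
  finally show "interval_start n < interval_start (Suc n)" by simp
qed

lemma dec_turn: "total_rec k F \<Longrightarrow> dec k (\<lambda>xs. turn p (F xs))"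
proof -
  have "total_rec 1 (\<lambda>xs. rec_nat 0 (\<lambda>n r. Suc (prod_encode (prod_encode (n, r), 2 ^ r))) (hd xs))"
    by (rule total_rec_primrec; (intro rec_intros)?; simp?)
  moreover have "rec_nat 0 (\<lambda>n r. Suc (prod_encode (prod_encode (n, r), 2 ^ r))) n = interval_start n" for n
    by (induction n) simp_all
  ultimately have "total_rec 1 (\<lambda>xs. interval_start (hd xs))" by simp
  note start = total_rec_comp1[where f = interval_start, OF this]
  have "dec 1 (\<lambda>xs. turn p (hd xs))"
    unfolding turn_def by (intro rec_intros start) simp_all
  then show "dec k (\<lambda>xs. turn p (F xs))" if "total_rec k F"
    by (rule dec_subst1[where P = "turn p"]) (rule that)
qed

lemma turn_unique:
  assumes "turn p i" "turn q i"
  shows "p = q"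
proof -
  obtain m n where m: "m mod 2 = p" "interval_start m \<le> i" "i < interval_start (Suc m)"
    and n: "n mod 2 = q" "interval_start n \<le> i" "i < interval_start (Suc n)"
    using assms unfolding turn_def by blast
  have "m < Suc n" "n < Suc m"
    using m n by (meson le_less_trans strict_mono_interval_start strict_mono_less)+
  then have "m = n" by simp
  with m(1) n(1) show ?thesis by simp
qed

lemma attack_index:
  assumes p: "p < 2" and X: "\<And>i. i \<in> X \<Longrightarrow> turn (1 - p) i"
  obtains i where "turn p i" "enum_index i = e" "scale_index i = k" "i \<notin> X"
    "\<And>j. j < i \<Longrightarrow> nbit (guess i) j \<longleftrightarrow> j \<in> X"
proof -
  define n where "n = 2 * prod_encode (e, k) + p"
  define b where "b = interval_start n"
  define g :: nat where "g = (\<Sum>j<b. of_bool (j \<in> X) * 2 ^ j)"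
  define i where "i = prod_encode (prod_encode (prod_encode (e, k), b), g)"
  have "b \<le> prod_encode (prod_encode (e, k), b)" by (rule le_prod_encode_2)
  also have "\<dots> \<le> i" unfolding i_def by (rule le_prod_encode_1)
  finally have bi: "b \<le> i" .
  have mono: "prod_encode (x, y) \<le> prod_encode (x', y')" if "x \<le> x'" "y \<le> y'" for x y x' y'
  proof -
    have "triangle (x + y) \<le> triangle (x' + y')"
      unfolding triangle_def using that by (intro div_le_mono mult_le_mono) auto
    with that show ?thesis by (simp add: prod_encode_def)
  qed
  have "g \<le> 2 ^ b" using sum_of_bool_less_power[of "\<lambda>j. j \<in> X" b] by (simp add: g_def)
  then have ib: "i < interval_start (Suc n)"
    unfolding i_def interval_start.simps less_Suc_eq_le b_def[symmetric]
    by (intro mono) (auto simp: n_def)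
  have "n \<le> b" unfolding b_def by (rule strict_mono_imp_increasing[OF strict_mono_interval_start])
  have range: "turn p j" if "b \<le> j" "j < interval_start (Suc n)" for j
    unfolding turn_def using that \<open>n \<le> b\<close> p by (intro exI[of _ n]) (auto simp: n_def b_def)
  have "p \<noteq> 1 - p" using p by presburger
  then have notX: "j \<notin> X" if "b \<le> j" "j < interval_start (Suc n)" for j
    using turn_unique[OF range[OF that] X[of j]] by blast
  show ?thesis
  proof
    show "turn p i" "i \<notin> X" using range notX bi ib by blast+
    show "enum_index i = e" "scale_index i = k"
      by (simp_all add: i_def enum_index_def scale_index_def)
    fix j assume "j < i"
    have "nbit (guess i) j \<longleftrightarrow> j < b \<and> j \<in> X"
      by (simp only: i_def guess_def g_def prod_encode_inverse snd_conv nbit_sum)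
    also have "\<dots> \<longleftrightarrow> j \<in> X" using notX[of j] \<open>j < i\<close> ib by (meson less_trans not_less)
    finally show "nbit (guess i) j \<longleftrightarrow> j \<in> X" .
  qed
qed

definition base2 :: "nat set \<Rightarrow> real" where
  "base2 X = (\<Sum>j. of_bool (j \<in> X) * (1/2) ^ Suc j)"

lemma base2_odd: "base2 ((\<lambda>j. 2 * j + 1) ` X) = base4 X"
proof -
  let ?g = "\<lambda>j :: nat. 2 * j + 1" and ?f = "\<lambda>j. of_bool (j \<in> (\<lambda>j. 2 * j + 1) ` X) * (1/2::real) ^ Suc j"
  have "base4 X = (\<Sum>j. ?f (?g j))"
    unfolding base4_def by (intro arg_cong[where f = suminf] ext)
      (auto simp: image_iff power_mult power2_eq_square)
  also have "\<dots> = suminf ?f"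
    by (rule suminf_mono_reindex) (auto simp: strict_mono_def)
  finally show ?thesis by (simp only: base2_def)
qed

lemma ce_difference:
  assumes "effective_list turing_machine M"
  obtains A B where "ce_set A" "ce_set B"
    "\<And>k. \<not> left_ce ((1/2) ^ k * (base2 B - base2 A))"
    "\<And>k. \<not> right_ce ((1/2) ^ k * (base2 B - base2 A))"
proof -
  obtain R where R: "dec 3 (\<lambda>xs. R (hd xs) (hd (tl xs)) (hd (tl (tl xs))))"
    and univ: "\<And>Z. ce_set Z \<Longrightarrow> \<exists>e. \<forall>n. n \<in> Z \<longleftrightarrow> (\<exists>s. R s e n)"
    using universal_ce[OF assms] by blast
  have R': "dec k (\<lambda>xs. R (F xs) (G xs) (H xs))" if "total_rec k F" "total_rec k G" "total_rec k H" for k F G H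
    using dec_list_comp[of "[F, G, H]" "\<lambda>xs. R (hd xs) (hd (tl xs)) (hd (tl (tl xs)))" k] R that
    by (auto simp: numeral_3_eq_3)
  define c where "c p q r = rat_code q p r" for p q r
  define Q0 where "Q0 = attack R rat_code (turn 0)"
  define Q1 where "Q1 = attack R c (turn 1)"
  define A where "A = stage_limit Q0"
  define B where "B = stage_limit Q1"
  have "ce_set A"
    unfolding A_def Q0_def attack_def guess_def enum_index_def scale_index_def
    by (intro ce_stage_limit rec_intros dec_turn R' total_rec_weight total_rec_rat_code; simp)
  have "ce_set B"
    unfolding B_def Q1_def attack_def guess_def enum_index_def scale_index_def c_def
    by (intro ce_stage_limit rec_intros dec_turn R' total_rec_weight total_rec_rat_code; simp)
  have ce: "ce_set ((\<lambda>j. 2 * j + 1) ` X)" if "ce_set X" for X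
  proof -
    have "ce 1 (\<lambda>xs. hd xs div 2 \<in> X \<and> hd xs mod 2 = 1)"
      by (intro ce_conj ce_subst1[OF that[unfolded ce_set_iff_ce]] ce_dec rec_intros) simp_all
    moreover have "n \<in> (\<lambda>j. 2 * j + 1) ` X \<longleftrightarrow> n div 2 \<in> X \<and> n mod 2 = 1" for n
      by (auto simp: image_iff intro!: bexI[of _ "n div 2"]) presburger
    ultimately show ?thesis by (simp add: ce_set_iff_ce)
  qed
  have turn_limit: "turn p i" if "i \<in> stage_limit (attack R d (turn p))" for p i d
    using stage_limit_imp[OF that] by (auto simp: attack_def)
  show ?thesis
  proof
    show "ce_set ((\<lambda>j. 2 * j + 1) ` A)" "ce_set ((\<lambda>j. 2 * j + 1) ` B)"
      using \<open>ce_set A\<close> \<open>ce_set B\<close> ce by blast+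
    fix k
    show "\<not> left_ce ((1/2) ^ k * (base2 ((\<lambda>j. 2 * j + 1) ` B) - base2 ((\<lambda>j. 2 * j + 1) ` A)))"
      unfolding base2_odd
    proof
      assume "left_ce ((1/2) ^ k * (base4 B - base4 A))"
      then have "ce_set {n. code_real n < (1/2) ^ k * (base4 B - base4 A)}"
        by (simp add: left_ce_def ce_rat_set_def)
      from univ[OF this] obtain e where
        e: "\<And>n. (\<exists>s. R s e n) \<longleftrightarrow> 1 * code_real n < (1/2) ^ k * (base4 B - base4 A)" by auto
      obtain i where i: "turn 0 i" "enum_index i = e" "scale_index i = k" "i \<notin> B"
        "\<And>j. j < i \<Longrightarrow> nbit (guess i) j \<longleftrightarrow> j \<in> B"
        by (rule attack_index[of 0 B e k]) (auto simp: B_def Q1_def intro: turn_limit)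
      show False
        by (rule attack_succeeds[of 1 rat_code R i B "turn 0"])
          (use i e in \<open>auto simp: code_real_rat_code A_def Q0_def\<close>)
    qed
    show "\<not> right_ce ((1/2) ^ k * (base2 ((\<lambda>j. 2 * j + 1) ` B) - base2 ((\<lambda>j. 2 * j + 1) ` A)))"
      unfolding base2_odd
    proof
      assume "right_ce ((1/2) ^ k * (base4 B - base4 A))"
      then have "ce_set {n. (1/2) ^ k * (base4 B - base4 A) < code_real n}"
        by (simp add: right_ce_def ce_rat_set_def)
      from univ[OF this] obtain e where
        e: "\<And>n. (\<exists>s. R s e n) \<longleftrightarrow> (1/2) ^ k * (base4 B - base4 A) < code_real n" by auto
      have e': "(\<exists>s. R s e n) \<longleftrightarrow> - 1 * code_real n < (1/2) ^ k * (base4 A - base4 B)" for n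
        unfolding e by (simp add: right_diff_distrib) linarith
      obtain i where i: "turn 1 i" "enum_index i = e" "scale_index i = k" "i \<notin> A"
        "\<And>j. j < i \<Longrightarrow> nbit (guess i) j \<longleftrightarrow> j \<in> A"
        by (rule attack_index[of 1 A e k]) (auto simp: A_def Q0_def intro: turn_limit)
      show False
        by (rule attack_succeeds[of "- 1" c R i A "turn 1"])
          (use i e' in \<open>auto simp: code_real_rat_code c_def B_def Q1_def minus_divide_left\<close>)
    qed
  qed
qed

section \<open>Coin tossing and prefix-free machines\<close>

abbreviation coin :: "bool stream measure" where
  "coin \<equiv> stream_space (measure_pmf (bernoulli_pmf (1/2)))"

interpretation coin: prob_space coin
  by (rule prob_space.prob_space_stream_space[OF prob_space_measure_pmf])

lemma sets_coin: "sets coin = sets (stream_space (count_space UNIV))"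
  by (rule sets_stream_space_cong) simp

lemma space_coin [simp]: "space coin = UNIV"
  by (simp add: space_stream_space)

lemma measurable_stake_coin [measurable]: "stake n \<in> measurable coin (count_space UNIV)"
  using measurable_stake by (simp cong: measurable_cong_sets add: sets_coin)

lemma sets_stake [measurable, simp]: "{\<omega>. stake n \<omega> \<in> Z} \<in> sets coin"
  using measurable_sets[OF measurable_stake_coin, of Z n] by (simp add: vimage_def)

definition hit :: "bool list set \<Rightarrow> bool stream set" where
  "hit Z = {\<omega>. \<exists>n. stake n \<omega> \<in> Z}"

lemma sets_hit [measurable, simp]: "hit Z \<in> sets coin"
proof -
  have "hit Z = (\<Union>n. {\<omega>. stake n \<omega> \<in> Z})" by (auto simp: hit_def)
  then show ?thesis by simp
qed

lemma halting_probability_hit: "halting_probability U = measure coin (hit (dom U))"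
  by (simp add: halting_probability_def hit_def)

definition cylinder :: "bool list \<Rightarrow> bool stream set" where
  "cylinder \<sigma> = {\<omega>. stake (length \<sigma>) \<omega> = \<sigma>}"

lemma sets_cylinder [measurable, simp]: "cylinder \<sigma> \<in> sets coin"
  using sets_stake[of "length \<sigma>" "{\<sigma>}"] by (simp add: cylinder_def)

lemma measure_coin_Cons:
  assumes X: "X \<in> sets coin"
  shows "measure coin {\<omega>. shd \<omega> = b \<and> stl \<omega> \<in> X} = measure coin X / 2"
proof -
  let ?Y = "{\<omega>. shd \<omega> = b \<and> stl \<omega> \<in> X}"
  have "{\<omega> \<in> space coin. shd \<omega> = b \<and> stl \<omega> \<in> X} \<in> sets coin"
    using X by measurable
  then have "emeasure coin ?Y = (\<integral>\<^sup>+t. emeasure coin {x \<in> space coin. t ## x \<in> ?Y} \<partial>measure_pmf (bernoulli_pmf (1/2)))"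
    by (intro prob_space.emeasure_stream_space[OF prob_space_measure_pmf]) simp
  also have "{x \<in> space coin. t ## x \<in> ?Y} = (if t = b then X else {})" for t by auto
  then have "(\<integral>\<^sup>+t. emeasure coin {x \<in> space coin. t ## x \<in> ?Y} \<partial>measure_pmf (bernoulli_pmf (1/2)))
    = emeasure coin X * ennreal (1/2)"
    by (cases b) simp_all
  also have "\<dots> = ennreal (measure coin X * (1/2))"
    unfolding coin.emeasure_eq_measure by (rule ennreal_mult[symmetric]) simp_all
  finally have "emeasure coin ?Y = ennreal (measure coin X * (1/2))" .
  then show ?thesis by (simp add: coin.emeasure_eq_measure)
qed

lemma measure_coin_append:
  assumes X: "X \<in> sets coin"
  shows "{\<omega>. stake (length \<sigma>) \<omega> = \<sigma> \<and> sdrop (length \<sigma>) \<omega> \<in> X} \<in> sets coin"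
    and "measure coin {\<omega>. stake (length \<sigma>) \<omega> = \<sigma> \<and> sdrop (length \<sigma>) \<omega> \<in> X} = (1/2) ^ length \<sigma> * measure coin X"
proof -
  have sets: "{\<omega>. stake (length \<sigma>) \<omega> = \<sigma> \<and> sdrop (length \<sigma>) \<omega> \<in> X} \<in> sets coin" for \<sigma>
  proof -
    have "{\<omega>. stake (length \<sigma>) \<omega> = \<sigma> \<and> sdrop (length \<sigma>) \<omega> \<in> X} =
      cylinder \<sigma> \<inter> (sdrop (length \<sigma>) -` X \<inter> space coin)"
      by (auto simp: cylinder_def)
    moreover have "sdrop (length \<sigma>) -` X \<inter> space coin \<in> sets coin"
      by (rule measurable_sets[OF measurable_sdrop X])
    ultimately show ?thesis by simp
  qed
  show "{\<omega>. stake (length \<sigma>) \<omega> = \<sigma> \<and> sdrop (length \<sigma>) \<omega> \<in> X} \<in> sets coin" by (rule sets)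
  show "measure coin {\<omega>. stake (length \<sigma>) \<omega> = \<sigma> \<and> sdrop (length \<sigma>) \<omega> \<in> X} = (1/2) ^ length \<sigma> * measure coin X"
  proof (induction \<sigma>)
    case (Cons b \<sigma>)
    have "{\<omega>. stake (length (b # \<sigma>)) \<omega> = b # \<sigma> \<and> sdrop (length (b # \<sigma>)) \<omega> \<in> X} =
      {\<omega>. shd \<omega> = b \<and> stl \<omega> \<in> {\<omega>. stake (length \<sigma>) \<omega> = \<sigma> \<and> sdrop (length \<sigma>) \<omega> \<in> X}}" by auto
    with Cons show ?case by (simp only: measure_coin_Cons[OF sets]) simp
  qed simp
qed

lemma measure_cylinder: "measure coin (cylinder \<sigma>) = (1/2) ^ length \<sigma>"
  using measure_coin_append(2)[of UNIV \<sigma>] coin.prob_space sets.top[of coin]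
  by (simp add: cylinder_def)

lemma finite_strings: "finite {\<tau> \<in> Z. length \<tau> = n}" for Z :: "bool list set"
  by (rule finite_subset[OF _ finite_lists_length_eq[of UNIV n]]) auto

lemma measure_stake_set: "measure coin {\<omega>. stake n \<omega> \<in> Z} = card {\<tau> \<in> Z. length \<tau> = n} / 2 ^ n"
proof -
  let ?Z = "{\<tau> \<in> Z. length \<tau> = n}"
  have "{\<omega>. stake n \<omega> \<in> Z} = (\<Union>\<tau>\<in>?Z. cylinder \<tau>)" by (auto simp: cylinder_def)
  also have "measure coin \<dots> = (\<Sum>\<tau>\<in>?Z. measure coin (cylinder \<tau>))"
    by (rule coin.finite_measure_finite_Union[OF finite_strings])
      (use sets_cylinder in blast, auto simp: disjoint_family_on_def cylinder_def)
  also have "\<dots> = (\<Sum>\<tau>\<in>?Z. (1/2) ^ n)" by (rule sum.cong) (auto simp: measure_cylinder)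
  finally show ?thesis by (simp add: power_one_over)
qed

definition unary :: "nat set \<Rightarrow> machine" where
  "unary X \<tau> = (if \<exists>j\<in>X. \<tau> = replicate j False @ [True] then Some [] else None)"

lemma dom_unary: "dom (unary X) = (\<lambda>j. replicate j False @ [True]) ` X"
  by (auto simp: unary_def dom_def)

lemma unary_eq_iff: "replicate i False @ True # \<rho> = replicate j False @ True # \<sigma> \<longleftrightarrow> i = j \<and> \<rho> = \<sigma>"
proof (induction i arbitrary: j)
  case 0
  show ?case by (cases j) auto
next
  case (Suc i)
  show ?case by (cases j) (auto simp: Suc)
qed

lemma str_code_unary: "str_code (replicate j False @ [True]) + 1 = 3 * 2 ^ j"
proof -
  have "str_code (replicate j False) + 1 = 2 ^ j" by (induction j) auto
  then show ?thesis by (simp add: str_code_append)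
qed

lemma prefix_free_unary:
  assumes "ce_set X"
  shows "prefix_free_machine (unary X)"
  unfolding prefix_free_machine_def
proof
  have "ce 2 (\<lambda>xs. hd xs = 0 \<and> (\<exists>j. j \<in> X \<and> hd (tl xs) + 1 = 3 * 2 ^ j))"
    by (intro ce_conj ce_ex ce_subst1[OF assms[unfolded ce_set_iff_ce]] ce_dec rec_intros) simp_all
  moreover have "unary X (str_decode x) = Some (str_decode y) \<longleftrightarrow> y = 0 \<and> (\<exists>j. j \<in> X \<and> x + 1 = 3 * 2 ^ j)" for x y
  proof -
    have "str_decode x = replicate j False @ [True] \<longleftrightarrow> x + 1 = 3 * 2 ^ j" for j
      using str_code_unary[of j] str_code_eq_iff[of "replicate j False @ [True]" x] by auto
    moreover have "[] = str_decode y \<longleftrightarrow> y = 0"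
      using str_code_eq_iff[of "[]" y] by auto
    ultimately show ?thesis unfolding unary_def by auto
  qed
  ultimately show "turing_machine (unary X)"
    unfolding turing_machine_iff_ce by simp
  show "\<forall>\<sigma>\<in>dom (unary X). \<forall>\<tau>\<in>dom (unary X). \<not> strict_prefix \<sigma> \<tau>"
    by (auto simp: dom_unary strict_prefix_def prefix_def unary_eq_iff)
qed

lemma measure_unary: "measure coin (hit (dom (unary X))) = base2 X"
proof -
  let ?C = "\<lambda>j. if j \<in> X then cylinder (replicate j False @ [True]) else {}"
  have "hit (dom (unary X)) = (\<Union>j. ?C j)"
  proof (intro set_eqI iffI)
    fix \<omega> assume "\<omega> \<in> hit (dom (unary X))"
    then obtain n j where "j \<in> X" "stake n \<omega> = replicate j False @ [True]"
      by (auto simp: hit_def dom_unary)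
    moreover from this have "n = Suc j" using length_stake[of n \<omega>] by (simp del: length_stake)
    ultimately show "\<omega> \<in> (\<Union>j. ?C j)" by (auto simp: cylinder_def intro!: exI[of _ j])
  next
    fix \<omega> assume "\<omega> \<in> (\<Union>j. ?C j)"
    then obtain j where "j \<in> X" "stake (Suc j) \<omega> = replicate j False @ [True]"
      by (auto simp: cylinder_def simp del: stake.simps split: if_splits)
    then show "\<omega> \<in> hit (dom (unary X))"
      unfolding hit_def dom_unary by blast
  qed
  moreover have "disjoint_family ?C"
  proof -
    have "i = j" if "\<omega> \<in> cylinder (replicate i False @ [True])" "\<omega> \<in> cylinder (replicate j False @ [True])" for \<omega> i j
    proof -
      have "take (Suc (min i j)) (replicate i False @ [True]) = stake (Suc (min i j)) \<omega>"
        "take (Suc (min i j)) (replicate j False @ [True]) = stake (Suc (min i j)) \<omega>"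
        using that[unfolded cylinder_def] take_stake[of "Suc (min i j)" "Suc i" \<omega>]
          take_stake[of "Suc (min i j)" "Suc j" \<omega>] by (auto simp: min_def split: if_splits)
      then have "take (Suc (min i j)) (replicate i False @ [True]) ! min i j =
        take (Suc (min i j)) (replicate j False @ [True]) ! min i j" by simp
      then show ?thesis by (auto simp: min_def nth_append split: if_splits)
    qed
    then show ?thesis by (auto simp: disjoint_family_on_def)
  qed
  ultimately have "(\<lambda>j. measure coin (?C j)) sums measure coin (hit (dom (unary X)))"
    using coin.finite_measure_UNION[of ?C] by (simp add: image_subset_iff)
  moreover have "measure coin (?C j) = of_bool (j \<in> X) * (1/2) ^ Suc j" for j
    by (simp add: measure_cylinder)
  ultimately show ?thesis by (simp add: base2_def sums_iff)
qed

lemma computable_strings_iff: "computable_strings \<sigma> \<longleftrightarrow> total_rec 1 (\<lambda>xs. str_code (\<sigma> (hd xs)))"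
proof
  assume "computable_strings \<sigma>"
  then obtain f where "\<And>e y. rec_eval f [e] y \<longleftrightarrow> y = str_code (\<sigma> e)"
    unfolding computable_strings_def by blast
  then show "total_rec 1 (\<lambda>xs. str_code (\<sigma> (hd xs)))"
    unfolding total_rec_def by (auto simp: length_Suc_conv intro!: exI[of _ f])
next
  assume "total_rec 1 (\<lambda>xs. str_code (\<sigma> (hd xs)))"
  then obtain f where "\<And>xs y. length xs = 1 \<Longrightarrow> rec_eval f xs y \<longleftrightarrow> y = str_code (\<sigma> (hd xs))"
    by (rule total_rec_exact) blast
  from this[of "[_]"] show "computable_strings \<sigma>" unfolding computable_strings_def by auto
qed

lemma str_decode_append_iff:
  "str_decode x = \<kappa> @ \<rho> \<longleftrightarrow> x = str_code \<kappa> + 2 ^ length \<kappa> * str_code \<rho>"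
  using str_code_eq_iff[of "\<kappa> @ \<rho>" x] by (auto simp: str_code_append)

lemma prefix_str_decode_iff:
  "prefix \<kappa> (str_decode x) \<longleftrightarrow> (\<exists>r\<le>x. x = str_code \<kappa> + 2 ^ length \<kappa> * r)"
proof
  assume "prefix \<kappa> (str_decode x)"
  then obtain \<rho> where "x = str_code \<kappa> + 2 ^ length \<kappa> * str_code \<rho>"
    by (auto simp: prefix_def str_decode_append_iff)
  moreover from this have "str_code \<rho> \<le> x" by (simp add: trans_le_add2)
  ultimately show "\<exists>r\<le>x. x = str_code \<kappa> + 2 ^ length \<kappa> * r" by blast
next
  assume "\<exists>r\<le>x. x = str_code \<kappa> + 2 ^ length \<kappa> * r"
  then obtain r where "x = str_code \<kappa> + 2 ^ length \<kappa> * r" by blast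
  then have "str_decode x = \<kappa> @ str_decode r" by (simp add: str_decode_append_iff)
  then show "prefix \<kappa> (str_decode x)" by simp
qed

definition graft :: "bool list \<Rightarrow> machine \<Rightarrow> machine \<Rightarrow> machine" where
  "graft \<kappa> V U \<tau> = (if prefix \<kappa> \<tau> then V (drop (length \<kappa>) \<tau>) else U \<tau>)"

lemma graft_append [simp]: "graft \<kappa> V U (\<kappa> @ \<rho>) = V \<rho>"
  by (simp add: graft_def)

lemma turing_machine_graft:
  assumes "turing_machine V" "turing_machine U"
  shows "turing_machine (graft \<kappa> V U)"
proof -
  let ?c = "str_code \<kappa>" and ?l = "2 ^ length \<kappa> :: nat"
  have "ce 2 (\<lambda>xs. (\<exists>r. hd (tl xs) = ?c + ?l * r \<and> V (str_decode r) = Some (str_decode (hd xs))) \<or>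
    \<not> (\<exists>r\<le>hd (tl xs). hd (tl xs) = ?c + ?l * r) \<and> U (str_decode (hd (tl xs))) = Some (str_decode (hd xs)))"
    by (intro ce_disj ce_conj ce_ex ce_machine assms; (rule ce_dec)?; (intro rec_intros)?; simp)
  moreover have "graft \<kappa> V U (str_decode x) = Some (str_decode y) \<longleftrightarrow>
    (\<exists>r. x = ?c + ?l * r \<and> V (str_decode r) = Some (str_decode y)) \<or>
    \<not> (\<exists>r\<le>x. x = ?c + ?l * r) \<and> U (str_decode x) = Some (str_decode y)" for x y
  proof (cases "prefix \<kappa> (str_decode x)")
    case True
    then obtain \<rho> where \<rho>: "str_decode x = \<kappa> @ \<rho>" by (auto simp: prefix_def)
    then have "x = ?c + ?l * r \<longleftrightarrow> r = str_code \<rho>" for r by (auto simp: str_decode_append_iff)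
    moreover from True have "\<exists>r\<le>x. x = ?c + ?l * r" unfolding prefix_str_decode_iff .
    ultimately show ?thesis by (simp add: \<rho>)
  next
    case False
    then have "x \<noteq> ?c + ?l * r" for r
      using str_decode_append_iff[of x \<kappa> "str_decode r"] by auto
    with False show ?thesis by (simp add: graft_def)
  qed
  ultimately show ?thesis unfolding turing_machine_iff_ce by simp
qed

lemma prefix_free_graft:
  assumes V: "prefix_free_machine V" and U: "prefix_free_machine U"
    and \<kappa>: "\<forall>\<sigma>. strict_prefix \<sigma> \<kappa> \<longrightarrow> \<sigma> \<notin> dom U"
  shows "prefix_free_machine (graft \<kappa> V U)"
  unfolding prefix_free_machine_def
proof (intro conjI ballI notI)
  show "turing_machine (graft \<kappa> V U)"
    using V U turing_machine_graft by (simp add: prefix_free_machine_def)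
  fix \<sigma> \<tau> assume dom: "\<sigma> \<in> dom (graft \<kappa> V U)" "\<tau> \<in> dom (graft \<kappa> V U)" and st: "strict_prefix \<sigma> \<tau>"
  consider \<rho> where "\<sigma> = \<kappa> @ \<rho>" | "\<not> prefix \<kappa> \<sigma>" "prefix \<kappa> \<tau>" | "\<not> prefix \<kappa> \<sigma>" "\<not> prefix \<kappa> \<tau>"
    by (auto simp: prefix_def)
  then show False
  proof cases
    case (1 \<rho>)
    then obtain \<rho>' where \<tau>: "\<tau> = \<kappa> @ \<rho>'" and "strict_prefix \<rho> \<rho>'"
      using st by (auto simp: strict_prefix_def prefix_def)
    moreover have "\<rho> \<in> dom V" "\<rho>' \<in> dom V" using dom by (auto simp: 1 \<tau> dom_def)
    ultimately show False using V by (auto simp: prefix_free_machine_def)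
  next
    case 2
    then have "strict_prefix \<sigma> \<kappa>"
      using st by (metis prefix_order.dual_order.strict_implies_order prefix_same_cases prefix_order.le_neq_trans)
    moreover have "\<sigma> \<in> dom U" using dom(1) 2 by (auto simp: graft_def dom_def)
    ultimately show False using \<kappa> by blast
  next
    case 3
    then have "\<sigma> \<in> dom U" "\<tau> \<in> dom U" using dom by (auto simp: graft_def dom_def)
    with U st show False by (auto simp: prefix_free_machine_def)
  qed
qed

lemma hit_graft:
  assumes \<kappa>: "\<forall>\<sigma>. strict_prefix \<sigma> \<kappa> \<longrightarrow> \<sigma> \<notin> dom U"
  shows "hit (dom (graft \<kappa> V U)) = (hit (dom U) - cylinder \<kappa>) \<union>
    {\<omega>. stake (length \<kappa>) \<omega> = \<kappa> \<and> sdrop (length \<kappa>) \<omega> \<in> hit (dom V)}"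
proof (intro set_eqI)
  fix \<omega>
  let ?l = "length \<kappa>"
  show "\<omega> \<in> hit (dom (graft \<kappa> V U)) \<longleftrightarrow> \<omega> \<in> (hit (dom U) - cylinder \<kappa>) \<union>
    {\<omega>. stake (length \<kappa>) \<omega> = \<kappa> \<and> sdrop (length \<kappa>) \<omega> \<in> hit (dom V)}"
  proof (cases "stake ?l \<omega> = \<kappa>")
    case True
    have long: "stake (?l + n) \<omega> = \<kappa> @ stake n (sdrop ?l \<omega>)" for n
      using stake_add[of ?l \<omega> n] True by simp
    have "\<omega> \<in> hit (dom (graft \<kappa> V U)) \<longleftrightarrow> (\<exists>n. stake (?l + n) \<omega> \<in> dom (graft \<kappa> V U))"
    proof
      assume "\<omega> \<in> hit (dom (graft \<kappa> V U))"
      then obtain n where n: "stake n \<omega> \<in> dom (graft \<kappa> V U)" by (auto simp: hit_def)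
      have "?l \<le> n"
      proof (rule ccontr)
        assume "\<not> ?l \<le> n"
        then have "stake n \<omega> = take n \<kappa>" and "n < ?l"
          using take_stake[of n ?l \<omega>] True by (simp_all add: min_def)
        moreover from this have "strict_prefix (take n \<kappa>) \<kappa>"
          by (metis length_take min.absorb4 nat_neq_iff prefix_order.le_neq_trans take_is_prefix)
        moreover from this have "\<not> prefix \<kappa> (take n \<kappa>)" by auto
        ultimately show False using n \<kappa> by (auto simp: graft_def dom_def)
      qed
      with n show "\<exists>n. stake (?l + n) \<omega> \<in> dom (graft \<kappa> V U)"
        by (intro exI[of _ "n - ?l"]) simp
    qed (auto simp: hit_def)
    also have "\<dots> \<longleftrightarrow> sdrop ?l \<omega> \<in> hit (dom V)"
      unfolding long hit_def by (auto simp: dom_def)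
    finally show ?thesis using True by (simp add: cylinder_def)
  next
    case False
    have "stake n \<omega> \<in> dom (graft \<kappa> V U) \<longleftrightarrow> stake n \<omega> \<in> dom U" for n
    proof -
      have "\<not> prefix \<kappa> (stake n \<omega>)"
      proof
        assume pre: "prefix \<kappa> (stake n \<omega>)"
        then have "?l \<le> n" using prefix_length_le by fastforce
        then have "stake ?l \<omega> = take ?l (stake n \<omega>)" by (simp add: take_stake min_def)
        also have "\<dots> = \<kappa>" using pre by (auto simp: prefix_def)
        finally show False using False by simp
      qed
      then show ?thesis by (simp add: graft_def dom_def)
    qed
    with False show ?thesis by (simp add: hit_def cylinder_def)
  qed
qed

lemma halting_probability_graft:
  assumes \<kappa>: "\<forall>\<sigma>. strict_prefix \<sigma> \<kappa> \<longrightarrow> \<sigma> \<notin> dom U"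
  shows "halting_probability (graft \<kappa> V U) =
    measure coin (hit (dom U) - cylinder \<kappa>) + (1/2) ^ length \<kappa> * halting_probability V"
proof -
  have "(hit (dom U) - cylinder \<kappa>) \<inter>
    {\<omega>. stake (length \<kappa>) \<omega> = \<kappa> \<and> sdrop (length \<kappa>) \<omega> \<in> hit (dom V)} = {}"
    by (auto simp: cylinder_def)
  then show ?thesis
    unfolding halting_probability_hit hit_graft[OF \<kappa>]
    by (subst coin.finite_measure_Union) (simp_all add: measure_coin_append)
qed

lemma graft_self: "graft \<kappa> (\<lambda>\<rho>. U (\<kappa> @ \<rho>)) U = U"
proof
  fix \<tau> show "graft \<kappa> (\<lambda>\<rho>. U (\<kappa> @ \<rho>)) U \<tau> = U \<tau>"
    by (cases "prefix \<kappa> \<tau>") (auto simp: graft_def prefix_def)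
qed

lemma prefix_free_empty: "prefix_free_machine (\<lambda>\<tau>. None)"
  unfolding prefix_free_machine_def turing_machine_iff_ce by (simp add: ce_dec dec_const)

lemma halting_probability_unary: "halting_probability (unary X) = base2 X"
  by (simp add: halting_probability_hit measure_unary)

lemma prefix_free_part:
  assumes P: "effective_list prefix_free_machine P" and U0: "universal_by_adjunction prefix_free_machine P U\<^sub>0"
    and A: "ce_set A" and B: "ce_set B"
  obtains U\<^sub>1 k where "universal_by_adjunction prefix_free_machine P U\<^sub>1"
    "halting_probability U\<^sub>0 = halting_probability U\<^sub>1 + (1/2) ^ k * (base2 B - base2 A)"
proof -
  have index: "\<exists>e. P e = N" if "prefix_free_machine N" for N
  proof -
    have "N \<in> range P" using P that by (simp add: effective_list_def)
    then show ?thesis by auto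
  qed
  have pf0: "prefix_free_machine U\<^sub>0" using U0 by (simp add: universal_by_adjunction_def)
  obtain \<sigma> where \<sigma>: "computable_strings \<sigma>" "\<And>e \<tau>. U\<^sub>0 (\<sigma> e @ \<tau>) = P e \<tau>"
    using U0 unfolding universal_by_adjunction_def by blast
  define N where "N = graft [False] (unary B) (graft [True] U\<^sub>0 (\<lambda>\<tau>. None))"
  have "prefix_free_machine N"
    unfolding N_def
    by (intro prefix_free_graft prefix_free_unary B pf0 prefix_free_empty)
      (auto simp: graft_def dom_def strict_prefix_def prefix_Cons split: if_splits)
  then obtain e where e: "P e = N" using index by blast
  define \<kappa> where "\<kappa> = \<sigma> e @ [False]"
  define U\<^sub>1 where "U\<^sub>1 = graft \<kappa> (unary A) U\<^sub>0"
  have N_False: "N (False # \<rho>) = unary B \<rho>" and N_True: "N (True # \<rho>) = U\<^sub>0 \<rho>" for \<rho>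
    by (simp_all add: N_def graft_def)
  have \<kappa>: "\<forall>\<tau>. strict_prefix \<tau> \<kappa> \<longrightarrow> \<tau> \<notin> dom U\<^sub>0"
  proof (intro allI impI notI)
    fix \<tau> assume \<tau>: "strict_prefix \<tau> \<kappa>" "\<tau> \<in> dom U\<^sub>0"
    have "ce_set {0}" unfolding ce_set_iff_ce by (simp add: ce_dec dec_eq total_rec_const total_rec_var)
    then obtain i where i: "P i = unary {0}" using index prefix_free_unary by blast
    have "U\<^sub>0 (\<sigma> i @ [True]) = Some []" by (simp add: \<sigma>(2) i unary_def)
    then have "\<sigma> e @ True # \<sigma> i @ [True] \<in> dom U\<^sub>0" by (simp add: \<sigma>(2) e N_True dom_def)
    moreover have "prefix \<tau> (\<sigma> e)" using \<tau>(1) unfolding \<kappa>_def by (auto simp: strict_prefix_def)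
    then have "strict_prefix \<tau> (\<sigma> e @ True # \<sigma> i @ [True])"
      by (auto simp: strict_prefix_def prefix_def)
    ultimately show False using \<tau>(2) pf0 by (auto simp: prefix_free_machine_def)
  qed
  show ?thesis
  proof
    show "universal_by_adjunction prefix_free_machine P U\<^sub>1"
      unfolding universal_by_adjunction_def
    proof (intro conjI exI allI)
      show "prefix_free_machine U\<^sub>1"
        unfolding U\<^sub>1_def by (intro prefix_free_graft prefix_free_unary A pf0 \<kappa>)
      show "computable_strings (\<lambda>i. \<sigma> e @ True # \<sigma> i)"
      proof -
        have "total_rec 1 (\<lambda>xs. str_code (\<sigma> e) + 2 ^ length (\<sigma> e) * (2 * str_code (\<sigma> (hd xs)) + 2))"
          using \<sigma>(1) by (intro rec_intros) (auto simp: computable_strings_iff)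
        then show ?thesis by (simp add: computable_strings_iff str_code_append)
      qed
      show "U\<^sub>1 ((\<sigma> e @ True # \<sigma> i) @ \<tau>) = P i \<tau>" for i \<tau>
        using \<sigma>(2)[of e "True # \<sigma> i @ \<tau>"] \<sigma>(2)[of i \<tau>]
        by (simp add: U\<^sub>1_def graft_def \<kappa>_def e N_True)
    qed
    have "(\<lambda>\<rho>. U\<^sub>0 (\<kappa> @ \<rho>)) = unary B"
      using \<sigma>(2)[of e "False # _"] by (simp add: \<kappa>_def e N_False)
    then have "halting_probability U\<^sub>0 = measure coin (hit (dom U\<^sub>0) - cylinder \<kappa>) + (1/2) ^ length \<kappa> * base2 B"
      using halting_probability_graft[OF \<kappa>, of "unary B"] graft_self[of \<kappa> U\<^sub>0]
      by (simp add: halting_probability_unary)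
    moreover have "halting_probability U\<^sub>1 = measure coin (hit (dom U\<^sub>0) - cylinder \<kappa>) + (1/2) ^ length \<kappa> * base2 A"
      unfolding U\<^sub>1_def using halting_probability_graft[OF \<kappa>, of "unary A"]
      by (simp add: halting_probability_unary)
    ultimately show "halting_probability U\<^sub>0 = halting_probability U\<^sub>1 + (1/2) ^ length \<kappa> * (base2 B - base2 A)"
      by (simp add: algebra_simps)
  qed
qed

section \<open>Randomness and left-c.e. reals\<close>

definition dyadic_approx :: "(nat \<Rightarrow> nat) \<Rightarrow> real \<Rightarrow> bool" where
  "dyadic_approx F z \<longleftrightarrow> total_rec 1 (\<lambda>xs. F (hd xs)) \<and> incseq (\<lambda>s. real (F s) / 2 ^ s) \<and>
     (\<lambda>s. real (F s) / 2 ^ s) \<longlonglongrightarrow> z"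

lemma dyadic_approx_le: "dyadic_approx F z \<Longrightarrow> real (F s) / 2 ^ s \<le> z"
  unfolding dyadic_approx_def using incseq_le by blast

lemma dyadic_approx_mono: "dyadic_approx F z \<Longrightarrow> s \<le> t \<Longrightarrow> real (F s) / 2 ^ s \<le> real (F t) / 2 ^ t"
  unfolding dyadic_approx_def using incseqD by blast

lemma dyadic_approx_total_rec: "dyadic_approx F z \<Longrightarrow> total_rec k H \<Longrightarrow> total_rec k (\<lambda>xs. F (H xs))"
  unfolding dyadic_approx_def using total_rec_comp1 by blast

lemma dyadic_approx_tendsto: "dyadic_approx F z \<Longrightarrow> (\<lambda>s. real (F s) / 2 ^ s) \<longlonglongrightarrow> z"
  by (simp add: dyadic_approx_def)

lemma disjnt_ball_real:
  fixes x y :: real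
  assumes "disjnt (ball x r) (ball y s)" "0 < r" "0 < s"
  shows "r + s \<le> \<bar>x - y\<bar>"
proof (rule ccontr)
  assume *: "\<not> r + s \<le> \<bar>x - y\<bar>"
  define z where "z = (s * x + r * y) / (r + s)"
  have "x - z = r * (x - y) / (r + s)" "y - z = s * (y - x) / (r + s)"
    using assms(2,3) by (simp_all add: z_def field_simps)
  then have "\<bar>x - z\<bar> = r * (\<bar>x - y\<bar> / (r + s))" "\<bar>y - z\<bar> = s * (\<bar>x - y\<bar> / (r + s))"
    using assms(2,3) by (simp_all add: abs_mult abs_minus_commute)
  moreover have q: "\<bar>x - y\<bar> / (r + s) < 1" using * assms(2,3) by (simp add: divide_less_eq)
  note mult_strict_left_mono[OF q assms(2)] mult_strict_left_mono[OF q assms(3)]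
  ultimately have "z \<in> ball x r" "z \<in> ball y s"
    by (simp_all only: mem_ball dist_real_def mult_1_right)
  with assms(1) show False by (auto simp: disjnt_def)
qed

text \<open>A ball of radius \<open>5 r\<close>, the enlargement in Vitali's covering lemma, has length \<open>10 r\<close>.\<close>

lemma vitali_measure_bound:
  fixes K :: "nat set" and a r :: "nat \<Rightarrow> real" and m :: real
  assumes r: "\<And>i. i \<in> K \<Longrightarrow> 0 < r i \<and> r i \<le> 1"
    and E: "\<And>i. i \<in> K \<Longrightarrow> E i \<in> sets lborel \<and> E i \<subseteq> V"
    and m: "0 \<le> m" "\<And>i. i \<in> K \<Longrightarrow> ennreal (10 * r i) \<le> ennreal m * emeasure lborel (E i)"
    and disj: "\<And>i j. i \<in> K \<Longrightarrow> j \<in> K \<Longrightarrow> r i + r j \<le> \<bar>a i - a j\<bar> \<Longrightarrow> E i \<inter> E j = {}"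
    and V: "V \<in> sets lborel"
  shows "emeasure lborel (\<Union>i\<in>K. ball (a i) (r i)) \<le> ennreal m * emeasure lborel V"
proof -
  obtain C where C: "C \<subseteq> K" "pairwise (\<lambda>i j. disjnt (ball (a i) (r i)) (ball (a j) (r j))) C"
    and cover: "(\<Union>i\<in>K. ball (a i) (r i)) \<subseteq> (\<Union>i\<in>C. ball (a i) (5 * r i))"
    by (rule Vitali_covering_lemma_balls[OF subset_refl r])
  let ?B = "\<lambda>i. if i \<in> C then ball (a i) (5 * r i) else {}"
  let ?E = "\<lambda>i. if i \<in> C then E i else {}"
  have "emeasure lborel (\<Union>i\<in>K. ball (a i) (r i)) \<le> emeasure lborel (\<Union>i. ?B i)"
    using cover by (intro emeasure_mono) (auto intro!: borel_open)
  also have "\<dots> \<le> (\<Sum>i. emeasure lborel (?B i))"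
    by (rule emeasure_subadditive_countably) auto
  also have "\<dots> \<le> (\<Sum>i. ennreal m * emeasure lborel (?E i))"
  proof (intro suminf_le summableI)
    fix i
    show "emeasure lborel (?B i) \<le> ennreal m * emeasure lborel (?E i)"
    proof (cases "i \<in> C")
      case True
      then have "emeasure lborel (ball (a i) (5 * r i)) = ennreal (10 * r i)"
        using C(1) r[of i] by (simp add: ball_eq_greaterThanLessThan subset_iff)
      with True C(1) m(2)[of i] show ?thesis by auto
    qed simp
  qed
  also have "\<dots> = ennreal m * (\<Sum>i. emeasure lborel (?E i))" by (rule ennreal_suminf_cmult)
  also have "(\<Sum>i. emeasure lborel (?E i)) = emeasure lborel (\<Union>i. ?E i)"
  proof (rule suminf_emeasure)
    show "range ?E \<subseteq> sets lborel" using E C(1) by auto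
    have "E i \<inter> E j = {}" if "i \<in> C" "j \<in> C" "i \<noteq> j" for i j
      using that C by (intro disj disjnt_ball_real) (use r in \<open>auto simp: pairwise_def subset_iff\<close>)
    then show "disjoint_family ?E" by (auto simp: disjoint_family_on_def)
  qed
  also have "ennreal m * emeasure lborel (\<Union>i. ?E i) \<le> ennreal m * emeasure lborel V"
    using E C(1) by (intro mult_left_mono emeasure_mono V) (auto split: if_splits)
  finally show ?thesis .
qed

lemma not_ml_randomI:
  assumes "ce 3 (\<lambda>xs. E (hd xs) (hd (tl xs)) (hd (tl (tl xs))))"
    and "\<And>n. emeasure lborel (\<Union>{{code_real a <..< code_real b} | a b. E n a b}) \<le> ennreal ((1/2) ^ n)"
    and "\<And>n. x \<in> \<Union>{{code_real a <..< code_real b} | a b. E n a b}"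
  shows "\<not> ml_random x"
  unfolding ml_random_def
  using uniformly_ce_openI[OF assms(1)] assms(2,3)
  by (intro notI) (metis (no_types, lifting) INT_iff)

lemma not_ml_random_of_nat: "\<not> ml_random (real p)"
proof (rule not_ml_randomI)
  let ?a = "\<lambda>n. rat_code (p * 2 ^ Suc n) 1 (2 ^ Suc n)" and ?b = "\<lambda>n. rat_code (p * 2 ^ Suc n + 1) 0 (2 ^ Suc n)"
  let ?E = "\<lambda>n a b. a = ?a n \<and> b = ?b n"
  show "ce 3 (\<lambda>xs. ?E (hd xs) (hd (tl xs)) (hd (tl (tl xs))))"
    by (intro ce_dec rec_intros total_rec_rat_code) simp_all
  have eq: "\<Union>{{code_real a <..< code_real b} | a b. ?E n a b} = {real p - 1 / 2 ^ Suc n <..< real p + 1 / 2 ^ Suc n}" for n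
    by (auto simp: code_real_rat_code field_simps)
  show "emeasure lborel (\<Union>{{code_real a <..< code_real b} | a b. ?E n a b}) \<le> ennreal ((1/2) ^ n)" for n
    unfolding eq by (simp add: power_one_over)
  show "real p \<in> \<Union>{{code_real a <..< code_real b} | a b. ?E n a b}" for n
    unfolding eq by simp
qed

lemma UN_prod_decode:
  "(\<Union>(s, t)\<in>K. f s t) = (\<Union>i\<in>{i. prod_decode i \<in> K}. f (fst (prod_decode i)) (snd (prod_decode i)))"
proof (intro equalityI subsetI)
  fix x assume "x \<in> (\<Union>(s, t)\<in>K. f s t)"
  then obtain s t where "(s, t) \<in> K" "x \<in> f s t" by auto
  then show "x \<in> (\<Union>i\<in>{i. prod_decode i \<in> K}. f (fst (prod_decode i)) (snd (prod_decode i)))"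
    by (intro UN_I[of "prod_encode (s, t)"]) auto
next
  fix x assume "x \<in> (\<Union>i\<in>{i. prod_decode i \<in> K}. f (fst (prod_decode i)) (snd (prod_decode i)))"
  then obtain i where "prod_decode i \<in> K" "x \<in> f (fst (prod_decode i)) (snd (prod_decode i))" by auto
  then show "x \<in> (\<Union>(s, t)\<in>K. f s t)"
    by (intro UN_I[of "prod_decode i"]) (auto simp: case_prod_beta)
qed

lemma UN_intervals:
  "\<Union>{{code_real u <..< code_real v} | u v. \<exists>s t. P s t \<and> u = f s t \<and> v = g s t} =
    (\<Union>(s, t)\<in>{(s, t). P s t}. {code_real (f s t) <..< code_real (g s t)})"
  by fast

text \<open>The Kucera-Slaman argument: the balls are entered only when \<open>\<alpha>\<close> lags behind \<open>y\<close>, and disjoint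
  balls belong to disjoint increments of \<open>y\<close>.\<close>

lemma random_dominates:
  assumes F: "dyadic_approx F \<alpha>" and G: "dyadic_approx G y" and y: "y \<le> 1" and \<alpha>: "ml_random \<alpha>"
  obtains n where "\<And>s. (1/2) ^ n * (y - real (G s) / 2 ^ s) \<le> \<alpha> - real (F s) / 2 ^ s"
proof -
  define a where "a s = real (F s) / 2 ^ s" for s
  define b where "b s = real (G s) / 2 ^ s" for s
  define R where "R n s t = (1/2) ^ (n + 4) * (b t - b s)" for n s t
  define K where "K n = {(s, t). s < t \<and> a t - a s < R n s t}" for n
  define T where "T n = (\<Union>(s, t)\<in>K n. ball (a s) (R n s t))" for n
  let ?lt = "\<lambda>n s t. s < t \<and> F t * 2 ^ (s + (n + 4)) + G s * 2 ^ t < F s * 2 ^ (t + (n + 4)) + G t * 2 ^ s"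
  let ?lo = "\<lambda>n s t. rat_code (F s * 2 ^ (t + (n + 4)) + G s * 2 ^ t) (G t * 2 ^ s) (2 ^ (s + t + (n + 4)))"
  let ?hi = "\<lambda>n s t. rat_code (F s * 2 ^ (t + (n + 4)) + G t * 2 ^ s) (G s * 2 ^ t) (2 ^ (s + t + (n + 4)))"
  let ?E = "\<lambda>n u v. \<exists>s t. ?lt n s t \<and> u = ?lo n s t \<and> v = ?hi n s t"
  have ce: "ce 3 (\<lambda>xs. ?E (hd xs) (hd (tl xs)) (hd (tl (tl xs))))"
    by (intro ce_ex ce_dec rec_intros total_rec_rat_code dyadic_approx_total_rec[OF F]
        dyadic_approx_total_rec[OF G]) simp_all
  have lt: "?lt n s t \<longleftrightarrow> (s, t) \<in> K n" for n s t
  proof -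
    let ?A = "F t * 2 ^ (s + (n + 4)) + G s * 2 ^ t" and ?B = "F s * 2 ^ (t + (n + 4)) + G t * 2 ^ s"
    have "a t - a s - R n s t = (real ?A - real ?B) / 2 ^ (s + t + (n + 4))"
      unfolding a_def b_def R_def by (simp add: power_add power_one_over field_simps)
    moreover have "(real ?A - real ?B) / 2 ^ (s + t + (n + 4)) < 0 \<longleftrightarrow> real ?A < real ?B"
      by (simp add: divide_less_0_iff)
    ultimately have "a t - a s < R n s t \<longleftrightarrow> real ?A < real ?B" by linarith
    then show ?thesis unfolding K_def of_nat_less_iff by simp
  qed
  have lo: "code_real (?lo n s t) = a s - R n s t" and hi: "code_real (?hi n s t) = a s + R n s t" for n s t
    unfolding a_def b_def R_def code_real_rat_code by (simp_all add: power_add power_one_over field_simps)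
  have T: "\<Union>{{code_real u <..< code_real v} | u v. ?E n u v} = T n" for n
  proof -
    have "\<Union>{{code_real u <..< code_real v} | u v. ?E n u v} =
      (\<Union>(s, t)\<in>{(s, t). ?lt n s t}. {code_real (?lo n s t) <..< code_real (?hi n s t)})"
      by (rule UN_intervals)
    also have "{(s, t). ?lt n s t} = K n" unfolding lt by simp
    finally show ?thesis by (simp add: T_def lo hi ball_eq_greaterThanLessThan)
  qed
  have meas: "emeasure lborel (T n) \<le> ennreal ((1/2) ^ n)" for n
  proof -
    let ?K = "{i. prod_decode i \<in> K n}"
    let ?s = "\<lambda>i. fst (prod_decode i)" and ?t = "\<lambda>i. snd (prod_decode i)"
    have b01: "0 \<le> b s" "b s \<le> 1" for s
      unfolding b_def by (simp, rule order_trans[OF dyadic_approx_le[OF G] y])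
    have mono: "a s \<le> a t" "b s \<le> b t" if "s \<le> t" for s t
      using that dyadic_approx_mono[OF F] dyadic_approx_mono[OF G] by (simp_all add: a_def b_def)
    have pos: "0 < R n s t" "0 < b t - b s" if "(s, t) \<in> K n" for s t
    proof -
      show "0 < R n s t" using that mono(1)[of s t] by (auto simp: K_def)
      then show "0 < b t - b s" unfolding R_def by (simp add: zero_less_mult_iff)
    qed
    have "T n = (\<Union>i\<in>?K. ball (a (?s i)) (R n (?s i) (?t i)))"
      unfolding T_def by (rule UN_prod_decode)
    also have "emeasure lborel \<dots> \<le> ennreal (10 * (1/2) ^ (n + 4)) * emeasure lborel {0..1::real}"
    proof (rule vitali_measure_bound)
      fix i assume "i \<in> ?K"
      then have i: "(?s i, ?t i) \<in> K n" by simp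
      have "R n (?s i) (?t i) \<le> 1 * 1"
        unfolding R_def using b01(1)[of "?s i"] b01(2)[of "?t i"] pos[OF i]
        by (intro mult_mono power_le_one) auto
      with pos[OF i] show "0 < R n (?s i) (?t i) \<and> R n (?s i) (?t i) \<le> 1" by simp
      show "{b (?s i) <..< b (?t i)} \<in> sets lborel \<and> {b (?s i) <..< b (?t i)} \<subseteq> {0..1}"
        using b01(1)[of "?s i"] b01(2)[of "?t i"] by auto
      show "ennreal (10 * R n (?s i) (?t i)) \<le> ennreal (10 * (1/2) ^ (n + 4)) * emeasure lborel {b (?s i) <..< b (?t i)}"
        using pos[OF i] by (simp add: R_def mult.assoc flip: ennreal_mult)
    next
      fix i j assume "i \<in> ?K" "j \<in> ?K"
        and far: "R n (?s i) (?t i) + R n (?s j) (?t j) \<le> \<bar>a (?s i) - a (?s j)\<bar>"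
      then have K: "(?s i, ?t i) \<in> K n" "(?s j, ?t j) \<in> K n" by simp_all
      have sep: "t \<le> s'" if "(s, t) \<in> K n" "(s', t') \<in> K n" "s \<le> s'" "R n s t + R n s' t' \<le> \<bar>a s - a s'\<bar>"
        for s t s' t'
      proof (rule ccontr)
        assume "\<not> t \<le> s'"
        then have "a s' \<le> a t" by (intro mono) simp
        moreover have "a t - a s < R n s t" using that(1) by (simp add: K_def)
        moreover have "a s \<le> a s'" using that(3) by (rule mono)
        ultimately show False using that(4) pos(1)[OF that(2)] by simp
      qed
      have "?t i \<le> ?s j \<or> ?t j \<le> ?s i"
        using sep[OF K] sep[OF K(2) K(1)] far by (cases "?s i \<le> ?s j") (auto simp: abs_minus_commute add.commute)
      then show "{b (?s i) <..< b (?t i)} \<inter> {b (?s j) <..< b (?t j)} = {}"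
        using mono(2) by fastforce
    qed auto
    also have "\<dots> \<le> ennreal ((1/2) ^ n)" by (simp add: power_add power_one_over field_simps)
    finally show ?thesis .
  qed
  obtain n where n: "\<alpha> \<notin> T n"
    using not_ml_randomI[OF ce, of \<alpha>] \<alpha> meas unfolding T by blast
  have "(1/2) ^ (n + 4) * (y - b s) \<le> \<alpha> - a s" for s
  proof (rule LIMSEQ_le_const2)
    show "(\<lambda>t. (1/2) ^ (n + 4) * (b t - b s)) \<longlonglongrightarrow> (1/2) ^ (n + 4) * (y - b s)"
      using dyadic_approx_tendsto[OF G] by (intro tendsto_intros) (simp add: b_def)
    have "R n s t \<le> \<alpha> - a s" if "s < t" for t
    proof (cases "(s, t) \<in> K n")
      case True
      then have "\<alpha> \<notin> ball (a s) (R n s t)" using n by (auto simp: T_def)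
      moreover have "a s \<le> \<alpha>" using dyadic_approx_le[OF F] by (simp add: a_def)
      ultimately show ?thesis by (simp add: dist_real_def)
    next
      case False
      then have "R n s t \<le> a t - a s" using that by (simp add: K_def)
      moreover have "a t \<le> \<alpha>" using dyadic_approx_le[OF F] by (simp add: a_def)
      ultimately show ?thesis by simp
    qed
    then show "\<exists>N. \<forall>t\<ge>N. (1/2) ^ (n + 4) * (b t - b s) \<le> \<alpha> - a s"
      unfolding R_def by (intro exI[of _ "Suc s"]) auto
  qed
  then show ?thesis using that[of "n + 4"] by (simp add: a_def b_def)
qed

text \<open>Demuth's argument: since \<open>w\<close> increases, disjoint balls around approximations of \<open>\<alpha>\<close>
  correspond to disjoint balls around approximations of \<open>w + \<alpha> / 2\<close> inside the given test.\<close>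

lemma random_plus_left_ce:
  assumes F: "dyadic_approx F \<alpha>" and G: "dyadic_approx G w" and \<alpha>: "ml_random \<alpha>"
  shows "ml_random (w + \<alpha> / 2)"
proof (rule ccontr)
  assume "\<not> ml_random (w + \<alpha> / 2)"
  then obtain V where V: "uniformly_ce_open V" "\<And>n. emeasure lborel (V n) \<le> ennreal ((1/2) ^ n)"
    and in_V: "\<And>n. w + \<alpha> / 2 \<in> V n"
    unfolding ml_random_def by blast
  obtain E where E: "ce 3 (\<lambda>xs. E (hd xs) (hd (tl xs)) (hd (tl (tl xs))))"
    and VE: "\<And>n. V n = \<Union>{{code_real a <..< code_real b} | a b. E n a b}"
    using uniformly_ce_openE[OF V(1)] by blast
  define a where "a s = real (F s) / 2 ^ s" for s
  define \<beta> where "\<beta> s = real (G s) / 2 ^ s + a s / 2" for s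
  define r where "r l = (1/2::real) ^ l" for l :: nat
  define K where "K n = {(s, l). \<exists>u v. E (n + 4) u v \<and> code_real u < \<beta> s - r l / 2 \<and> \<beta> s + r l / 2 < code_real v}" for n
  define T where "T n = (\<Union>(s, l)\<in>K n. ball (a s) (r l))" for n
  let ?lo = "\<lambda>s l. rat_code ((2 * G s + F s) * 2 ^ l) (2 ^ s) (2 ^ Suc (s + l))"
  let ?hi = "\<lambda>s l. rat_code ((2 * G s + F s) * 2 ^ l + 2 ^ s) 0 (2 ^ Suc (s + l))"
  let ?in = "\<lambda>n s l. \<exists>u v. E (n + 4) u v \<and> nat_to_rat_surj u < nat_to_rat_surj (?lo s l)
    \<and> nat_to_rat_surj (?hi s l) < nat_to_rat_surj v"
  let ?Lo = "\<lambda>s l. rat_code (F s * 2 ^ l) (2 ^ s) (2 ^ (s + l))"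
  let ?Hi = "\<lambda>s l. rat_code (F s * 2 ^ l + 2 ^ s) 0 (2 ^ (s + l))"
  let ?E = "\<lambda>n u v. \<exists>s l. ?in n s l \<and> u = ?Lo s l \<and> v = ?Hi s l"
  have ce: "ce 3 (\<lambda>xs. ?E (hd xs) (hd (tl xs)) (hd (tl (tl xs))))"
    by (intro ce_ex ce_conj; (rule ce_subst3[where P = E, OF E] | rule ce_dec);
        (intro rec_intros dec_rat_less total_rec_rat_code dyadic_approx_total_rec[OF F]
        dyadic_approx_total_rec[OF G])?; simp)
  have lo: "code_real (?lo s l) = \<beta> s - r l / 2" and hi: "code_real (?hi s l) = \<beta> s + r l / 2"
    and Lo: "code_real (?Lo s l) = a s - r l" and Hi: "code_real (?Hi s l) = a s + r l" for s l
    unfolding a_def \<beta>_def r_def code_real_rat_code by (simp_all add: power_add power_one_over field_simps)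
  have "of_rat (nat_to_rat_surj u) < (of_rat (nat_to_rat_surj v) :: real) \<longleftrightarrow> nat_to_rat_surj u < nat_to_rat_surj v" for u v
    by (rule of_rat_less)
  then have K: "?in n s l \<longleftrightarrow> (s, l) \<in> K n" for n s l
    unfolding K_def lo[symmetric] hi[symmetric] by simp
  have T: "\<Union>{{code_real u <..< code_real v} | u v. ?E n u v} = T n" for n
  proof -
    have "\<Union>{{code_real u <..< code_real v} | u v. ?E n u v} =
      (\<Union>(s, l)\<in>{(s, l). ?in n s l}. {code_real (?Lo s l) <..< code_real (?Hi s l)})"
      by (rule UN_intervals)
    also have "{(s, l). ?in n s l} = K n" unfolding K by simp
    finally show ?thesis by (simp add: T_def Lo Hi ball_eq_greaterThanLessThan)
  qed
  have meas: "emeasure lborel (T n) \<le> ennreal ((1/2) ^ n)" for n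
  proof -
    let ?K = "{i. prod_decode i \<in> K n}"
    let ?s = "\<lambda>i. fst (prod_decode i)" and ?l = "\<lambda>i. snd (prod_decode i)"
    have r: "0 < r l" "r l \<le> 1" for l by (simp_all add: r_def power_le_one)
    have "T n = (\<Union>i\<in>?K. ball (a (?s i)) (r (?l i)))"
      unfolding T_def by (rule UN_prod_decode)
    also have "emeasure lborel \<dots> \<le> ennreal 10 * emeasure lborel (V (n + 4))"
    proof (rule vitali_measure_bound)
      show "V (n + 4) \<in> sets lborel" unfolding VE sets_lborel by (intro borel_open open_Union) auto
      fix i assume "i \<in> ?K"
      then have i: "(?s i, ?l i) \<in> K n" by simp
      show "0 < r (?l i) \<and> r (?l i) \<le> 1" using r by simp
      show "ball (\<beta> (?s i)) (r (?l i) / 2) \<in> sets lborel \<and> ball (\<beta> (?s i)) (r (?l i) / 2) \<subseteq> V (n + 4)"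
      proof
        obtain u v where uv: "E (n + 4) u v" "code_real u < \<beta> (?s i) - r (?l i) / 2" "\<beta> (?s i) + r (?l i) / 2 < code_real v"
          using i unfolding K_def by auto
        then have "ball (\<beta> (?s i)) (r (?l i) / 2) \<subseteq> {code_real u <..< code_real v}"
          by (auto simp: ball_eq_greaterThanLessThan)
        also have "\<dots> \<subseteq> V (n + 4)" unfolding VE using uv(1) by blast
        finally show "ball (\<beta> (?s i)) (r (?l i) / 2) \<subseteq> V (n + 4)" .
      qed simp
      show "ennreal (10 * r (?l i)) \<le> ennreal 10 * emeasure lborel (ball (\<beta> (?s i)) (r (?l i) / 2))"
        using r[of "?l i"] by (simp add: ball_eq_greaterThanLessThan ennreal_mult)
    next
      fix i j assume far: "r (?l i) + r (?l j) \<le> \<bar>a (?s i) - a (?s j)\<bar>"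
      have expand: "(a t - a s) / 2 \<le> \<beta> t - \<beta> s" "0 \<le> a t - a s" if "s \<le> t" for s t
        using dyadic_approx_mono[OF G that] dyadic_approx_mono[OF F that]
        by (simp_all add: \<beta>_def a_def diff_divide_distrib)
      have "\<bar>a (?s i) - a (?s j)\<bar> / 2 \<le> \<bar>\<beta> (?s i) - \<beta> (?s j)\<bar>"
        using expand[of "?s i" "?s j"] expand[of "?s j" "?s i"] by (cases "?s i \<le> ?s j") auto
      moreover have "(r (?l i) + r (?l j)) / 2 \<le> \<bar>a (?s i) - a (?s j)\<bar> / 2"
        using far by (rule divide_right_mono) simp
      ultimately have "r (?l i) / 2 + r (?l j) / 2 \<le> \<bar>\<beta> (?s i) - \<beta> (?s j)\<bar>"
        unfolding add_divide_distrib by (rule order_trans[rotated])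
      then show "ball (\<beta> (?s i)) (r (?l i) / 2) \<inter> ball (\<beta> (?s j)) (r (?l j) / 2) = {}"
        by (intro disjoint_ballI) (simp add: dist_real_def)
    qed simp
    also have "\<dots> \<le> ennreal 10 * ennreal ((1/2) ^ (n + 4))" by (intro mult_left_mono V(2)) simp
    also have "\<dots> \<le> ennreal ((1/2) ^ n)"
      by (subst ennreal_mult[symmetric]) (auto simp: power_add power_one_over field_simps intro!: ennreal_leI)
    finally show ?thesis .
  qed
  have "\<alpha> \<in> T n" for n
  proof -
    obtain u v where uv: "E (n + 4) u v" "code_real u < w + \<alpha> / 2" "w + \<alpha> / 2 < code_real v"
      using in_V[of "n + 4"] unfolding VE by auto
    define \<epsilon> where "\<epsilon> = min (w + \<alpha> / 2 - code_real u) (code_real v - (w + \<alpha> / 2))"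
    have "0 < \<epsilon>" using uv by (simp add: \<epsilon>_def)
    then obtain l where l: "r l < \<epsilon>" unfolding r_def using real_arch_pow_inv[of \<epsilon> "1/2"] by auto
    have a: "a \<longlonglongrightarrow> \<alpha>" using dyadic_approx_tendsto[OF F] by (simp add: a_def[abs_def])
    have \<beta>: "\<beta> \<longlonglongrightarrow> w + \<alpha> / 2"
      unfolding \<beta>_def by (intro tendsto_intros a dyadic_approx_tendsto[OF G]) simp
    have "\<forall>\<^sub>F s in sequentially. dist (a s) \<alpha> < r l \<and> dist (\<beta> s) (w + \<alpha> / 2) < \<epsilon> / 2"
      using tendstoD[OF a, of "r l"] tendstoD[OF \<beta>, of "\<epsilon> / 2"] \<open>0 < \<epsilon>\<close>
      by (simp add: eventually_conj_iff r_def)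
    then obtain s where s: "dist (a s) \<alpha> < r l" "dist (\<beta> s) (w + \<alpha> / 2) < \<epsilon> / 2"
      by (auto dest: eventually_happens)
    have "code_real u < \<beta> s - r l / 2" "\<beta> s + r l / 2 < code_real v"
    proof -
      have "w + \<alpha> / 2 - \<beta> s < \<epsilon> / 2" "\<beta> s - (w + \<alpha> / 2) < \<epsilon> / 2"
        using s(2) unfolding dist_real_def abs_less_iff by simp_all
      moreover have "\<epsilon> \<le> w + \<alpha> / 2 - code_real u" "\<epsilon> \<le> code_real v - (w + \<alpha> / 2)"
        by (simp_all add: \<epsilon>_def)
      ultimately show "code_real u < \<beta> s - r l / 2" "\<beta> s + r l / 2 < code_real v"
        using l by linarith+
    qed
    then have "(s, l) \<in> K n" using uv(1) by (auto simp: K_def)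
    with s(1) show ?thesis by (auto simp: T_def intro!: bexI[of _ "(s, l)"])
  qed
  with not_ml_randomI[OF ce, of \<alpha>] \<alpha> meas show False unfolding T by blast
qed

section \<open>Plain machines\<close>

lemma dyadic_approx_machine:
  assumes "turing_machine U"
  obtains F where "dyadic_approx F (halting_probability U)"
proof -
  have "ce 1 (\<lambda>xs. str_decode (hd xs) \<in> dom U)"
    by (intro ce_dom assms total_rec_var) simp
  then obtain S where S: "dec (Suc 1) (\<lambda>ys. S (hd ys) (tl ys))"
    and dom: "\<And>xs. length xs = 1 \<Longrightarrow> str_decode (hd xs) \<in> dom U \<longleftrightarrow> (\<exists>s. S s xs)"
    by (rule ceE) blast
  define R where "R t x = S t [x]" for t x
  have R: "dec k (\<lambda>xs. R (F xs) (G xs))" if "total_rec k F" "total_rec k G" for k F G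
    using dec_list_comp[of "[F, G]" "\<lambda>ys. S (hd ys) (tl ys)" k] S that by (auto simp: R_def)
  have dom: "\<tau> \<in> dom U \<longleftrightarrow> (\<exists>t. R t (str_code \<tau>))" for \<tau>
    using dom[of "[str_code \<tau>]"] by (simp add: R_def)
  define C where "C s x \<longleftrightarrow> (\<exists>p\<le>x. (\<exists>q\<le>x. x = p + 2 ^ strlen p * q) \<and> (\<exists>t<s. R t p))" for s x
  define F where "F s = (\<Sum>x<2 ^ Suc s. of_bool (strlen x = s \<and> C s x) :: nat)" for s
  have F: "total_rec 1 (\<lambda>xs. F (hd xs))"
    unfolding F_def C_def by (intro rec_intros total_rec_strlen R) simp_all
  have C: "C s (str_code \<tau>) \<longleftrightarrow> (\<exists>n\<le>length \<tau>. \<exists>t<s. R t (str_code (take n \<tau>)))" for s \<tau>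
  proof
    assume "C s (str_code \<tau>)"
    then obtain p q t where "str_code \<tau> = p + 2 ^ strlen p * q" and t: "t < s" "R t p"
      unfolding C_def by blast
    then have "str_decode (str_code \<tau>) = str_decode p @ str_decode q"
      unfolding str_decode_append_iff by (simp add: strlen_def)
    then have "p = str_code (take (strlen p) \<tau>)" "strlen p \<le> length \<tau>" by (simp_all add: strlen_def)
    with t show "\<exists>n\<le>length \<tau>. \<exists>t<s. R t (str_code (take n \<tau>))" by metis
  next
    assume "\<exists>n\<le>length \<tau>. \<exists>t<s. R t (str_code (take n \<tau>))"
    then obtain n t where n: "n \<le> length \<tau>" and t: "t < s" "R t (str_code (take n \<tau>))" by blast
    let ?p = "str_code (take n \<tau>)" and ?q = "str_code (drop n \<tau>)"
    have eq: "str_code \<tau> = ?p + 2 ^ strlen ?p * ?q"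
      using str_code_append[of "take n \<tau>" "drop n \<tau>"] by (simp add: strlen_def)
    then have "?p \<le> str_code \<tau>" by linarith
    moreover have "?q \<le> 2 ^ strlen ?p * ?q" by simp
    with eq have "?q \<le> str_code \<tau>" by linarith
    ultimately show "C s (str_code \<tau>)" unfolding C_def using eq t by blast
  qed
  define H where "H s = {\<omega>. \<exists>n\<le>s. \<exists>t<s. R t (str_code (stake n \<omega>))}" for s
  have H: "H s = {\<omega>. stake s \<omega> \<in> {\<tau>. C s (str_code \<tau>)}}" for s
    unfolding H_def C by (auto simp: take_stake min_def intro: exI[where x = "_ :: nat"])
  have meas: "measure coin (H s) = real (F s) / 2 ^ s" for s
  proof -
    have img: "str_code ` {\<tau> \<in> {\<tau>. C s (str_code \<tau>)}. length \<tau> = s} = {..<2 ^ Suc s} \<inter> {x. strlen x = s \<and> C s x}"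
    proof (intro equalityI subsetI)
      fix x assume "x \<in> {..<2 ^ Suc s} \<inter> {x. strlen x = s \<and> C s x}"
      then show "x \<in> str_code ` {\<tau> \<in> {\<tau>. C s (str_code \<tau>)}. length \<tau> = s}"
        by (intro image_eqI[of _ _ "str_decode x"]) (auto simp: strlen_def)
    next
      fix x assume "x \<in> str_code ` {\<tau> \<in> {\<tau>. C s (str_code \<tau>)}. length \<tau> = s}"
      then obtain \<tau> where "x = str_code \<tau>" "C s (str_code \<tau>)" "length \<tau> = s" by blast
      moreover from this have "x < 2 ^ Suc s" using str_code_bounds(2)[of \<tau>] by auto
      ultimately show "x \<in> {..<2 ^ Suc s} \<inter> {x. strlen x = s \<and> C s x}" by (simp add: strlen_def)
    qed
    have "F s = card ({..<2 ^ Suc s} \<inter> {x. strlen x = s \<and> C s x})"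
      by (simp only: F_def sum_of_bool_eq finite_lessThan of_nat_id)
    also have "\<dots> = card {\<tau> \<in> {\<tau>. C s (str_code \<tau>)}. length \<tau> = s}"
      unfolding img[symmetric] by (rule card_image) (rule inj_onI, rule inj_str_code)
    finally show ?thesis unfolding H measure_stake_set by simp
  qed
  have inc: "H s \<subseteq> H t" if "s \<le> t" for s t
    unfolding H_def using that by (blast intro: le_trans less_le_trans)
  have "(\<Union>s. H s) = hit (dom U)"
  proof (intro equalityI subsetI)
    fix \<omega> assume "\<omega> \<in> hit (dom U)"
    then obtain n t where nt: "R t (str_code (stake n \<omega>))" unfolding hit_def dom by blast
    have "n \<le> Suc (max n t)" "t < Suc (max n t)" by simp_all
    with nt have "\<omega> \<in> H (Suc (max n t))" unfolding H_def by blast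
    then show "\<omega> \<in> (\<Union>s. H s)" by blast
  next
    fix \<omega> assume "\<omega> \<in> (\<Union>s. H s)"
    then show "\<omega> \<in> hit (dom U)" unfolding H_def hit_def dom by blast
  qed
  moreover have sets: "H s \<in> sets coin" for s unfolding H by (rule sets_stake)
  moreover have "(\<lambda>s. measure coin (H s)) \<longlonglongrightarrow> measure coin (\<Union>s. H s)"
    by (rule coin.finite_Lim_measure_incseq) (use sets inc in \<open>auto simp: incseq_def\<close>)
  ultimately have "(\<lambda>s. real (F s) / 2 ^ s) \<longlonglongrightarrow> halting_probability U"
    by (simp only: halting_probability_hit meas)
  moreover have "incseq (\<lambda>s. real (F s) / 2 ^ s)"
    unfolding incseq_def meas[symmetric] by (intro allI impI coin.finite_measure_mono inc sets)
  ultimately show ?thesis using F by (intro that[of F]) (simp add: dyadic_approx_def)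
qed

lemma dyadic_approx_add:
  assumes "dyadic_approx F z" "dyadic_approx G w"
  shows "dyadic_approx (\<lambda>s. F s + G s) (z + w)"
  using assms unfolding dyadic_approx_def
  by (auto simp: add_divide_distrib incseq_def intro!: add_mono tendsto_add total_rec_add)

lemma dyadic_approx_scale:
  assumes F: "dyadic_approx F z"
  shows "dyadic_approx (\<lambda>s. if s < k then 0 else F (s - k)) ((1/2) ^ k * z)"
proof -
  let ?G = "\<lambda>s. if s < k then 0 else F (s - k)"
  have G: "real (?G s) / 2 ^ s = (if s < k then 0 else (1/2) ^ k * (real (F (s - k)) / 2 ^ (s - k)))" for s
    by (auto simp: power_one_over simp flip: power_add)
  have "total_rec 1 (\<lambda>xs. ?G (hd xs))"
    by (intro rec_intros dyadic_approx_total_rec[OF F]) simp_all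
  moreover have "incseq (\<lambda>s. real (?G s) / 2 ^ s)"
    unfolding incseq_def G using dyadic_approx_mono[OF F] by (auto intro!: mult_left_mono diff_le_mono simp del: times_divide_eq_right)
  moreover have "(\<lambda>s. real (?G s) / 2 ^ s) \<longlonglongrightarrow> (1/2) ^ k * z"
  proof (rule LIMSEQ_offset[where k = k])
    show "(\<lambda>s. real (?G (s + k)) / 2 ^ (s + k)) \<longlonglongrightarrow> (1/2) ^ k * z"
      unfolding G using dyadic_approx_tendsto[OF F]
      by (auto intro!: tendsto_mult simp del: times_divide_eq_right)
  qed
  ultimately show ?thesis by (simp add: dyadic_approx_def)
qed

lemma dyadic_approx_of_bounded:
  assumes H: "total_rec 1 (\<lambda>xs. H (hd xs))" and le: "\<And>s. real (H s) / 2 ^ s \<le> z"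
    and lim: "(\<lambda>s. real (H s) / 2 ^ s) \<longlonglongrightarrow> z"
  obtains F where "dyadic_approx F z"
proof -
  define F where "F s = rec_nat (H 0) (\<lambda>s r. if 2 * r \<le> H (Suc s) then H (Suc s) else 2 * r) s" for s
  note Hc = total_rec_comp1[where f = H, OF H]
  have "total_rec 1 (\<lambda>xs. F (hd xs))"
    unfolding F_def by (rule total_rec_primrec; (intro rec_intros Hc)?; simp?)
  moreover have F0: "F 0 = H 0" and FS: "F (Suc s) = max (2 * F s) (H (Suc s))" for s
    by (simp_all add: F_def max_def)
  have "incseq (\<lambda>s. real (F s) / 2 ^ s)"
  proof (rule incseq_SucI)
    fix s
    have "real (F s) / 2 ^ s = real (2 * F s) / 2 ^ Suc s" by simp
    also have "\<dots> \<le> real (F (Suc s)) / 2 ^ Suc s" unfolding FS by (intro divide_right_mono) simp_all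
    finally show "real (F s) / 2 ^ s \<le> real (F (Suc s)) / 2 ^ Suc s" .
  qed
  moreover have "real (F s) / 2 ^ s \<le> z" for s
  proof (induction s)
    case 0
    show ?case using le[of 0] by (simp add: F0)
  next
    case (Suc s)
    have "real (2 * F s) / 2 ^ Suc s \<le> z" using Suc by simp
    moreover have "F (Suc s) = 2 * F s \<or> F (Suc s) = H (Suc s)" unfolding FS by (simp add: max_def)
    ultimately show ?case using le[of "Suc s"] by auto
  qed
  moreover have "H s \<le> F s" for s by (cases s) (simp_all add: F0 FS)
  ultimately have "(\<lambda>s. real (F s) / 2 ^ s) \<longlonglongrightarrow> z"
    by (intro tendsto_sandwich[OF _ _ lim tendsto_const] always_eventually allI divide_right_mono) auto
  then show ?thesis
    using \<open>total_rec 1 (\<lambda>xs. F (hd xs))\<close> \<open>incseq (\<lambda>s. real (F s) / 2 ^ s)\<close>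
    by (intro that[of F]) (simp add: dyadic_approx_def)
qed

fun binary_value :: "bool list \<Rightarrow> nat" where
  "binary_value [] = 0"
| "binary_value (b # \<tau>) = of_bool b * 2 ^ length \<tau> + binary_value \<tau>"

lemma binary_value_less: "binary_value \<tau> < 2 ^ length \<tau>"
  by (induction \<tau>) auto

lemma binary_value_inj: "length \<sigma> = length \<tau> \<Longrightarrow> binary_value \<sigma> = binary_value \<tau> \<Longrightarrow> \<sigma> = \<tau>"
proof (induction \<sigma> \<tau> rule: list_induct2)
  case (Cons b \<sigma> c \<tau>)
  then have "b = c"
    using binary_value_less[of \<sigma>] binary_value_less[of \<tau>] by (cases b; cases c) auto
  with Cons show ?case by simp
qed simp

lemma binary_value_surj: "v < 2 ^ n \<Longrightarrow> \<exists>\<tau>. length \<tau> = n \<and> binary_value \<tau> = v"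
proof (induction n arbitrary: v)
  case (Suc n)
  let ?b = "2 ^ n \<le> v"
  have "v - of_bool ?b * 2 ^ n < 2 ^ n" using Suc.prems by (cases ?b) auto
  then obtain \<tau> where "length \<tau> = n" "binary_value \<tau> = v - of_bool ?b * 2 ^ n" using Suc.IH by blast
  then show ?case by (intro exI[of _ "?b # \<tau>"]) (cases ?b; simp)
qed simp

lemma binary_value_snoc: "binary_value (\<tau> @ [b]) = 2 * binary_value \<tau> + of_bool b"
  by (induction \<tau>) auto

lemma binary_value_replicate_False: "binary_value (replicate m False) = 0"
  by (induction m) auto

lemma nbit_str_code: "i < length \<tau> \<Longrightarrow> nbit (Suc (str_code \<tau>)) i \<longleftrightarrow> \<tau> ! i"
proof (induction \<tau> arbitrary: i)
  case (Cons b \<tau>)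
  have code: "Suc (str_code (b # \<tau>)) = of_bool b + 2 * Suc (str_code \<tau>)" by simp
  show ?case
  proof (cases i)
    case 0
    show ?thesis unfolding 0 nbit_def code by (cases b) simp_all
  next
    case (Suc j)
    have "Suc (str_code (b # \<tau>)) div 2 = Suc (str_code \<tau>)" unfolding code by (cases b) simp_all
    then have "Suc (str_code (b # \<tau>)) div 2 ^ Suc j = Suc (str_code \<tau>) div 2 ^ j"
      unfolding power_Suc div_mult2_eq by (rule arg_cong)
    with Cons Suc show ?thesis by (simp only: nbit_def nth_Cons_Suc list.size Suc_less_eq add_Suc_right add_0_right)
  qed
qed simp

lemma binary_value_sum: "binary_value \<tau> = (\<Sum>i<length \<tau>. of_bool (\<tau> ! i) * 2 ^ (length \<tau> - Suc i))"
  by (induction \<tau>) (simp_all add: sum.lessThan_Suc_shift del: sum.lessThan_Suc)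

lemma total_rec_binary_value:
  assumes "total_rec k F"
  shows "total_rec k (\<lambda>xs. binary_value (str_decode (F xs)))"
proof (rule total_rec_comp1[OF _ assms])
  have "total_rec 1 (\<lambda>xs. \<Sum>i<strlen (hd xs). of_bool (nbit (Suc (hd xs)) i) * 2 ^ (strlen (hd xs) - Suc i))"
    by (intro rec_intros dec_nbit total_rec_strlen) simp_all
  moreover have "(\<Sum>i<strlen x. of_bool (nbit (Suc x) i) * 2 ^ (strlen x - Suc i)) = binary_value (str_decode x)" for x
    unfolding binary_value_sum strlen_def using nbit_str_code[of _ "str_decode x"] by (intro sum.cong) simp_all
  ultimately show "total_rec 1 (\<lambda>xs. binary_value (str_decode (hd xs)))" by simp
qed

lemma realize_left_ce:
  assumes F: "dyadic_approx F \<beta>" and \<beta>: "0 < \<beta>" "\<beta> \<le> 1" and V: "turing_machine V"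
  obtains U \<kappa> where "turing_machine U" "halting_probability U = \<beta>" "\<And>\<rho>. U (\<kappa> @ \<rho>) = V \<rho>"
proof -
  define R where "R = {\<tau>. \<exists>s. (binary_value \<tau> + 1) * 2 ^ s \<le> F s * 2 ^ length \<tau>}"
  define N :: machine where "N = (\<lambda>\<tau>. if \<tau> \<in> R then Some [] else None)"
  have N: "turing_machine N"
  proof -
    have "ce 2 (\<lambda>xs. hd xs = 0 \<and> (\<exists>s. (binary_value (str_decode (hd (tl xs))) + 1) * 2 ^ s \<le> F s * 2 ^ strlen (hd (tl xs))))"
      by (intro ce_conj ce_ex ce_dec rec_intros total_rec_binary_value total_rec_strlen
          dyadic_approx_total_rec[OF F]) simp_all
    moreover have "N (str_decode x) = Some (str_decode y) \<longleftrightarrow>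
      y = 0 \<and> (\<exists>s. (binary_value (str_decode x) + 1) * 2 ^ s \<le> F s * 2 ^ strlen x)" for x y
      using str_code_eq_iff[of "[]" y] unfolding N_def R_def strlen_def by auto
    ultimately show ?thesis unfolding turing_machine_iff_ce by simp
  qed
  have R_real: "\<tau> \<in> R \<longleftrightarrow> (\<exists>s. (real (binary_value \<tau>) + 1) / 2 ^ length \<tau> \<le> real (F s) / 2 ^ s)" for \<tau>
  proof -
    have "(binary_value \<tau> + 1) * 2 ^ s \<le> F s * 2 ^ length \<tau> \<longleftrightarrow>
      (real (binary_value \<tau>) + 1) / 2 ^ length \<tau> \<le> real (F s) / 2 ^ s" for s
    proof -
      have "(binary_value \<tau> + 1) * 2 ^ s \<le> F s * 2 ^ length \<tau> \<longleftrightarrow>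
        real ((binary_value \<tau> + 1) * 2 ^ s) \<le> real (F s * 2 ^ length \<tau>)" by (rule of_nat_le_iff[symmetric])
      also have "\<dots> \<longleftrightarrow> (real (binary_value \<tau>) + 1) / 2 ^ length \<tau> \<le> real (F s) / 2 ^ s"
        by (simp add: divide_simps algebra_simps)
      finally show ?thesis .
    qed
    then show ?thesis unfolding R_def by blast
  qed
  have R_snoc: "\<tau> @ [b] \<in> R" if "\<tau> \<in> R" for \<tau> b
  proof -
    have "(real (binary_value (\<tau> @ [b])) + 1) / 2 ^ length (\<tau> @ [b]) \<le> (real (binary_value \<tau>) + 1) / 2 ^ length \<tau>"
      by (cases b) (simp_all add: binary_value_snoc field_simps)
    with that show ?thesis unfolding R_real using order_trans by blast
  qed
  have "\<exists>s. 0 < real (F s) / 2 ^ s"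
  proof (rule ccontr)
    assume "\<nexists>s. 0 < real (F s) / 2 ^ s"
    then have "\<beta> \<le> 0" by (intro LIMSEQ_le_const2[OF dyadic_approx_tendsto[OF F]]) (auto simp: not_less)
    with \<beta>(1) show False by simp
  qed
  then obtain m where m: "0 < F m" by (auto simp: zero_less_divide_iff)
  define \<zeta> where "\<zeta> = replicate m False"
  define \<kappa> where "\<kappa> = \<zeta> @ [True]"
  have \<zeta>: "\<zeta> \<in> R"
    using m unfolding R_def \<zeta>_def by (auto simp: binary_value_replicate_False intro!: exI[of _ m])
  have R_pre: "\<tau> \<in> R \<Longrightarrow> prefix \<tau> \<sigma> \<Longrightarrow> \<sigma> \<in> R" for \<tau> \<sigma>
    by (induction \<sigma> rule: rev_induct) (auto simp: R_snoc)
  have "hit (dom (graft \<kappa> V N)) = hit R"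
  proof (intro equalityI subsetI)
    fix \<omega> assume "\<omega> \<in> hit (dom (graft \<kappa> V N))"
    then obtain n where "stake n \<omega> \<in> dom (graft \<kappa> V N)" by (auto simp: hit_def)
    then have "stake n \<omega> \<in> R \<or> prefix \<kappa> (stake n \<omega>)"
      by (auto simp: graft_def N_def dom_def split: if_splits)
    moreover have "\<kappa> \<in> R" unfolding \<kappa>_def by (rule R_snoc[OF \<zeta>])
    ultimately show "\<omega> \<in> hit R" using R_pre by (auto simp: hit_def)
  next
    fix \<omega> assume "\<omega> \<in> hit R"
    then obtain n where n: "stake n \<omega> \<in> R" by (auto simp: hit_def)
    show "\<omega> \<in> hit (dom (graft \<kappa> V N))"
    proof (cases "prefix \<kappa> (stake n \<omega>)")
      case True
      then have "prefix \<zeta> (stake n \<omega>)" unfolding \<kappa>_def by (auto simp: prefix_def)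
      then have "stake (length \<zeta>) \<omega> = \<zeta>"
        by (metis append_eq_conv_conj length_stake prefix_def prefix_length_le take_stake min.absorb1)
      moreover have "\<not> prefix \<kappa> \<zeta>" unfolding \<kappa>_def by (auto dest: prefix_length_le)
      ultimately have "stake (length \<zeta>) \<omega> \<in> dom (graft \<kappa> V N)"
        using \<zeta> by (auto simp: graft_def N_def dom_def)
      then show ?thesis by (auto simp: hit_def)
    next
      case False
      with n have "stake n \<omega> \<in> dom (graft \<kappa> V N)" by (auto simp: graft_def N_def dom_def)
      then show ?thesis by (auto simp: hit_def)
    qed
  qed
  then have hp: "halting_probability (graft \<kappa> V N) = measure coin (hit R)"
    by (simp add: halting_probability_hit)
  define c where "c n = real (card {\<tau> \<in> R. length \<tau> = n}) / 2 ^ n" for n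
  have c: "measure coin {\<omega>. stake n \<omega> \<in> R} = c n" for n
    unfolding c_def by (rule measure_stake_set)
  have inj: "inj_on binary_value {\<tau> \<in> R. length \<tau> = n}" for n
    by (rule inj_onI) (auto intro: binary_value_inj)
  have "c n \<le> \<beta>" for n
  proof -
    let ?S = "binary_value ` {\<tau> \<in> R. length \<tau> = n}"
    have "real v + 1 \<le> \<beta> * 2 ^ n" if v: "v \<in> ?S" for v
    proof -
      obtain \<tau> where \<tau>: "\<tau> \<in> R" "length \<tau> = n" "binary_value \<tau> = v" using v by auto
      then obtain s where "(real v + 1) / 2 ^ n \<le> real (F s) / 2 ^ s" using R_real[of \<tau>] by blast
      also have "\<dots> \<le> \<beta>" by (rule dyadic_approx_le[OF F])
      finally show ?thesis by (simp add: divide_le_eq)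
    qed
    then have "int v + 1 \<le> \<lfloor>\<beta> * 2 ^ n\<rfloor>" if "v \<in> ?S" for v
      using that by (simp only: le_floor_iff) simp
    then have "?S \<subseteq> {..<nat \<lfloor>\<beta> * 2 ^ n\<rfloor>}"
      unfolding subset_iff lessThan_iff zless_nat_eq_int_zless by (unfold add1_zle_eq, blast)
    then have "card ?S \<le> nat \<lfloor>\<beta> * 2 ^ n\<rfloor>" using card_mono[of "{..<nat \<lfloor>\<beta> * 2 ^ n\<rfloor>}" ?S] by simp
    then have "real (card ?S) \<le> real (nat \<lfloor>\<beta> * 2 ^ n\<rfloor>)" by (simp only: of_nat_le_iff)
    also have "\<dots> \<le> \<beta> * 2 ^ n" using \<beta>(1) by (intro of_nat_floor) simp
    finally have "real (card ?S) \<le> \<beta> * 2 ^ n" .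
    then show ?thesis unfolding c_def card_image[OF inj] by (simp add: divide_le_eq)
  qed
  moreover have "incseq (\<lambda>n. {\<omega>. stake n \<omega> \<in> R})"
    by (rule incseq_SucI) (auto simp: stake_Suc R_snoc simp del: stake.simps)
  then have "c \<longlonglongrightarrow> measure coin (hit R)"
    using coin.finite_Lim_measure_incseq[of "\<lambda>n. {\<omega>. stake n \<omega> \<in> R}"]
    by (simp add: c image_subset_iff hit_def Collect_ex_eq)
  ultimately have le: "measure coin (hit R) \<le> \<beta>"
    by (intro LIMSEQ_le_const2) auto
  have "real (F s) / 2 ^ s \<le> measure coin (hit R)" for s
  proof -
    have "real (F s) / 2 ^ s \<le> 1" using dyadic_approx_le[OF F, of s] \<beta>(2) by linarith
    then have "real (F s) \<le> real (2 ^ s)" by (simp add: divide_le_eq)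
    then have Fs: "F s \<le> 2 ^ s" by (simp only: of_nat_le_iff)
    have "{..<F s} \<subseteq> binary_value ` {\<tau> \<in> R. length \<tau> = s}"
    proof
      fix v assume v: "v \<in> {..<F s}"
      then obtain \<tau> where \<tau>: "length \<tau> = s" "binary_value \<tau> = v"
        using binary_value_surj[of v s] Fs by auto
      have "(binary_value \<tau> + 1) * 2 ^ s \<le> F s * 2 ^ length \<tau>"
        unfolding \<tau> using v by (intro mult_le_mono) auto
      then have "\<tau> \<in> R" unfolding R_def by blast
      with \<tau> show "v \<in> binary_value ` {\<tau> \<in> R. length \<tau> = s}" by auto
    qed
    then have "card {..<F s} \<le> card (binary_value ` {\<tau> \<in> R. length \<tau> = s})"
      by (rule card_mono[OF finite_imageI[OF finite_strings]])
    then have "F s \<le> card {\<tau> \<in> R. length \<tau> = s}" unfolding card_image[OF inj] by simp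
    then have "real (F s) / 2 ^ s \<le> c s" unfolding c_def by (intro divide_right_mono) simp_all
    also have "\<dots> \<le> measure coin (hit R)"
      unfolding c[symmetric] by (rule coin.finite_measure_mono[OF _ sets_hit]) (auto simp: hit_def)
    finally show ?thesis .
  qed
  then have "\<beta> \<le> measure coin (hit R)"
    by (intro LIMSEQ_le_const2[OF dyadic_approx_tendsto[OF F]]) auto
  with le hp have "halting_probability (graft \<kappa> V N) = \<beta>" by simp
  then show ?thesis using turing_machine_graft[OF V N] by (intro that[of "graft \<kappa> V N" \<kappa>]) simp_all
qed

lemma plain_part:
  assumes M: "effective_list turing_machine M" and U0: "universal_by_adjunction turing_machine M U\<^sub>0"
    and rand: "ml_random (halting_probability U\<^sub>0)" and A: "ce_set A" and B: "ce_set B"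
  obtains U\<^sub>1 k where "universal_by_adjunction turing_machine M U\<^sub>1" "ml_random (halting_probability U\<^sub>1)"
    "halting_probability U\<^sub>0 = halting_probability U\<^sub>1 + (1/2) ^ k * (base2 B - base2 A)"
proof -
  define \<alpha> where "\<alpha> = halting_probability U\<^sub>0"
  define x where "x = base2 A"
  define y where "y = base2 B"
  have tm0: "turing_machine U\<^sub>0" using U0 by (simp add: universal_by_adjunction_def)
  obtain F where F: "dyadic_approx F \<alpha>" using dyadic_approx_machine[OF tm0] unfolding \<alpha>_def by blast
  have tm: "turing_machine (unary X)" if "ce_set X" for X
    using prefix_free_unary[OF that] by (simp add: prefix_free_machine_def)
  obtain X where X: "dyadic_approx X x"
    using dyadic_approx_machine[OF tm[OF A]] unfolding x_def halting_probability_unary by blast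
  obtain Y where Y: "dyadic_approx Y y"
    using dyadic_approx_machine[OF tm[OF B]] unfolding y_def halting_probability_unary by blast
  have xy: "0 \<le> x" "x \<le> 1" "0 \<le> y" "y \<le> 1"
    unfolding x_def y_def halting_probability_unary[symmetric] halting_probability_hit by simp_all
  have "0 \<le> \<alpha>" "\<alpha> \<le> 1" unfolding \<alpha>_def halting_probability_hit by simp_all
  moreover have "\<alpha> \<noteq> 0" "\<alpha> \<noteq> 1"
    using rand not_ml_random_of_nat[of 0] not_ml_random_of_nat[of 1] unfolding \<alpha>_def by auto
  ultimately have \<alpha>: "0 < \<alpha>" "\<alpha> < 1" by simp_all
  obtain n0 where n0: "\<And>s. (1/2) ^ n0 * (y - real (Y s) / 2 ^ s) \<le> \<alpha> - real (F s) / 2 ^ s"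
    using random_dominates[OF F Y xy(4)] rand unfolding \<alpha>_def by blast
  obtain n1 where n1: "(1/2) ^ n1 < min \<alpha> (1 - \<alpha>)"
    using real_arch_pow_inv[of "min \<alpha> (1 - \<alpha>)" "1/2"] \<alpha> by auto
  define n where "n = max n0 n1"
  have n_n0: "(1/2) ^ n \<le> (1/2 :: real) ^ n0" and n_n1: "(1/2) ^ n \<le> (1/2 :: real) ^ n1"
    by (simp_all add: n_def power_decreasing)
  have n_small: "(1/2) ^ n < \<alpha>" "(1/2) ^ n < 1 - \<alpha>"
    using n1 by (intro le_less_trans[OF n_n1]; simp)+
  have dom: "(1/2) ^ n * (y - real (Y s) / 2 ^ s) \<le> \<alpha> - real (F s) / 2 ^ s" for s
    using mult_right_mono[OF n_n0, of "y - real (Y s) / 2 ^ s"] dyadic_approx_le[OF Y, of s] n0[of s]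
    by linarith
  define c where "c = (1/2 :: real) ^ n"
  have c: "0 < c" "2 ^ n * c = 1" by (simp_all add: c_def power_one_over)
  define h where "h = 2 ^ n * \<alpha> - y"
  have h: "0 \<le> h"
  proof -
    have "1 \<le> 2 ^ n * \<alpha>"
      using n_small(1) c mult_left_mono[of c \<alpha> "2 ^ n"] by (simp add: c_def)
    with xy(4) show ?thesis by (simp add: h_def)
  qed
  let ?H = "\<lambda>s. F s * 2 ^ n - Y s"
  have H: "real (?H s) / 2 ^ s = max (2 ^ n * (real (F s) / 2 ^ s) - real (Y s) / 2 ^ s) 0" for s
  proof (cases "Y s \<le> F s * 2 ^ n")
    case True
    then have "real (Y s) \<le> real (F s * 2 ^ n)" by (simp only: of_nat_le_iff)
    then have "real (?H s) / 2 ^ s = 2 ^ n * (real (F s) / 2 ^ s) - real (Y s) / 2 ^ s"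
      using True by (simp add: of_nat_diff diff_divide_distrib)
    moreover have "0 \<le> real (?H s) / 2 ^ s" by simp
    ultimately show ?thesis by (simp only: max_absorb1)
  next
    case False
    then have "real (F s * 2 ^ n) \<le> real (Y s)" by (simp only: of_nat_le_iff)
    then have "2 ^ n * (real (F s) / 2 ^ s) - real (Y s) / 2 ^ s \<le> 0"
      by (simp add: divide_right_mono mult.commute)
    then show ?thesis using False by (simp add: max_absorb2)
  qed
  obtain G where G: "dyadic_approx G h"
  proof (rule dyadic_approx_of_bounded[where H = ?H and z = h])
    show "total_rec 1 (\<lambda>xs. ?H (hd xs))"
      by (intro rec_intros dyadic_approx_total_rec[OF F] dyadic_approx_total_rec[OF Y]) simp_all
    show "real (?H s) / 2 ^ s \<le> h" for s
    proof -
      have "2 ^ n * (c * (y - real (Y s) / 2 ^ s)) \<le> 2 ^ n * (\<alpha> - real (F s) / 2 ^ s)"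
        using dom[of s] unfolding c_def by (intro mult_left_mono) simp_all
      then have "y - real (Y s) / 2 ^ s \<le> 2 ^ n * \<alpha> - 2 ^ n * (real (F s) / 2 ^ s)"
        unfolding mult.assoc[symmetric] c(2) by (simp only: mult_1_left right_diff_distrib)
      then show ?thesis unfolding H h_def using h[unfolded h_def] by (intro max.boundedI) linarith+
    qed
    have "(\<lambda>s. max (2 ^ n * (real (F s) / 2 ^ s) - real (Y s) / 2 ^ s) 0) \<longlonglongrightarrow> max h 0"
      unfolding h_def by (intro tendsto_intros dyadic_approx_tendsto[OF F] dyadic_approx_tendsto[OF Y])
    then show "(\<lambda>s. real (?H s) / 2 ^ s) \<longlonglongrightarrow> h" unfolding H using h by (simp only: max_absorb1)
  qed
  define w where "w = (1/2) ^ Suc n * h + (1/2) ^ Suc n * x"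
  define \<beta> where "\<beta> = w + \<alpha> / 2"
  have \<beta>_eq: "\<beta> = \<alpha> - (1/2) ^ Suc n * (y - x)"
  proof -
    have "c * (2 ^ n * \<alpha>) = (2 ^ n * c) * \<alpha>" by (simp only: ac_simps)
    then have e: "c * (2 ^ n * \<alpha>) = \<alpha>" by (simp only: c(2) mult_1_left)
    have "\<beta> = (c * (2 ^ n * \<alpha>) - c * y + c * x) / 2 + \<alpha> / 2"
      unfolding \<beta>_def w_def h_def c_def by (simp add: right_diff_distrib add_divide_distrib diff_divide_distrib)
    then have "\<beta> = \<alpha> - c * (y - x) / 2" unfolding e by (simp add: field_simps)
    then show ?thesis by (simp add: c_def)
  qed
  obtain W where W: "dyadic_approx W w"
    using dyadic_approx_add[OF dyadic_approx_scale[OF G, of "Suc n"] dyadic_approx_scale[OF X, of "Suc n"]]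
    unfolding w_def by blast
  have rand\<beta>: "ml_random \<beta>"
    unfolding \<beta>_def by (rule random_plus_left_ce[OF F W]) (use rand in \<open>simp add: \<alpha>_def\<close>)
  obtain S where S: "dyadic_approx S \<beta>"
    using dyadic_approx_add[OF W dyadic_approx_scale[OF F, of 1]] unfolding \<beta>_def by auto
  have "0 < \<beta>" unfolding \<beta>_def w_def using h xy \<alpha> by (simp add: add_nonneg_pos)
  moreover have "\<beta> \<le> 1"
  proof -
    have "c * (x - y) \<le> c * 1" using c xy by (intro mult_left_mono) simp_all
    moreover have "\<beta> = \<alpha> + c * (x - y) / 2" unfolding \<beta>_eq c_def by (simp add: right_diff_distrib diff_divide_distrib)
    ultimately show ?thesis using n_small(2) c(1) unfolding c_def[symmetric] by linarith
  qed
  ultimately obtain U\<^sub>1 \<kappa> where U1: "turing_machine U\<^sub>1" "halting_probability U\<^sub>1 = \<beta>" "\<And>\<rho>. U\<^sub>1 (\<kappa> @ \<rho>) = U\<^sub>0 \<rho>"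
    using realize_left_ce[OF S _ _ tm0] by blast
  show ?thesis
  proof
    show "universal_by_adjunction turing_machine M U\<^sub>1"
      unfolding universal_by_adjunction_def
    proof
      obtain \<sigma> where \<sigma>: "computable_strings \<sigma>" "\<And>e \<tau>. U\<^sub>0 (\<sigma> e @ \<tau>) = M e \<tau>"
        using U0 unfolding universal_by_adjunction_def by blast
      show "\<exists>\<sigma>. computable_strings \<sigma> \<and> (\<forall>e \<tau>. U\<^sub>1 (\<sigma> e @ \<tau>) = M e \<tau>)"
      proof (intro exI conjI allI)
        have "total_rec 1 (\<lambda>xs. str_code \<kappa> + 2 ^ length \<kappa> * str_code (\<sigma> (hd xs)))"
          using \<sigma>(1) by (intro rec_intros) (auto simp: computable_strings_iff)
        then show "computable_strings (\<lambda>e. \<kappa> @ \<sigma> e)"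
          by (simp add: computable_strings_iff str_code_append)
        show "U\<^sub>1 ((\<kappa> @ \<sigma> e) @ \<tau>) = M e \<tau>" for e \<tau>
          by (simp add: U1(3) \<sigma>(2))
      qed
    qed (rule U1)
    show "ml_random (halting_probability U\<^sub>1)" using rand\<beta> U1(2) by simp
    show "halting_probability U\<^sub>0 = halting_probability U\<^sub>1 + (1/2) ^ Suc n * (base2 B - base2 A)"
      unfolding U1(2) \<beta>_eq \<alpha>_def x_def y_def by simp
  qed
qed

theorem corollary1p4:
  fixes M P :: "nat \<Rightarrow> machine"
  assumes "effective_list turing_machine M"
    and "effective_list prefix_free_machine P"
  shows "(\<forall>U0. universal_by_adjunction prefix_free_machine P U0 \<longrightarrow>
            (\<exists>U1. universal_by_adjunction prefix_free_machine P U1 \<and>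
              (\<forall>\<beta>. left_ce \<beta> \<or> right_ce \<beta> \<longrightarrow>
                 halting_probability U0 \<noteq> halting_probability U1 + \<beta>)))
       \<and> (\<forall>U0. universal_by_adjunction turing_machine M U0 \<and> ml_random (halting_probability U0) \<longrightarrow>
            (\<exists>U1. universal_by_adjunction turing_machine M U1 \<and> ml_random (halting_probability U1) \<and>
              (\<forall>\<beta>. left_ce \<beta> \<or> right_ce \<beta> \<longrightarrow>
                 halting_probability U0 \<noteq> halting_probability U1 + \<beta>)))"
proof -
  obtain A B where AB: "ce_set A" "ce_set B"
    and neither: "\<And>k. \<not> left_ce ((1/2) ^ k * (base2 B - base2 A))"
      "\<And>k. \<not> right_ce ((1/2) ^ k * (base2 B - base2 A))"
    using ce_difference[OF assms(1)] by blast
  have separated: "\<forall>\<beta>. left_ce \<beta> \<or> right_ce \<beta> \<longrightarrow> p \<noteq> q + \<beta>"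
    if "p = q + (1/2) ^ k * (base2 B - base2 A)" for p q k
    using that neither[of k] by auto
  show ?thesis
  proof (intro conjI allI impI)
    fix U0 assume "universal_by_adjunction prefix_free_machine P U0"
    from prefix_free_part[OF assms(2) this AB] obtain U1 k
      where "universal_by_adjunction prefix_free_machine P U1"
        and "halting_probability U0 = halting_probability U1 + (1/2) ^ k * (base2 B - base2 A)" by blast
    then show "\<exists>U1. universal_by_adjunction prefix_free_machine P U1 \<and>
        (\<forall>\<beta>. left_ce \<beta> \<or> right_ce \<beta> \<longrightarrow> halting_probability U0 \<noteq> halting_probability U1 + \<beta>)"
      using separated by blast
  next
    fix U0 assume "universal_by_adjunction turing_machine M U0 \<and> ml_random (halting_probability U0)"
    then have "universal_by_adjunction turing_machine M U0" "ml_random (halting_probability U0)" by simp_all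
    from plain_part[OF assms(1) this AB] obtain U1 k
      where "universal_by_adjunction turing_machine M U1" "ml_random (halting_probability U1)"
        and "halting_probability U0 = halting_probability U1 + (1/2) ^ k * (base2 B - base2 A)" by blast
    then show "\<exists>U1. universal_by_adjunction turing_machine M U1 \<and> ml_random (halting_probability U1) \<and>
        (\<forall>\<beta>. left_ce \<beta> \<or> right_ce \<beta> \<longrightarrow> halting_probability U0 \<noteq> halting_probability U1 + \<beta>)"
      using separated by blast
  qed
qed

end
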